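(* Let $0<\alpha<\beta\le1$, $n\in\mathbb{N}$ with $n\ge2$, $p\in[1,\infty]$, and $I=[0,1]$. Then the flow mapping $$\mathrm{Fl}:L^1(I,\mathcal{B}^{n,\beta,p}(\mathbb{R}^d,\mathbb{R}^d))\to C(I,\mathcal{B}^{n,\alpha,p}(\mathbb{R}^d,\mathbb{R}^d)),\qquad u\mapsto\phi_u,$$ is continuous, even Hölder continuous of any order $\gamma<\beta-\alpha$.
   Context: Besov spaces. Let $E,F$ be Banach spaces. $L_k(E;F)$ denotes the bounded $k$-linear maps $E^k\to F$ with the operator norm. $C^n(E,F)$ is the space of $n$-times continuously Fréchet differentiable maps, $f^{(k)}:E\to L_k(E;F)$ is the $k$-th derivative, and $\|f\|_{C^n_b}=\sup_{0\le k\le n}\|f^{(k)}\|_\infty$. For a function $f$ on $E$ with values in a Banach space put $\Delta^2_hf(x)=f(x+2h)-2f(x+h)+f(x)$ and $\eta(f;t)=\sup_{x\in E,\ \|h\|\le t}\|\Delta_h^2f(x)\|$. For $\alpha\in(0,1]$ let $$Z^{\alpha,p}(f)=\Big(\int_0^\infty\Big(\frac{\eta(f;t)}{t^\alpha}\Big)^p\frac{dt}{t}\Big)^{1/p}\ (1\le p<\infty),\qquad Z^{\alpha,\infty}(f)=\sup_{t>0}\frac{\eta(f;t)}{t^\alpha}.$$ For $n\in\mathbb{N}=\{0,1,2,\dots\}$, $$\mathcal{B}^{n,\alpha,p}(E,F)=\{f\in C^n(E,F):\ \|f\|^{\mathcal Z}_{n,\alpha,p}:=\sup\{\|f\|_{C^n_b},\,Z^{\alpha,p}(f^{(n)})\}<\infty\},$$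 normed by $\|\cdot\|^{\mathcal Z}_{n,\alpha,p}$. Domain and codomain. $L^1(I,\mathcal{B}^{n,\beta,p}(\mathbb{R}^d,\mathbb{R}^d))$ is the space of Bochner integrable functions $u:I\to\mathcal{B}^{n,\beta,p}(\mathbb{R}^d,\mathbb{R}^d)$ with norm $\int_0^1\|u(t)\|^{\mathcal Z}_{n,\beta,p}\,dt$; such $u$ is regarded as a time-dependent vector field $u(t,x)=u(t)(x)$. $C(I,\mathcal{B}^{n,\alpha,p}(\mathbb{R}^d,\mathbb{R}^d))$ is the space of continuous curves with the supremum norm over $I$. Flow. The flow of $u$ is the unique map $\Phi_u:I\times\mathbb{R}^d\to\mathbb{R}^d$, with $t\mapsto\Phi_u(t,x)$ absolutely continuous for each $x$, such that $\Phi_u(t,x)=x+\int_0^tu(s,\Phi_u(s,x))\,ds$ for all $t\in I$, $x\in\mathbb{R}^d$. Put $\phi_u(t,x):=\Phi_u(t,x)-x$; $\phi_u$ is regarded as the curve $t\mapsto\phi_u(t,\cdot)$.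
   Formalization: Hölder continuity of order γ (0<γ<β−α) is proved uniformly on bounded subsets of L¹(I,B^{n,β,p}), with a constant depending on the bound; a single constant on the whole space is impossible, since derivatives of the flow grow exponentially in the size of u. *)

theory Defs
  imports "HOL-Analysis.Analysis"
begin

section \<open>Bounded multilinear maps and higher derivatives\<close>

text \<open>
  The order \<open>k\<close> of the derivatives is a variable, so \<open>L\<^sub>k(E;F)\<close> is not a type here. A \<open>k\<close>-linear map
  is a function on lists, and only its values on lists of length \<open>k\<close> matter; for \<open>k = 0\<close> it
  is identified with its value at \<open>[]\<close>.
\<close>

definition bounded_multilinear ::
  "nat \<Rightarrow> ('a::real_normed_vector list \<Rightarrow> 'b::real_normed_vector) \<Rightarrow> bool" where
  "bounded_multilinear k m \<longleftrightarrow>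
     (\<forall>hs i. length hs = k \<longrightarrow> i < k \<longrightarrow> linear (\<lambda>v. m (hs[i := v]))) \<and>
     (\<exists>K. \<forall>hs. length hs = k \<longrightarrow> norm (m hs) \<le> K * (\<Prod>h\<leftarrow>hs. norm h))"

definition mlnorm ::
  "nat \<Rightarrow> ('a::real_normed_vector list \<Rightarrow> 'b::real_normed_vector) \<Rightarrow> ennreal" where
  "mlnorm k m = (SUP hs\<in>{hs. length hs = k \<and> (\<forall>h\<in>set hs. norm h \<le> 1)}. ennreal (norm (m hs)))"

text \<open>
  \<open>nderiv k f x [h\<^sub>1, \<dots>, h\<^sub>k]\<close> is \<open>D\<^sup>kf(x)(h\<^sub>1, \<dots>, h\<^sub>k)\<close>, with the convention
  \<open>D\<^sup>k\<^sup>+\<^sup>1f(x)(h, h\<^sub>1, \<dots>, h\<^sub>k) = (D(D\<^sup>kf)(x) h)(h\<^sub>1, \<dots>, h\<^sub>k)\<close>. The recursion differentiates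
  \<open>D\<^sup>kf\<close> evaluated at fixed arguments. It is meaningful for maps in \<open>Cn\<close>, where differentiability
  is required in the operator norm of \<open>L\<^sub>k(E;F)\<close>.
\<close>

primrec nderiv ::
  "nat \<Rightarrow> ('a::real_normed_vector \<Rightarrow> 'b::real_normed_vector) \<Rightarrow> 'a \<Rightarrow> 'a list \<Rightarrow> 'b" where
  "nderiv 0 f = (\<lambda>x hs. f x)"
| "nderiv (Suc k) f = (\<lambda>x hs. frechet_derivative (\<lambda>y. nderiv k f y (tl hs)) (at x) (hd hs))"

definition frechet_differentiable_ml ::
  "nat \<Rightarrow> ('a::real_normed_vector \<Rightarrow> 'a list \<Rightarrow> 'b::real_normed_vector) \<Rightarrow>
   ('a \<Rightarrow> 'a list \<Rightarrow> 'b) \<Rightarrow> bool" where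
  "frechet_differentiable_ml k G G' \<longleftrightarrow>
     (\<forall>x. bounded_multilinear (Suc k) (G' x) \<and>
          ((\<lambda>h. mlnorm k (\<lambda>hs. G (x + h) hs - G x hs - G' x (h # hs)) / ennreal (norm h))
             \<longlongrightarrow> 0) (at 0))"

definition Cn :: "nat \<Rightarrow> ('a::real_normed_vector \<Rightarrow> 'b::real_normed_vector) set" where
  "Cn n = {f. (\<forall>k<n. frechet_differentiable_ml k (nderiv k f) (nderiv (Suc k) f)) \<and>
              (\<forall>x. ((\<lambda>y. mlnorm n (\<lambda>hs. nderiv n f y hs - nderiv n f x hs)) \<longlongrightarrow> 0) (at x))}"

definition Cb_norm :: "nat \<Rightarrow> ('a::real_normed_vector \<Rightarrow> 'b::real_normed_vector) \<Rightarrow> ennreal" where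
  "Cb_norm n f = (SUP k\<in>{0..n}. SUP x. mlnorm k (nderiv k f x))"


section \<open>Besov spaces\<close>

definition ennpowr :: "ennreal \<Rightarrow> real \<Rightarrow> ennreal" where
  "ennpowr a r = (if a = \<infinity> then \<infinity> else ennreal (enn2real a powr r))"
  \<comment> \<open>only used for \<open>r > 0\<close>\<close>

definition eta ::
  "nat \<Rightarrow> ('a::real_normed_vector \<Rightarrow> 'a list \<Rightarrow> 'b::real_normed_vector) \<Rightarrow> real \<Rightarrow> ennreal" where
  "eta k G t = (SUP x. SUP h\<in>cball 0 t.
     mlnorm k (\<lambda>hs. G (x + 2 *\<^sub>R h) hs - 2 *\<^sub>R G (x + h) hs + G x hs))"

definition Zsemi ::
  "nat \<Rightarrow> real \<Rightarrow> ennreal \<Rightarrow> ('a::real_normed_vector \<Rightarrow> 'a list \<Rightarrow> 'b::real_normed_vector) \<Rightarrow> ennreal"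
  where
  "Zsemi k \<alpha> p G =
     (if p = \<infinity> then (SUP t\<in>{0<..}. eta k G t / ennreal (t powr \<alpha>))
      else ennpowr
        (\<integral>\<^sup>+t\<in>{0<..}. (ennpowr (eta k G t / ennreal (t powr \<alpha>)) (enn2real p) / ennreal t) \<partial>lborel)
        (1 / enn2real p))"

definition besov_norm ::
  "nat \<Rightarrow> real \<Rightarrow> ennreal \<Rightarrow> ('a::real_normed_vector \<Rightarrow> 'b::real_normed_vector) \<Rightarrow> ennreal" where
  "besov_norm n \<alpha> p f = max (Cb_norm n f) (Zsemi n \<alpha> p (nderiv n f))"

definition besov ::
  "nat \<Rightarrow> real \<Rightarrow> ennreal \<Rightarrow> ('a::real_normed_vector \<Rightarrow> 'b::real_normed_vector) set" where
  "besov n \<alpha> p = {f \<in> Cn n. besov_norm n \<alpha> p f < \<infinity>}"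


section \<open>Curves in a normed space given by a carrier and a norm\<close>

text \<open>
  The library's Bochner integral and metric notions are tied to type classes (with a second countable
  target), so for curves on \<open>I = [0,1]\<close> with values in a carrier \<open>V\<close> normed by \<open>N\<close> the
  notions are spelled out. Elements of \<open>L\<^sup>1\<close> are represented by functions, not by classes
  modulo null sets; values outside \<open>I\<close> are irrelevant.
\<close>

definition L1_norm :: "('v \<Rightarrow> ennreal) \<Rightarrow> (real \<Rightarrow> 'v) \<Rightarrow> ennreal" where
  "L1_norm N u = (\<integral>\<^sup>+t. N (u t) \<partial>lebesgue_on {0..1})"

definition L1_curves :: "'v::minus set \<Rightarrow> ('v \<Rightarrow> ennreal) \<Rightarrow> (real \<Rightarrow> 'v) set" where
  "L1_curves V N = {u. (\<forall>t\<in>{0..1}. u t \<in> V) \<and>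
     (\<exists>s. (\<forall>j. simple_function (lebesgue_on {0..1}) (s j) \<and> (\<forall>t\<in>{0..1}. s j t \<in> V)) \<and>
          (AE t in lebesgue_on {0..1}. (\<lambda>j. N (u t - s j t)) \<longlonglongrightarrow> 0) \<and>
          (\<lambda>j. L1_norm N (\<lambda>t. u t - s j t)) \<longlonglongrightarrow> 0)}"

definition C_norm :: "('v \<Rightarrow> ennreal) \<Rightarrow> (real \<Rightarrow> 'v) \<Rightarrow> ennreal" where
  "C_norm N c = (SUP t\<in>{0..1}. N (c t))"

definition C_curves :: "'v::minus set \<Rightarrow> ('v \<Rightarrow> ennreal) \<Rightarrow> (real \<Rightarrow> 'v) set" where
  "C_curves V N = {c. (\<forall>t\<in>{0..1}. c t \<in> V) \<and>
     (\<forall>t\<in>{0..1}. ((\<lambda>s. N (c s - c t)) \<longlongrightarrow> 0) (at t within {0..1}))}"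

definition norm_continuous_on ::
  "'v::minus set \<Rightarrow> ('v \<Rightarrow> ennreal) \<Rightarrow> ('w::minus \<Rightarrow> ennreal) \<Rightarrow> ('v \<Rightarrow> 'w) \<Rightarrow> bool" where
  "norm_continuous_on S N M F \<longleftrightarrow>
     (\<forall>u\<in>S. \<forall>\<epsilon>>0. \<exists>\<delta>>0. \<forall>v\<in>S. N (v - u) < \<delta> \<longrightarrow> M (F v - F u) < \<epsilon>)"

text \<open>
  Hoelder continuity with a constant that is uniform on bounded sets. For the flow map a single
  constant on the whole space is impossible, since derivatives of the flow grow exponentially in
  the norm of the vector field.
\<close>

definition holder_on_bounded ::
  "real \<Rightarrow> 'v::minus set \<Rightarrow> ('v \<Rightarrow> ennreal) \<Rightarrow> ('w::minus \<Rightarrow> ennreal) \<Rightarrow> ('v \<Rightarrow> 'w) \<Rightarrow> bool" where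
  "holder_on_bounded \<gamma> S N M F \<longleftrightarrow>
     (\<forall>R::real. \<exists>C::real. 0 \<le> C \<and>
        (\<forall>u\<in>S. \<forall>v\<in>S. N u \<le> ennreal R \<longrightarrow> N v \<le> ennreal R \<longrightarrow>
           M (F v - F u) \<le> ennreal C * ennpowr (N (v - u)) \<gamma>))"


section \<open>Flows\<close>

definition abs_continuous_on_interval ::
  "real \<Rightarrow> real \<Rightarrow> (real \<Rightarrow> 'a::real_normed_vector) \<Rightarrow> bool" where
  "abs_continuous_on_interval a b f \<longleftrightarrow>
     (\<forall>\<epsilon>>0. \<exists>\<delta>>0. \<forall>D::(real \<times> real) set.
        finite D \<longrightarrow>
        (\<forall>(c,d)\<in>D. a \<le> c \<and> c \<le> d \<and> d \<le> b) \<longrightarrow>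
        pairwise (\<lambda>(c,d) (c',d'). {c<..<d} \<inter> {c'<..<d'} = {}) D \<longrightarrow>
        (\<Sum>(c,d)\<in>D. d - c) < \<delta> \<longrightarrow> (\<Sum>(c,d)\<in>D. norm (f d - f c)) < \<epsilon>)"

text \<open>
  The condition \<open>\<Phi> \<in> extensional {0..1}\<close> fixes the values for times outside \<open>I\<close>, so that
  uniqueness of the flow on \<open>I\<close> is uniqueness of the function \<open>\<Phi>\<close>.
\<close>

definition is_flow ::
  "(real \<Rightarrow> 'a::euclidean_space \<Rightarrow> 'a) \<Rightarrow> (real \<Rightarrow> 'a \<Rightarrow> 'a) \<Rightarrow> bool" where
  "is_flow u \<Phi> \<longleftrightarrow> \<Phi> \<in> extensional {0..1} \<and>
     (\<forall>x. abs_continuous_on_interval 0 1 (\<lambda>t. \<Phi> t x) \<and>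
          set_integrable lebesgue {0..1} (\<lambda>s. u s (\<Phi> s x)) \<and>
          (\<forall>t\<in>{0..1}. \<Phi> t x = x + (LINT s:{0..t}|lebesgue. u s (\<Phi> s x))))"

definition flow :: "(real \<Rightarrow> 'a::euclidean_space \<Rightarrow> 'a) \<Rightarrow> real \<Rightarrow> 'a \<Rightarrow> 'a" where
  "flow u = (THE \<Phi>. is_flow u \<Phi>)"

definition Fl :: "(real \<Rightarrow> 'a::euclidean_space \<Rightarrow> 'a) \<Rightarrow> real \<Rightarrow> 'a \<Rightarrow> 'a" where
  "Fl u = (\<lambda>t x. flow u t x - x)"

end

theory Submission
  imports Defs
begin

text \<open>
  Partial derivatives of order \<open>n\<close> are handled by recursion on \<open>n\<close>: the chain and product rules
  express a directional derivative of \<open>f \<circ> (id + \<phi>)\<close> through derivatives of order \<open>n - 1\<close> of the same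
  kind, so no Faa di Bruno formula is needed. At order \<open>0\<close> the second difference of
  \<open>f \<circ> (id + \<phi>)\<close> is compared with the second difference of \<open>f\<close> along the chord; the midpoint is
  missed by \<open>O(|h|\<^sup>2)\<close> since \<open>\<phi>\<close> is \<open>C\<^sup>2\<close>, and this costs a term \<open>|h|\<^sup>2\<^sup>\<gamma>\<close> for any Hoelder exponent
  \<open>\<gamma> < \<beta>\<close> of the \<open>n\<close>-th derivative, which has finite Besov norm once \<open>2\<gamma> > \<beta>\<close>. Hence Picard
  iteration on short time intervals stays in a set of displacements whose second differences are
  dominated by a fixed multiple of \<open>\<integral> \<eta>(u(s); t) ds + min 1 (t\<^sup>2\<^sup>\<gamma>)\<close>. This set is closed under pointwise
  limits, and finitely many short intervals, whose number depends on the \<open>L\<^sup>1\<close>-norm of \<open>u\<close> only, are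
  composed. A Gronwall argument shows that \<open>u \<mapsto> \<phi>\<^sub>u\<close> is \<open>\<gamma>\<close>-Hoelder into \<open>C\<^sup>n\<close> on bounded sets.
  Interpolating between this and the uniform bound of order \<open>\<beta>\<close> yields the exponent
  \<open>\<gamma> (\<beta> - \<alpha>) / \<beta>\<close> in the Besov norm of order \<open>\<alpha>\<close>, and \<open>\<gamma> < \<beta>\<close> is arbitrary.
\<close>

section \<open>Functions with controlled derivatives and second differences\<close>

text \<open>Pointwise moduli are propagated instead of Besov norms. The composition estimate is
  linear in the bound \<open>M\<close> and the modulus \<open>H\<close> of the outer function, and
  the modulus of the inner displacement occurs only multiplied by \<open>M\<close>. After
  integration in time a small mass therefore absorbs that term, and the Picard map preserves a fixed
  bound. The loss in the exponent has a definite source. The top derivative of a field is only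
  Hoelder, so comparing one field along two flows in \<open>C\<^sup>n\<close> costs the power
  \<gamma> of their uniform distance. That distance is controlled beforehand by a separate argument
  without loss, and the \<open>C\<^sup>n\<close> estimate stays linear with a known inhomogeneity.
  The exponent \<gamma> stays strictly below \<beta> because for \<beta> = 1 control of second
  differences does not give Lipschitz continuity (the Zygmund class).\<close>

definition dderiv :: "'a::real_normed_vector \<Rightarrow> ('a \<Rightarrow> 'b::real_normed_vector) \<Rightarrow> 'a \<Rightarrow> 'b" where
  "dderiv v f = (\<lambda>x. frechet_derivative f (at x) v)"

text \<open>
  The factor \<open>2\<close> in the Hoelder condition makes it automatic for \<open>\<gamma> = 0\<close>, so that \<open>bd n M\<close> below just
  bounds the derivatives up to order \<open>n\<close>, and makes it inherited from a bounded derivative.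
\<close>

primrec cls :: "real \<Rightarrow> nat \<Rightarrow> real \<Rightarrow> (real \<Rightarrow> real) \<Rightarrow>
    ('a::euclidean_space \<Rightarrow> 'b::real_normed_vector) \<Rightarrow> bool" where
  "cls \<gamma> 0 M H f \<longleftrightarrow> (\<forall>x. norm (f x) \<le> M) \<and>
     (\<forall>x y. norm (f x - f y) \<le> 2 * M * norm (x - y) powr \<gamma>) \<and>
     (\<forall>x h. norm (f (x + 2 *\<^sub>R h) - 2 *\<^sub>R f (x + h) + f x) \<le> H (norm h))"
| "cls \<gamma> (Suc n) M H f \<longleftrightarrow> (\<forall>x. norm (f x) \<le> M) \<and> (\<forall>x. f differentiable at x) \<and>
     (\<forall>v. norm v \<le> 1 \<longrightarrow> cls \<gamma> n M H (dderiv v f))"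

text \<open>For large arguments a second difference is controlled by the bound of the function
  alone, hence the cap at 1; without it the Besov functional of order \<beta> < 2 * \<gamma> would
  diverge at infinity.\<close>

definition cap_power :: "real \<Rightarrow> real \<Rightarrow> real" where
  "cap_power \<gamma> t = min 1 (t powr (2 * \<gamma>))"

abbreviation bd :: "nat \<Rightarrow> real \<Rightarrow> ('a::euclidean_space \<Rightarrow> 'b::real_normed_vector) \<Rightarrow> bool" where
  "bd n M \<equiv> cls 0 n M (\<lambda>_. 4 * M)"

section \<open>Calculus of directional derivatives\<close>

lemma dderiv_eq: "(f has_derivative L) (at x) \<Longrightarrow> dderiv v f x = L v"
  unfolding dderiv_def by (metis frechet_derivative_at)

lemma has_derivative_dderiv:
  "f differentiable at x \<Longrightarrow> (f has_derivative (\<lambda>v. dderiv v f x)) (at x)"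
  unfolding dderiv_def using frechet_derivative_works by blast

lemma linear_dderiv: "f differentiable at x \<Longrightarrow> linear (\<lambda>v. dderiv v f x)"
  using has_derivative_dderiv has_derivative_linear by blast

lemma dderiv_add:
  assumes "\<And>x. f differentiable at x" "\<And>x. g differentiable at x"
  shows "dderiv v (\<lambda>x. f x + g x) = (\<lambda>x. dderiv v f x + dderiv v g x)"
  using assms by (intro ext dderiv_eq has_derivative_add has_derivative_dderiv)

lemma dderiv_diff:
  assumes "\<And>x. f differentiable at x" "\<And>x. g differentiable at x"
  shows "dderiv v (\<lambda>x. f x - g x) = (\<lambda>x. dderiv v f x - dderiv v g x)"
  using assms by (intro ext dderiv_eq has_derivative_diff has_derivative_dderiv)

lemma dderiv_linear:
  assumes "\<And>x. f differentiable at x" "bounded_linear T"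
  shows "dderiv v (\<lambda>x. T (f x)) = (\<lambda>x. T (dderiv v f x))"
  by (intro ext dderiv_eq bounded_linear.has_derivative[OF assms(2)] has_derivative_dderiv assms)

lemma differentiable_linear:
  assumes "f differentiable at x" "bounded_linear T"
  shows "(\<lambda>x. T (f x)) differentiable at x"
  using bounded_linear.has_derivative[OF assms(2) has_derivative_dderiv[OF assms(1)]]
  unfolding differentiable_def by blast

lemma dderiv_const: "dderiv v (\<lambda>_. c) = (\<lambda>_. 0)"
  by (intro ext) (simp add: dderiv_def frechet_derivative_const)

lemma dderiv_scaleR_vec:
  assumes "f differentiable at x"
  shows "dderiv (c *\<^sub>R v) f x = c *\<^sub>R dderiv v f x"
  using linear_dderiv[OF assms] by (rule linear_cmul)

lemma dderiv_bound_homogeneous: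
  assumes "f differentiable at x" "\<And>v. norm v \<le> 1 \<Longrightarrow> norm (dderiv v f x) \<le> B"
  shows "norm (dderiv w f x) \<le> B * norm w"
proof (cases "w = 0")
  case True
  then show ?thesis using linear_0[OF linear_dderiv[OF assms(1)]] by simp
next
  case False
  have "dderiv w f x = norm w *\<^sub>R dderiv ((1 / norm w) *\<^sub>R w) f x"
    using False by (subst dderiv_scaleR_vec[OF assms(1)]) simp
  moreover have "norm (dderiv ((1 / norm w) *\<^sub>R w) f x) \<le> B"
    using assms(2) False by simp
  ultimately show ?thesis
    by (metis abs_norm_cancel mult.commute mult_left_mono norm_ge_zero norm_scaleR)
qed

section \<open>Monotonicity of the classes and closure under linear operations\<close>

lemma cls_bound: "cls \<gamma> n M H f \<Longrightarrow> norm (f x) \<le> M"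
  by (cases n) auto

lemma cls_nonneg: "cls \<gamma> n M H f \<Longrightarrow> 0 \<le> M"
  using cls_bound norm_ge_zero order_trans by blast

text \<open>A Euclidean space has vectors of every norm \<open>t \<ge> 0\<close>, so
  \<open>H t\<close> bounds the norm of some second difference.\<close>

lemma cls_H_nonneg: "cls \<gamma> n M H (f :: 'a::euclidean_space \<Rightarrow> 'b::real_normed_vector) \<Longrightarrow> 0 \<le> t \<Longrightarrow> 0 \<le> H t"
proof (induction n arbitrary: f)
  case 0
  obtain h :: 'a where "norm h = t"
    using vector_choose_size[OF 0(2)] by blast
  then show ?case using 0(1) norm_ge_zero order_trans by (metis cls.simps(1))
next
  case (Suc n)
  then show ?case by (metis cls.simps(2) norm_zero zero_le_one)
qed

lemma cls_mono:
  "cls \<gamma> n M H f \<Longrightarrow> M \<le> M' \<Longrightarrow> (\<And>t. 0 \<le> t \<Longrightarrow> H t \<le> H' t) \<Longrightarrow> cls \<gamma> n M' H' f"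
proof (induction n arbitrary: f)
  case 0
  have *: "2 * M * r powr \<gamma> \<le> 2 * M' * r powr \<gamma>" for r
    using 0(2) by (intro mult_right_mono) auto
  have "norm (f x) \<le> M'" for x using 0(1,2) order_trans[of "norm (f x)" M M'] by simp
  moreover have "norm (f x - f y) \<le> 2 * M' * norm (x - y) powr \<gamma>" for x y
    using 0(1) order_trans[OF _ *, of "norm (f x - f y)" "norm (x - y)"] by simp
  moreover have "norm (f (x + 2 *\<^sub>R h) - 2 *\<^sub>R f (x + h) + f x) \<le> H' (norm h)" for x h
    using 0(1) order_trans[OF _ 0(3), of _ "norm h"] by simp
  ultimately show ?case by simp
next
  case (Suc n)
  have "norm (f x) \<le> M'" for x using Suc.prems(1,2) order_trans[of "norm (f x)" M M'] by simp
  then show ?case using Suc by simp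
qed

lemma cls_add:
  "cls \<gamma> n A Ha a \<Longrightarrow> cls \<gamma> n B Hb b \<Longrightarrow> cls \<gamma> n (A + B) (\<lambda>t. Ha t + Hb t) (\<lambda>x. a x + b x)"
proof (induction n arbitrary: a b)
  case 0
  have "norm (a x + b x - (a y + b y)) \<le> 2 * (A + B) * norm (x - y) powr \<gamma>" for x y
  proof -
    have "a x + b x - (a y + b y) = (a x - a y) + (b x - b y)" by simp
    then have "norm (a x + b x - (a y + b y)) \<le> norm (a x - a y) + norm (b x - b y)"
      by (metis norm_triangle_ineq)
    also have "\<dots> \<le> 2 * A * norm (x - y) powr \<gamma> + 2 * B * norm (x - y) powr \<gamma>"
      using 0 by (intro add_mono) auto
    finally show ?thesis by (simp add: algebra_simps)
  qed
  moreover have "norm (a (x + 2 *\<^sub>R h) + b (x + 2 *\<^sub>R h) - 2 *\<^sub>R (a (x + h) + b (x + h)) + (a x + b x)) \<le> Ha (norm h) + Hb (norm h)" for x h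
  proof -
    have "a (x + 2 *\<^sub>R h) + b (x + 2 *\<^sub>R h) - 2 *\<^sub>R (a (x + h) + b (x + h)) + (a x + b x) =
      (a (x + 2 *\<^sub>R h) - 2 *\<^sub>R a (x + h) + a x) + (b (x + 2 *\<^sub>R h) - 2 *\<^sub>R b (x + h) + b x)"
      by (simp add: algebra_simps)
    also have "norm \<dots> \<le> Ha (norm h) + Hb (norm h)"
      by (rule order_trans[OF norm_triangle_ineq], rule add_mono) (use 0 in simp_all)
    finally show ?thesis .
  qed
  moreover have "norm (a x + b x) \<le> A + B" for x
    using 0 by (intro order_trans[OF norm_triangle_ineq] add_mono) simp_all
  ultimately show ?case by simp
next
  case (Suc n)
  have "norm (a x + b x) \<le> A + B" for x
    using Suc.prems by (intro order_trans[OF norm_triangle_ineq] add_mono) simp_all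
  then show ?case using Suc by (auto simp: dderiv_add)
qed

lemma cls_linear:
  assumes T: "bounded_linear T" "\<And>y. norm (T y) \<le> c * norm y" and c: "0 \<le> c"
  shows "cls \<gamma> n A H a \<Longrightarrow> cls \<gamma> n (c * A) (\<lambda>t. c * H t) (\<lambda>x. T (a x))"
proof (induction n arbitrary: a)
  case 0
  interpret T: bounded_linear T by fact
  have *: "norm (T y) \<le> c * B" if "norm y \<le> B" for y B
    using T(2)[of y] mult_left_mono[OF that c] by linarith
  have "norm (T (a x) - T (a y)) \<le> 2 * (c * A) * norm (x - y) powr \<gamma>" for x y
  proof -
    have "norm (T (a x - a y)) \<le> c * (2 * A * norm (x - y) powr \<gamma>)"
      using 0 by (intro *) simp
    then show ?thesis by (simp add: T.diff algebra_simps)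
  qed
  moreover have "norm (T (a (x + 2 *\<^sub>R h)) - 2 *\<^sub>R T (a (x + h)) + T (a x)) \<le> c * H (norm h)" for x h
  proof -
    have "norm (T (a (x + 2 *\<^sub>R h) - 2 *\<^sub>R a (x + h) + a x)) \<le> c * H (norm h)"
      using 0 by (intro *) simp
    then show ?thesis by (simp add: T.diff T.add T.scaleR)
  qed
  ultimately show ?case using 0 * by simp
next
  case (Suc n)
  have "norm (T (a x)) \<le> c * A" for x
    using Suc.prems T(2)[of "a x"] mult_left_mono[OF _ c, of "norm (a x)" A] by fastforce
  then show ?case using Suc by (auto simp: dderiv_linear[OF _ T(1)] differentiable_linear[OF _ T(1)])
qed

lemma cls_scaleR: "cls \<gamma> n A H a \<Longrightarrow> cls \<gamma> n (\<bar>c\<bar> * A) (\<lambda>t. \<bar>c\<bar> * H t) (\<lambda>x. c *\<^sub>R a x)"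
  by (intro cls_linear) (auto intro: bounded_linear_intros)

lemma cls_diff:
  assumes "cls \<gamma> n A Ha a" "cls \<gamma> n B Hb b"
  shows "cls \<gamma> n (A + B) (\<lambda>t. Ha t + Hb t) (\<lambda>x. a x - b x)"
  using cls_add[OF assms(1) cls_scaleR[OF assms(2), of "-1"]] by simp

lemma cls_inner:
  assumes "cls \<gamma> n A H a" "norm j \<le> 1"
  shows "cls \<gamma> n A H (\<lambda>x. a x \<bullet> j)"
proof -
  have "norm (y \<bullet> j) \<le> 1 * norm y" for y
    using Cauchy_Schwarz_ineq2[of y j] mult_left_mono[OF assms(2) norm_ge_zero[of y]] by simp
  then show ?thesis
    using cls_linear[OF bounded_linear_inner_left _ _ assms(1), of j 1] by simp
qed

lemma cls_const: "norm c \<le> A \<Longrightarrow> cls \<gamma> n A (\<lambda>_. 0) (\<lambda>_. c)"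
proof (induction n arbitrary: c)
  case 0
  have "0 \<le> A" using 0 norm_ge_zero order_trans by blast
  then show ?case using 0 by (auto simp: scaleR_2)
next
  case (Suc n)
  have "0 \<le> A" using Suc norm_ge_zero order_trans by blast
  then show ?case using Suc by (auto simp: dderiv_const)
qed

lemma cls_sum:
  assumes "finite I" "\<And>i. i \<in> I \<Longrightarrow> cls \<gamma> n A H (f i)"
  shows "cls \<gamma> n (real (card I) * A) (\<lambda>t. real (card I) * H t) (\<lambda>x. \<Sum>i\<in>I. f i x)"
  using assms
proof (induction rule: finite_induct)
  case empty
  then show ?case using cls_const[of 0 0] by simp
next
  case (insert i I)
  then show ?case using cls_add[of \<gamma> n A H "f i" "real (card I) * A" "\<lambda>t. real (card I) * H t" "\<lambda>x. \<Sum>i\<in>I. f i x"]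
    by (simp add: algebra_simps)
qed

lemma cap_power_nonneg [simp]: "0 \<le> cap_power \<gamma> t" and cap_power_le_1: "cap_power \<gamma> t \<le> 1"
  by (auto simp: cap_power_def)

section \<open>First and second differences of functions with bounded derivatives\<close>

lemma differentiable_lipschitz:
  fixes f :: "'a::euclidean_space \<Rightarrow> 'b::real_normed_vector"
  assumes "convex S" "\<And>x. x \<in> S \<Longrightarrow> (f has_derivative f' x) (at x)"
    "\<And>x w. x \<in> S \<Longrightarrow> norm (f' x w) \<le> B * norm w" "x \<in> S" "y \<in> S"
  shows "norm (f x - f y) \<le> B * norm (x - y)"
proof (rule differentiable_bound[of S f f'])
  show "onorm (f' z) \<le> B" if "z \<in> S" for z using assms(3)[OF that] by (rule onorm_le)
qed (use assms in \<open>auto intro: has_derivative_at_withinI\<close>)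

lemma cls_lipschitz:
  assumes "cls \<gamma> (Suc n) M H f"
  shows "norm (f x - f y) \<le> M * norm (x - y)"
proof (rule differentiable_lipschitz[where S=UNIV and f'="\<lambda>x v. dderiv v f x"])
  show "norm (dderiv w f z) \<le> M * norm w" for z w
  proof (rule dderiv_bound_homogeneous)
    fix v :: 'a assume "norm v \<le> 1"
    then have "cls \<gamma> n M H (dderiv v f)" using assms by simp
    then show "norm (dderiv v f z) \<le> M" by (rule cls_bound)
  qed (use assms in simp)
qed (use assms in \<open>simp_all add: has_derivative_dderiv\<close>)

lemma powr_ge_base: "0 \<le> (d::real) \<Longrightarrow> d \<le> 1 \<Longrightarrow> 0 \<le> g \<Longrightarrow> g \<le> 1 \<Longrightarrow> d \<le> d powr g"
  by (metis powr_mono' powr_one)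

text \<open>Above order 0, the Lipschitz constant \<open>M\<close> settles distances up to 1 and the
  bound \<open>2 * M\<close> on all differences settles the rest; both fit under the factor 2 of the
  definition.\<close>

lemma cls_holder:
  assumes "cls \<gamma> n M H f" "0 \<le> \<gamma>" "\<gamma> \<le> 1"
  shows "norm (f x - f y) \<le> 2 * M * norm (x - y) powr \<gamma>"
proof (cases n)
  case 0
  then show ?thesis using assms by simp
next
  case (Suc k)
  note M = cls_nonneg[OF assms(1)]
  let ?d = "norm (x - y)"
  show ?thesis
  proof (cases "?d \<le> 1")
    case True
    have "norm (f x - f y) \<le> M * ?d" using assms(1) cls_lipschitz unfolding Suc by blast
    also have "\<dots> \<le> (2 * M) * ?d powr \<gamma>"
      using True M assms by (intro mult_mono powr_ge_base) auto
    finally show ?thesis .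
  next
    case False
    have "norm (f x - f y) \<le> 2 * M * 1"
      using norm_triangle_ineq4[of "f x" "f y"] cls_bound[OF assms(1), of x] cls_bound[OF assms(1), of y] by simp
    also have "\<dots> \<le> (2 * M) * ?d powr \<gamma>"
      using False M assms by (intro mult_left_mono ge_one_powr_ge_zero) auto
    finally show ?thesis .
  qed
qed

lemma norm_second_diff_le:
  fixes f :: "'a::real_normed_vector \<Rightarrow> 'b::real_normed_vector"
  assumes "\<And>x. norm (f x) \<le> M"
  shows "norm (f y - 2 *\<^sub>R f z + f x) \<le> 4 * M"
proof -
  have "norm (f y - 2 *\<^sub>R f z + f x) \<le> norm (f y - 2 *\<^sub>R f z) + norm (f x)"
    by (rule norm_triangle_ineq)
  also have "norm (f y - 2 *\<^sub>R f z) \<le> norm (f y) + 2 * norm (f z)"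
    by (metis norm_scaleR norm_triangle_ineq4 abs_numeral)
  finally show ?thesis using assms[of x] assms[of y] assms[of z] by linarith
qed

text \<open>The second difference is the increment over \<open>h\<close> of
  \<open>\<lambda>x. f (x + h) - f x\<close>, whose derivative is a difference of first derivatives
  and so at most \<open>2 * M * norm h powr \<gamma>\<close>.\<close>

lemma cls_second_diff:
  fixes f :: "'a::euclidean_space \<Rightarrow> 'b::real_normed_vector"
  assumes "cls \<gamma> (Suc n) M H f" "0 \<le> \<gamma>" "\<gamma> \<le> 1"
  shows "norm (f (x + 2 *\<^sub>R h) - 2 *\<^sub>R f (x + h) + f x) \<le> 2 * M * norm h powr \<gamma> * norm h"
proof -
  have d: "f differentiable at x" for x using assms by simp
  have D: "((\<lambda>x. f (x + h) - f x) has_derivative (\<lambda>v. dderiv v f (y + h) - dderiv v f y)) (at y)" for y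
  proof (rule has_derivative_diff)
    have "((\<lambda>x. x + h) has_derivative (\<lambda>v. v)) (at y)" by (auto intro!: derivative_eq_intros)
    from has_derivative_compose[OF this has_derivative_dderiv[OF d]]
    show "((\<lambda>x. f (x + h)) has_derivative (\<lambda>v. dderiv v f (y + h))) (at y)" .
  qed (rule has_derivative_dderiv[OF d])
  have "norm ((f (x + h + h) - f (x + h)) - (f (x + h) - f x)) \<le> 2 * M * norm h powr \<gamma> * norm ((x + h) - x)"
  proof (rule differentiable_lipschitz[where S=UNIV and f="\<lambda>x. f (x + h) - f x"
        and f'="\<lambda>x v. dderiv v f (x + h) - dderiv v f x"])
    fix y :: 'a
    show "((\<lambda>x. f (x + h) - f x) has_derivative (\<lambda>v. dderiv v f (y + h) - dderiv v f y)) (at y)" by (rule D)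
  next
    fix y w :: 'a
    have "norm (dderiv w (\<lambda>x. f (x + h) - f x) y) \<le> 2 * M * norm h powr \<gamma> * norm w"
    proof (rule dderiv_bound_homogeneous)
      show "(\<lambda>x. f (x + h) - f x) differentiable at y" using D unfolding differentiable_def by blast
      fix v :: 'a assume "norm v \<le> 1"
      then have "cls \<gamma> n M H (dderiv v f)" using assms by simp
      from cls_holder[OF this assms(2,3), of "y + h" y]
      show "norm (dderiv v (\<lambda>x. f (x + h) - f x) y) \<le> 2 * M * norm h powr \<gamma>"
        using dderiv_eq[OF D] by simp
    qed
    also have "dderiv w (\<lambda>x. f (x + h) - f x) y = dderiv w f (y + h) - dderiv w f y"
      by (rule dderiv_eq[OF D])
    finally show "norm (dderiv w f (y + h) - dderiv w f y) \<le> 2 * M * norm h powr \<gamma> * norm w" .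
  qed auto
  moreover have "f (x + 2 *\<^sub>R h) - 2 *\<^sub>R f (x + h) + f x = (f (x + h + h) - f (x + h)) - (f (x + h) - f x)"
    by (simp add: algebra_simps scaleR_2)
  ultimately show ?thesis by (simp only: add_diff_cancel_left')
qed

text \<open>Giving up one derivative replaces \<open>H\<close> by a multiple of
  \<open>cap_power \<gamma>\<close>: second differences are of size
  \<open>norm h powr (1 + \<gamma>)\<close>, which is below
  \<open>norm h powr (2 * \<gamma>)\<close> for \<open>norm h \<le> 1\<close>. This handles the
  undifferentiated factors in the product and chain rules.\<close>

lemma cls_lower:
  assumes "0 \<le> \<gamma>" "\<gamma> \<le> 1"
  shows "cls \<gamma> (Suc n) M H f \<Longrightarrow> cls \<gamma> n M (\<lambda>t. 4 * M * cap_power \<gamma> t) f"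
proof (induction n arbitrary: f)
  case 0
  note M = cls_nonneg[OF 0]
  have "norm (f (x + 2 *\<^sub>R h) - 2 *\<^sub>R f (x + h) + f x) \<le> 4 * M * cap_power \<gamma> (norm h)" for x h
  proof (cases "norm h \<le> 1")
    case True
    have "norm (f (x + 2 *\<^sub>R h) - 2 *\<^sub>R f (x + h) + f x) \<le> 2 * M * norm h powr \<gamma> * norm h"
      by (rule cls_second_diff[OF 0 assms])
    also have "\<dots> \<le> 2 * M * norm h powr \<gamma> * norm h powr \<gamma>"
      using True M assms by (intro mult_left_mono powr_ge_base) auto
    also have "\<dots> = 2 * M * norm h powr (2 * \<gamma>)" by (simp add: powr_add[symmetric])
    also have "\<dots> \<le> 4 * M * cap_power \<gamma> (norm h)"
    proof -
      have "norm h powr (2 * \<gamma>) \<le> 1" using True assms by (intro powr_le1) auto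
      then show ?thesis using M by (auto simp: cap_power_def intro!: mult_right_mono)
    qed
    finally show ?thesis .
  next
    case False
    then have "cap_power \<gamma> (norm h) = 1" using assms by (auto simp: cap_power_def ge_one_powr_ge_zero min_def)
    then show ?thesis using norm_second_diff_le[of f M] cls_bound[OF 0] by simp
  qed
  then show ?case using 0 cls_holder[OF 0 assms] by simp
next
  case (Suc n)
  then show ?case by simp
qed

lemma cls_bd: "cls \<gamma> n M H f \<Longrightarrow> bd n M f"
proof (induction n arbitrary: f)
  case 0
  have "norm (f x - f y) \<le> 2 * M * norm (x - y) powr 0" for x y
    using norm_triangle_ineq4[of "f x" "f y"] cls_bound[OF 0, of x] cls_bound[OF 0, of y] by simp
  then show ?case using 0 norm_second_diff_le[of f M] by simp
qed simp

lemma bd_lower: "bd (Suc n) M f \<Longrightarrow> bd n M f"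
  by (rule cls_bd, rule cls_lower[of 0]) auto

lemma bd_le: "bd n M f \<Longrightarrow> k \<le> n \<Longrightarrow> bd k M f"
  by (induction n) (auto simp: le_Suc_eq simp del: cls.simps dest: bd_lower)

lemma bd_0I: "(\<And>x. norm (f x) \<le> M) \<Longrightarrow> bd 0 M f"
proof -
  assume *: "\<And>x. norm (f x) \<le> M"
  have "norm (f x - f y) \<le> 2 * M * norm (x - y) powr 0" for x y
    using norm_triangle_ineq4[of "f x" "f y"] *[of x] *[of y] by simp
  then show ?thesis using * norm_second_diff_le[of f M] by simp
qed

lemma cap_power_eq:
  assumes "0 \<le> t" "0 \<le> \<gamma>" shows "t \<le> 1 \<Longrightarrow> cap_power \<gamma> t = t powr (2 * \<gamma>)" "1 \<le> t \<Longrightarrow> cap_power \<gamma> t = 1"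
proof -
  show "t \<le> 1 \<Longrightarrow> cap_power \<gamma> t = t powr (2 * \<gamma>)"
    using powr_le1[of "2 * \<gamma>" t] assms by (simp add: cap_power_def min_def)
  show "1 \<le> t \<Longrightarrow> cap_power \<gamma> t = 1"
    using ge_one_powr_ge_zero[of t "2 * \<gamma>"] assms by (simp add: cap_power_def min_def)
qed

lemma cap_power_mono: "0 \<le> \<gamma> \<Longrightarrow> 0 \<le> s \<Longrightarrow> s \<le> t \<Longrightarrow> cap_power \<gamma> s \<le> cap_power \<gamma> t"
  unfolding cap_power_def by (intro min.mono powr_mono2) auto

lemma cap_power_double:
  assumes "0 \<le> \<gamma>" "\<gamma> \<le> 1" "0 \<le> t"
  shows "cap_power \<gamma> (2 * t) \<le> 4 * cap_power \<gamma> t"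
proof -
  have "(2::real) powr (2 * \<gamma>) \<le> 2 powr 2" using assms by (intro powr_mono) auto
  then have "(2 * t) powr (2 * \<gamma>) \<le> 4 * t powr (2 * \<gamma>)"
    using assms by (simp add: powr_mult mult_right_mono)
  then show ?thesis by (auto simp: cap_power_def min_def)
qed

text \<open>The Leibniz rule for second differences leaves two products of first differences, each
  of size \<open>norm h powr (2 * \<gamma>)\<close>; they cause the \<open>cap_power\<close> term.
  The base 10 comes from differentiating: each of the two resulting products has a factor of lowered
  order, which contributes 4 by \<open>cls_lower\<close>, and one \<open>cap_power\<close> term of
  its own.\<close>

lemma cls_mult:
  fixes a :: "'a::euclidean_space \<Rightarrow> real" and b :: "'a \<Rightarrow> 'b::real_normed_vector"
  assumes \<gamma>: "0 \<le> \<gamma>" "\<gamma> \<le> 1"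
  shows "cls \<gamma> n A Ha a \<Longrightarrow> cls \<gamma> n B Hb b \<Longrightarrow>
    cls \<gamma> n (8 * 10 ^ n * (A * B)) (\<lambda>t. 8 * 10 ^ n * (A * Hb t + B * Ha t + A * B * cap_power \<gamma> t)) (\<lambda>x. a x *\<^sub>R b x)"
proof (induction n arbitrary: a b Ha Hb)
  case 0
  note A = cls_nonneg[OF 0(1)] and B = cls_nonneg[OF 0(2)]
  note a = cls_bound[OF 0(1)] and b = cls_bound[OF 0(2)]
  have ab: "norm (a x *\<^sub>R b x) \<le> A * B" for x
    using mult_mono[OF a b A norm_ge_zero, of x x] by simp
  have AB: "0 \<le> A * B" using A B by simp
  have "norm (a x *\<^sub>R b x - a y *\<^sub>R b y) \<le> 2 * (8 * (A * B)) * norm (x - y) powr \<gamma>" for x y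
  proof -
    have "a x *\<^sub>R b x - a y *\<^sub>R b y = (a x - a y) *\<^sub>R b x + a y *\<^sub>R (b x - b y)"
      by (simp add: algebra_simps)
    also have "norm \<dots> \<le> \<bar>a x - a y\<bar> * norm (b x) + \<bar>a y\<bar> * norm (b x - b y)"
      using norm_triangle_ineq by (metis norm_scaleR)
    also have "\<dots> \<le> (2 * A * norm (x - y) powr \<gamma>) * B + A * (2 * B * norm (x - y) powr \<gamma>)"
      using 0 a[of y] b[of x] A B by (intro add_mono mult_mono) auto
    also have "\<dots> = 4 * (A * B * norm (x - y) powr \<gamma>)" by simp
    also have "\<dots> \<le> 16 * (A * B * norm (x - y) powr \<gamma>)" using A B by (intro mult_right_mono) auto
    finally show ?thesis by simp
  qed
  moreover have "norm (a (x + 2 *\<^sub>R h) *\<^sub>R b (x + 2 *\<^sub>R h) - 2 *\<^sub>R (a (x + h) *\<^sub>R b (x + h)) + a x *\<^sub>R b x)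
    \<le> 8 * (A * Hb (norm h) + B * Ha (norm h) + A * B * cap_power \<gamma> (norm h))" (is "norm ?l \<le> ?r") for x h
  proof -
    have Hn: "0 \<le> A * Hb (norm h)" "0 \<le> B * Ha (norm h)"
      using cls_H_nonneg[OF 0(1)] cls_H_nonneg[OF 0(2)] A B by auto
    show ?thesis
    proof (cases "norm h \<le> 1")
      case True
      let ?a0 = "a x" and ?a1 = "a (x + h)" and ?a2 = "a (x + 2 *\<^sub>R h)"
      let ?b0 = "b x" and ?b1 = "b (x + h)" and ?b2 = "b (x + 2 *\<^sub>R h)"
      let ?p = "norm h powr \<gamma>"
      have e: "?l = (?a2 - 2 * ?a1 + ?a0) *\<^sub>R ?b1 + ?a1 *\<^sub>R (?b2 - 2 *\<^sub>R ?b1 + ?b0)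
        + (?a2 - ?a1) *\<^sub>R (?b2 - ?b1) + (?a1 - ?a0) *\<^sub>R (?b1 - ?b0)"
        by (simp add: algebra_simps scaleR_2)
      have d: "\<bar>?a2 - ?a1\<bar> \<le> 2 * A * ?p" "\<bar>?a1 - ?a0\<bar> \<le> 2 * A * ?p"
          "norm (?b2 - ?b1) \<le> 2 * B * ?p" "norm (?b1 - ?b0) \<le> 2 * B * ?p"
        using cls_holder[OF 0(1) \<gamma>, of "x + 2 *\<^sub>R h" "x + h"] cls_holder[OF 0(1) \<gamma>, of "x + h" x]
          cls_holder[OF 0(2) \<gamma>, of "x + 2 *\<^sub>R h" "x + h"] cls_holder[OF 0(2) \<gamma>, of "x + h" x]
        by (simp_all add: scaleR_2)
      have "norm ((?a2 - 2 * ?a1 + ?a0) *\<^sub>R ?b1) \<le> Ha (norm h) * B"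
        unfolding norm_scaleR using 0 b[of "x + h"] cls_H_nonneg[OF 0(1)] by (intro mult_mono) auto
      moreover have "norm (?a1 *\<^sub>R (?b2 - 2 *\<^sub>R ?b1 + ?b0)) \<le> A * Hb (norm h)"
        unfolding norm_scaleR using 0 a[of "x + h"] A by (intro mult_mono) auto
      moreover have "norm ((?a2 - ?a1) *\<^sub>R (?b2 - ?b1)) \<le> (2 * A * ?p) * (2 * B * ?p)"
        unfolding norm_scaleR using d A by (intro mult_mono) auto
      moreover have "norm ((?a1 - ?a0) *\<^sub>R (?b1 - ?b0)) \<le> (2 * A * ?p) * (2 * B * ?p)"
        unfolding norm_scaleR using d A by (intro mult_mono) auto
      ultimately have "norm ?l \<le> Ha (norm h) * B + A * Hb (norm h) + (2 * A * ?p) * (2 * B * ?p) + (2 * A * ?p) * (2 * B * ?p)"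
        unfolding e by (intro norm_triangle_le add_mono) 
      also have "(2 * A * ?p) * (2 * B * ?p) = 4 * (A * B * cap_power \<gamma> (norm h))"
        using True \<gamma> by (simp add: cap_power_eq powr_add[symmetric])
      finally show ?thesis using Hn by (simp add: algebra_simps)
    next
      case False
      then have "cap_power \<gamma> (norm h) = 1" using \<gamma> by (simp add: cap_power_eq)
      moreover have "norm ?l \<le> 4 * (A * B)" using ab by (intro norm_second_diff_le) 
      ultimately show ?thesis using AB Hn by (simp add: algebra_simps)
    qed
  qed
  moreover have "norm (a x *\<^sub>R b x) \<le> 8 * (A * B)" for x using ab[of x] AB by linarith
  ultimately show ?case by simp
next
  case (Suc n)
  note A = cls_nonneg[OF Suc(2)] and B = cls_nonneg[OF Suc(3)]
  note a = cls_bound[OF Suc(2)] and b = cls_bound[OF Suc(3)]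
  have AB: "0 \<le> A * B" using A B by simp
  have "norm (a x *\<^sub>R b x) \<le> 8 * 10 ^ Suc n * (A * B)" for x
  proof -
    have "norm (a x *\<^sub>R b x) \<le> A * B"
      using mult_mono[OF a b A norm_ge_zero, of x x] by simp
    also have "\<dots> = 1 * (A * B)" by simp
    also have "\<dots> \<le> 8 * 10 ^ Suc n * (A * B)"
      using one_le_power[of "10::real" "Suc n"] by (intro mult_right_mono AB) linarith
    finally show ?thesis .
  qed
  moreover have D: "((\<lambda>x. a x *\<^sub>R b x) has_derivative (\<lambda>v. a x *\<^sub>R dderiv v b x + dderiv v a x *\<^sub>R b x)) (at x)" for x
    using Suc.prems by (intro has_derivative_scaleR has_derivative_dderiv) auto
  moreover have "cls \<gamma> n (8 * 10 ^ Suc n * (A * B)) (\<lambda>t. 8 * 10 ^ Suc n * (A * Hb t + B * Ha t + A * B * cap_power \<gamma> t))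
      (dderiv v (\<lambda>x. a x *\<^sub>R b x))" if v: "norm v \<le> 1" for v
  proof -
    let ?c = "8 * 10 ^ n :: real"
    have 1: "cls \<gamma> n (?c * (A * B)) (\<lambda>t. ?c * (A * Hb t + B * (4 * A * cap_power \<gamma> t) + A * B * cap_power \<gamma> t)) (\<lambda>x. a x *\<^sub>R dderiv v b x)"
      using Suc.prems v by (intro Suc.IH cls_lower[OF \<gamma> Suc(2)]) auto
    have 2: "cls \<gamma> n (?c * (A * B)) (\<lambda>t. ?c * (A * (4 * B * cap_power \<gamma> t) + B * Ha t + A * B * cap_power \<gamma> t)) (\<lambda>x. dderiv v a x *\<^sub>R b x)"
      using Suc.prems v by (intro Suc.IH cls_lower[OF \<gamma> Suc(3)]) auto
    have e: "dderiv v (\<lambda>x. a x *\<^sub>R b x) = (\<lambda>x. a x *\<^sub>R dderiv v b x + dderiv v a x *\<^sub>R b x)"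
      using dderiv_eq[OF D] by blast
    show ?thesis unfolding e
    proof (rule cls_mono[OF cls_add[OF 1 2]])
      show "?c * (A * B) + ?c * (A * B) \<le> 8 * 10 ^ Suc n * (A * B)"
        using mult_nonneg_nonneg[OF _ AB, of ?c] by simp
      fix t :: real assume "0 \<le> t"
      then have "0 \<le> A * Hb t" "0 \<le> B * Ha t"
        using cls_H_nonneg[OF Suc(2)] cls_H_nonneg[OF Suc(3)] A B by auto
      then have "(A * Hb t + B * (4 * A * cap_power \<gamma> t) + A * B * cap_power \<gamma> t) + (A * (4 * B * cap_power \<gamma> t) + B * Ha t + A * B * cap_power \<gamma> t)
        \<le> 10 * (A * Hb t + B * Ha t + A * B * cap_power \<gamma> t)"
        by (simp add: algebra_simps)
      from mult_left_mono[OF this, of ?c]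
      show "?c * (A * Hb t + B * (4 * A * cap_power \<gamma> t) + A * B * cap_power \<gamma> t) + ?c * (A * (4 * B * cap_power \<gamma> t) + B * Ha t + A * B * cap_power \<gamma> t)
        \<le> 8 * 10 ^ Suc n * (A * Hb t + B * Ha t + A * B * cap_power \<gamma> t)"
        by (simp add: algebra_simps)
    qed
  qed
  moreover have "(\<lambda>x. a x *\<^sub>R b x) differentiable at x" for x
    using D unfolding differentiable_def by blast
  ultimately show ?case by auto
qed

lemma bd_mult:
  assumes "bd n A (a :: 'a::euclidean_space \<Rightarrow> real)" "bd n B (b :: 'a \<Rightarrow> 'b::real_normed_vector)"
  shows "bd n (8 * 10 ^ n * (A * B)) (\<lambda>x. a x *\<^sub>R b x)"
  by (rule cls_bd[OF cls_mult[OF _ _ assms]]) auto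

section \<open>Perturbations of the identity and moduli\<close>

lemma dderiv_basis_sum:
  fixes f :: "'a::euclidean_space \<Rightarrow> 'b::real_normed_vector"
  assumes "f differentiable at y"
  shows "dderiv w f y = (\<Sum>j\<in>Basis. (w \<bullet> j) *\<^sub>R dderiv j f y)"
proof -
  interpret linear "\<lambda>w. dderiv w f y" by (rule linear_dderiv[OF assms])
  have "dderiv w f y = dderiv (\<Sum>j\<in>Basis. (w \<bullet> j) *\<^sub>R j) f y" by (simp add: euclidean_representation)
  then show ?thesis by (simp add: sum scaleR)
qed

text \<open>Expanding the outer derivative in the standard basis turns the derivative into a sum of
  scalar functions times compositions with the same displacement, so products and compositions of
  lower order are all that the recursion meets.\<close>

lemma has_derivative_displacement:
  fixes f :: "'a::euclidean_space \<Rightarrow> 'b::real_normed_vector"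
  assumes "\<And>y. f differentiable at y" "\<phi> differentiable at x"
  shows "((\<lambda>x. f (x + \<phi> x)) has_derivative
    (\<lambda>v. \<Sum>j\<in>Basis. ((v + dderiv v \<phi> x) \<bullet> j) *\<^sub>R dderiv j f (x + \<phi> x))) (at x)"
proof -
  have "((\<lambda>x. x + \<phi> x) has_derivative (\<lambda>v. v + dderiv v \<phi> x)) (at x)"
    by (intro has_derivative_add has_derivative_ident has_derivative_dderiv assms)
  from has_derivative_compose[OF this has_derivative_dderiv[OF assms(1)]]
  show ?thesis by (subst (asm) dderiv_basis_sum[OF assms(1)])
qed

lemma doubling_iterate:
  assumes "\<And>t. 0 \<le> t \<Longrightarrow> H (2 * t) \<le> 4 * (H t :: real)" "\<And>s t. 0 \<le> s \<Longrightarrow> s \<le> t \<Longrightarrow> H s \<le> H t" "(L::real) \<le> 2 ^ m" "0 \<le> t" "0 \<le> L"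
  shows "H (L * t) \<le> 4 ^ m * H t"
proof -
  have "H (2 ^ m * t) \<le> 4 ^ m * H t" for m
  proof (induction m)
    case (Suc m)
    have "H (2 ^ Suc m * t) \<le> 4 * H (2 ^ m * t)" using assms(1)[of "2 ^ m * t"] assms(4) by (simp add: ac_simps)
    then show ?case using Suc by simp
  qed simp
  moreover have "H (L * t) \<le> H (2 ^ m * t)" using assms by (intro assms(2) mult_right_mono) auto
  ultimately show ?thesis by (meson order_trans)
qed

text \<open>The recursion on the order degrades \<phi> to order 0, where bounds on its derivatives
  are no longer visible. What the base case needs of them is therefore carried separately: a
  Lipschitz constant of the perturbed identity and quadratic second differences of \<phi>.\<close>

definition near_id :: "real \<Rightarrow> ('a::euclidean_space \<Rightarrow> 'a) \<Rightarrow> bool" where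
  "near_id L \<phi> \<longleftrightarrow> (\<forall>x y. norm ((x + \<phi> x) - (y + \<phi> y)) \<le> L * norm (x - y)) \<and>
     (\<forall>x h. norm (\<phi> (x + 2 *\<^sub>R h) - 2 *\<^sub>R \<phi> (x + h) + \<phi> x) \<le> L * (norm h)\<^sup>2)"

text \<open>
  A modulus is nonnegative on \<open>[0, \<infinity>)\<close>: by monotonicity, \<open>H t \<le> H (2 * t) \<le> 4 * H t\<close>.
\<close>

definition modulus :: "(real \<Rightarrow> real) \<Rightarrow> bool" where
  "modulus H \<longleftrightarrow> (\<forall>t\<ge>0. H (2 * t) \<le> 4 * H t) \<and> (\<forall>s t. 0 \<le> s \<longrightarrow> s \<le> t \<longrightarrow> H s \<le> H t)"

text \<open>Order at least 2 matters here: bounded second derivatives make the first ones Lipschitz,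
  and second differences become quadratic.\<close>

lemma cls_near_id:
  assumes "cls \<gamma> n R K \<phi>" "2 \<le> n"
  shows "near_id (1 + 2 * R) \<phi>"
proof -
  have b: "bd 2 R \<phi>" using bd_le[OF cls_bd[OF assms(1)] assms(2)] .
  then have b1: "bd (Suc 1) R \<phi>" by (simp only: numeral_2_eq_2 One_nat_def)
  note R = cls_nonneg[OF b]
  have "norm ((x + \<phi> x) - (y + \<phi> y)) \<le> (1 + 2 * R) * norm (x - y)" for x y
  proof -
    have "norm ((x + \<phi> x) - (y + \<phi> y)) \<le> norm (x - y) + norm (\<phi> x - \<phi> y)"
      by (metis add_diff_add norm_triangle_ineq)
    also have "norm (\<phi> x - \<phi> y) \<le> R * norm (x - y)" by (rule cls_lipschitz[OF b1])
    also have "norm (x - y) + R * norm (x - y) \<le> (1 + 2 * R) * norm (x - y)"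
      using R by (simp add: algebra_simps)
    finally show ?thesis by simp
  qed
  moreover have "norm (\<phi> (x + 2 *\<^sub>R h) - 2 *\<^sub>R \<phi> (x + h) + \<phi> x) \<le> (1 + 2 * R) * (norm h)\<^sup>2" for x h
  proof -
    \<comment> \<open>Exponent 1 encodes Lipschitz first derivatives; \<open>cls_second_diff\<close>
      with this exponent yields \<open>2 * R * (norm h)\<^sup>2\<close>.\<close>
    let ?C = "cls 1 0 R (\<lambda>_. 4 * R)"
    have "?C (dderiv v \<phi>)" if "norm v \<le> 1" for v
    proof -
      have "bd (Suc 0) R (dderiv v \<phi>)" using b1 that by simp
      from cls_lipschitz[OF this] cls_bound[OF this] have
        *: "norm (dderiv v \<phi> x - dderiv v \<phi> y) \<le> R * norm (x - y)" "norm (dderiv v \<phi> x) \<le> R" for x y by auto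
      have "norm (dderiv v \<phi> x - dderiv v \<phi> y) \<le> 2 * R * norm (x - y) powr 1" for x y
        using order_trans[OF *(1)[of x y], of "2 * R * norm (x - y)"] mult_nonneg_nonneg[OF R norm_ge_zero[of "x - y"]] by simp
      then show ?thesis
        using *(2) norm_second_diff_le[of "dderiv v \<phi>" R] by simp
    qed
    then have "cls 1 (Suc 0) R (\<lambda>_. 4 * R) \<phi>" using b1 by simp
    from cls_second_diff[OF this, of x h]
    have "norm (\<phi> (x + 2 *\<^sub>R h) - 2 *\<^sub>R \<phi> (x + h) + \<phi> x) \<le> 2 * R * (norm h)\<^sup>2" by (simp add: power2_eq_square)
    also have "\<dots> \<le> (1 + 2 * R) * (norm h)\<^sup>2" by (intro mult_right_mono) auto
    finally show ?thesis .
  qed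
  ultimately show ?thesis unfolding near_id_def by blast
qed

section \<open>Composition, limits and integrals\<close>

text \<open>\<open>C\<close> is chosen before \<open>f\<close> and \<phi>, and the bounds are linear
  in \<open>M\<close> and \<open>H\<close>. In the induction step \<open>dderiv j f\<close> inherits
  \<open>M\<close> and \<open>H\<close>, \<phi> is lowered by one order, and \<open>near_id\<close>
  passes unchanged.\<close>

lemma cls_compose:
  assumes \<gamma>: "0 \<le> \<gamma>" "\<gamma> \<le> 1" and L: "1 \<le> L" and R: "0 \<le> R"
  shows "\<exists>C\<ge>1. \<forall>(f::'a::euclidean_space \<Rightarrow> 'b::real_normed_vector) \<phi> M H K.
    cls \<gamma> n M H f \<longrightarrow> modulus H \<longrightarrow> cls \<gamma> n R K \<phi> \<longrightarrow> near_id L \<phi> \<longrightarrow>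
    cls \<gamma> n (C * M) (\<lambda>t. C * (H t + M * K t + M * cap_power \<gamma> t)) (\<lambda>x. f (x + \<phi> x))"
proof (induction n)
  case 0
  obtain m where m: "L \<le> 2 ^ m" using real_arch_pow[of 2 L] by (auto intro: less_imp_le)
  \<comment> \<open>\<open>4 ^ m\<close> pays for evaluating \<open>H\<close> at
    \<open>L * norm h\<close> with \<open>L \<le> 2 ^ m\<close>; the multiple of \<open>L\<close>
    pays for the midpoint error and for the Hoelder bound, through
    \<open>L powr \<gamma> \<le> L\<close>.\<close>
  define C where "C = 4 ^ m + 8 * L"
  have C: "1 \<le> C" "4 ^ m \<le> C" "8 * L \<le> C" using L zero_le_power[of "4::real" m] unfolding C_def by linarith+
  have "cls \<gamma> 0 (C * M) (\<lambda>t. C * (H t + M * K t + M * cap_power \<gamma> t)) (\<lambda>x. f (x + \<phi> x))"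
    if f: "cls \<gamma> 0 M H f" and H: "modulus H" and \<phi>: "cls \<gamma> 0 R K \<phi>" and n: "near_id L \<phi>"
    for f :: "'a \<Rightarrow> 'b" and \<phi> M H K
  proof -
    note M = cls_nonneg[OF f]
    have lip: "norm ((x + \<phi> x) - (y + \<phi> y)) \<le> L * norm (x - y)" for x y using n unfolding near_id_def by blast
    have sd: "norm (\<phi> (x + 2 *\<^sub>R h) - 2 *\<^sub>R \<phi> (x + h) + \<phi> x) \<le> L * (norm h)\<^sup>2" for x h
      using n unfolding near_id_def by blast
    have bM: "norm (f x) \<le> M" for x by (rule cls_bound[OF f])
    have Lg: "L powr \<gamma> \<le> L" using powr_mono[of \<gamma> 1 L] \<gamma> L by simp
    have M1: "M \<le> C * M" using mult_right_mono[OF C(1) M] by simp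
    have "norm (f (x + \<phi> x)) \<le> C * M" for x using bM[of "x + \<phi> x"] M1 by linarith
    moreover have "norm (f (x + \<phi> x) - f (y + \<phi> y)) \<le> 2 * (C * M) * norm (x - y) powr \<gamma>" for x y
    proof -
      have "norm (f (x + \<phi> x) - f (y + \<phi> y)) \<le> 2 * M * norm ((x + \<phi> x) - (y + \<phi> y)) powr \<gamma>"
        by (rule cls_holder[OF f \<gamma>])
      also have "\<dots> \<le> 2 * M * (L * norm (x - y)) powr \<gamma>"
        using M \<gamma> lip by (intro mult_left_mono powr_mono2) auto
      also have "\<dots> = 2 * M * (L powr \<gamma> * norm (x - y) powr \<gamma>)" using L by (simp add: powr_mult)
      also have "\<dots> \<le> 2 * M * (C * norm (x - y) powr \<gamma>)"
        using M Lg C L by (intro mult_left_mono mult_right_mono) auto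
      finally show ?thesis by (simp add: ac_simps)
    qed
    moreover have "norm (f (x + 2 *\<^sub>R h + \<phi> (x + 2 *\<^sub>R h)) - 2 *\<^sub>R f (x + h + \<phi> (x + h)) + f (x + \<phi> x))
      \<le> C * (H (norm h) + M * K (norm h) + M * cap_power \<gamma> (norm h))" (is "norm ?l \<le> _") for x h
    proof -
      let ?d = "norm h"
      define y0 y1 y2 where y: "y0 = x + \<phi> x" "y1 = x + h + \<phi> (x + h)" "y2 = x + 2 *\<^sub>R h + \<phi> (x + 2 *\<^sub>R h)"
      \<comment> \<open>Half the chord: \<open>y0 + k\<close> is its midpoint and differs from
        \<open>y1\<close> by half a second difference of \<phi>.\<close>
      define k where "k = (1 / 2) *\<^sub>R (y2 - y0)"
      have Hn: "0 \<le> H ?d" using cls_H_nonneg[OF f] by simp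
      have Kn: "0 \<le> K ?d" using cls_H_nonneg[OF \<phi>] by simp
      have k: "norm k \<le> L * ?d"
        using lip[of "x + 2 *\<^sub>R h" x] by (simp add: k_def y)
      have k2: "y0 + 2 *\<^sub>R k = y2" by (simp add: k_def)
      have "(y0 + k) - y1 = (1 / 2) *\<^sub>R (\<phi> (x + 2 *\<^sub>R h) - 2 *\<^sub>R \<phi> (x + h) + \<phi> x)"
      proof -
        have "2 *\<^sub>R ((y0 + k) - y1) = \<phi> (x + 2 *\<^sub>R h) - 2 *\<^sub>R \<phi> (x + h) + \<phi> x"
          by (simp add: k_def y algebra_simps scaleR_2)
        then show ?thesis by (metis (no_types, lifting) divide_inverse_commute inverse_eq_divide mult.commute nonzero_eq_divide_eq scaleR_one scaleR_scaleR zero_neq_numeral)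
      qed
      then have mid: "norm ((y0 + k) - y1) \<le> L * ?d\<^sup>2" using sd[of x h] order_trans[OF norm_ge_zero sd[of x h]] by simp
      have e: "?l = (f (y0 + 2 *\<^sub>R k) - 2 *\<^sub>R f (y0 + k) + f y0) + 2 *\<^sub>R (f (y0 + k) - f y1)"
      proof -
        have "?l = f y2 - 2 *\<^sub>R f y1 + f y0" by (simp add: y)
        also have "\<dots> = (f (y0 + 2 *\<^sub>R k) - 2 *\<^sub>R f (y0 + k) + f y0) + 2 *\<^sub>R (f (y0 + k) - f y1)"
          unfolding k2 by (simp add: algebra_simps)
        finally show ?thesis .
      qed
      have p1: "norm (f (y0 + 2 *\<^sub>R k) - 2 *\<^sub>R f (y0 + k) + f y0) \<le> 4 ^ m * H ?d"
      proof -
        have "norm (f (y0 + 2 *\<^sub>R k) - 2 *\<^sub>R f (y0 + k) + f y0) \<le> H (norm k)" using f by simp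
        also have "\<dots> \<le> H (L * ?d)" using H k unfolding modulus_def by simp
        also have "\<dots> \<le> 4 ^ m * H ?d"
          using H m L unfolding modulus_def by (intro doubling_iterate) auto
        finally show ?thesis .
      qed
      have p2: "norm (2 *\<^sub>R (f (y0 + k) - f y1)) \<le> 4 * (M * L * cap_power \<gamma> ?d)"
      proof (cases "?d \<le> 1")
        case True
        have "norm (f (y0 + k) - f y1) \<le> 2 * M * norm ((y0 + k) - y1) powr \<gamma>"
          by (rule cls_holder[OF f \<gamma>])
        also have "\<dots> \<le> 2 * M * (L * ?d\<^sup>2) powr \<gamma>"
          using M \<gamma> mid by (intro mult_left_mono powr_mono2) auto
        also have "\<dots> = 2 * M * (L powr \<gamma> * cap_power \<gamma> ?d)"
          using True \<gamma> L by (cases "?d = 0") (simp_all add: powr_mult cap_power_eq powr_powr flip: powr_numeral)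
        also have "\<dots> \<le> 2 * M * (L * cap_power \<gamma> ?d)"
          using M Lg by (intro mult_left_mono mult_right_mono) auto
        finally show ?thesis by (simp add: ac_simps)
      next
        case False
        have "norm (f (y0 + k) - f y1) \<le> 2 * M"
          using norm_triangle_ineq4[of "f (y0 + k)" "f y1"] bM[of "y0 + k"] bM[of y1] by linarith
        also have "\<dots> \<le> 2 * (M * L)" using mult_left_mono[OF L M] by simp
        finally show ?thesis using False \<gamma> by (simp add: cap_power_eq ac_simps)
      qed
      have "norm ?l \<le> 4 ^ m * H ?d + 4 * (M * L * cap_power \<gamma> ?d)"
        unfolding e by (rule norm_triangle_le, rule add_mono[OF p1 p2])
      also have "\<dots> \<le> C * H ?d + C * (M * cap_power \<gamma> ?d)"
      proof (rule add_mono)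
        have "4 * L * (M * cap_power \<gamma> ?d) \<le> C * (M * cap_power \<gamma> ?d)" using C L M by (intro mult_right_mono) auto
        then show "4 * (M * L * cap_power \<gamma> ?d) \<le> C * (M * cap_power \<gamma> ?d)" by (simp add: ac_simps)
      qed (intro mult_right_mono C Hn)
      also have "\<dots> \<le> C * (H ?d + M * K ?d + M * cap_power \<gamma> ?d)"
        using C M Kn by (simp add: distrib_left)
      finally show ?thesis .
    qed
    ultimately show ?thesis by simp
  qed
  then show ?case using C by blast
next
  case (Suc n)
  then obtain C0 where C0: "1 \<le> C0" and IH: "\<And>(f::'a \<Rightarrow> 'b) \<phi> M H K. cls \<gamma> n M H f \<Longrightarrow> modulus H \<Longrightarrow> cls \<gamma> n R K \<phi> \<Longrightarrow>
      near_id L \<phi> \<Longrightarrow> cls \<gamma> n (C0 * M) (\<lambda>t. C0 * (H t + M * K t + M * cap_power \<gamma> t)) (\<lambda>x. f (x + \<phi> x))" by blast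
  let ?N = "real (card (Basis :: 'a set))"
  let ?c = "8 * 10 ^ n :: real"
  \<comment> \<open>The factors are the number of basis vectors, the constant of the product rule,
    the constant at order \<open>n\<close>, and the bound \<open>1 + R\<close> of
    \<open>v + dderiv v \<phi> x\<close>. In the last factor \<open>4 * R\<close> stems from
    lowering \<phi>, and the 3 covers the remaining copies of \<open>cap_power\<close>.\<close>
  define C where "C = ?N * (?c * (C0 * ((1 + R) * (4 * R + 3))))"
  have N: "1 \<le> ?N" by (simp add: DIM_positive Suc_leI)
  have c1: "1 \<le> ?c" using one_le_power[of "10::real" n] by linarith
  have C': "1 \<le> C"
    unfolding C_def using C0 R N c1 by (intro mult_ge1_I) (auto simp: algebra_simps)
  have "cls \<gamma> (Suc n) (C * M) (\<lambda>t. C * (H t + M * K t + M * cap_power \<gamma> t)) (\<lambda>x. f (x + \<phi> x))"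
    if f: "cls \<gamma> (Suc n) M H f" and H: "modulus H" and \<phi>: "cls \<gamma> (Suc n) R K \<phi>" and n: "near_id L \<phi>"
    for f :: "'a \<Rightarrow> 'b" and \<phi> M H K
  proof -
    note M = cls_nonneg[OF f]
    have M1: "M \<le> C * M" using mult_right_mono[OF C' M] by simp
    have D: "((\<lambda>x. f (x + \<phi> x)) has_derivative
        (\<lambda>v. \<Sum>j\<in>Basis. ((v + dderiv v \<phi> x) \<bullet> j) *\<^sub>R dderiv j f (x + \<phi> x))) (at x)" for x
      using f \<phi> by (intro has_derivative_displacement) auto
    have "cls \<gamma> n (C * M) (\<lambda>t. C * (H t + M * K t + M * cap_power \<gamma> t)) (dderiv v (\<lambda>x. f (x + \<phi> x)))" if v: "norm v \<le> 1" for v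
    proof -
      \<comment> \<open>The composition sees only the lowered \<phi>, with modulus
        \<open>4 * R * cap_power \<gamma> t\<close>; \<open>K\<close> itself enters through the
        factor \<open>dderiv v \<phi>\<close> of the product.\<close>
      have 1: "cls \<gamma> n (C0 * M) (\<lambda>t. C0 * (H t + M * (4 * R * cap_power \<gamma> t) + M * cap_power \<gamma> t)) (\<lambda>x. dderiv j f (x + \<phi> x))"
        if "j \<in> Basis" for j
        using f that by (intro IH H cls_lower[OF \<gamma> \<phi>] n) auto
      have 2: "cls \<gamma> n (1 + R) (\<lambda>t. 0 + K t) (\<lambda>x. (v + dderiv v \<phi> x) \<bullet> j)" if "j \<in> Basis" for j
        using v \<phi> that by (intro cls_inner cls_add cls_const) auto
      have 3: "cls \<gamma> n (?c * ((1 + R) * (C0 * M)))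
          (\<lambda>t. ?c * ((1 + R) * (C0 * (H t + M * (4 * R * cap_power \<gamma> t) + M * cap_power \<gamma> t)) + C0 * M * (0 + K t) + (1 + R) * (C0 * M) * cap_power \<gamma> t))
          (\<lambda>x. ((v + dderiv v \<phi> x) \<bullet> j) *\<^sub>R dderiv j f (x + \<phi> x))" if "j \<in> Basis" for j
        by (rule cls_mult[OF \<gamma> 2[OF that] 1[OF that]])
      have e: "dderiv v (\<lambda>x. f (x + \<phi> x)) = (\<lambda>x. \<Sum>j\<in>Basis. ((v + dderiv v \<phi> x) \<bullet> j) *\<^sub>R dderiv j f (x + \<phi> x))"
        using dderiv_eq[OF D] by blast
      show ?thesis unfolding e
      proof (rule cls_mono[OF cls_sum[OF finite_Basis 3]])
        have "(1 + R) * (C0 * M) \<le> C0 * ((1 + R) * (4 * R + 3)) * M"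
          using C0 R M by (simp add: algebra_simps)
        from mult_left_mono[OF mult_left_mono[OF this], of ?c ?N]
        show "?N * (?c * ((1 + R) * (C0 * M))) \<le> C * M" by (simp add: C_def ac_simps)
        fix t :: real assume t: "0 \<le> t"
        have p: "0 \<le> H t" "0 \<le> M * K t" "0 \<le> M * cap_power \<gamma> t"
          using cls_H_nonneg[OF f t] cls_H_nonneg[OF \<phi> t] M by auto
        have "(1 + R) * (H t + M * (4 * R * cap_power \<gamma> t) + M * cap_power \<gamma> t) + M * (0 + K t) + (1 + R) * M * cap_power \<gamma> t
          = (1 + R) * H t + 1 * (M * K t) + ((1 + R) * (4 * R + 2)) * (M * cap_power \<gamma> t)"
          by (simp add: algebra_simps)
        also have "\<dots> \<le> ((1 + R) * (4 * R + 3)) * H t + ((1 + R) * (4 * R + 3)) * (M * K t) + ((1 + R) * (4 * R + 3)) * (M * cap_power \<gamma> t)"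
          using R p by (intro add_mono mult_right_mono) (auto simp: algebra_simps)
        finally have "(1 + R) * (H t + M * (4 * R * cap_power \<gamma> t) + M * cap_power \<gamma> t) + M * (0 + K t) + (1 + R) * M * cap_power \<gamma> t
          \<le> ((1 + R) * (4 * R + 3)) * (H t + M * K t + M * cap_power \<gamma> t)" by (simp add: distrib_left)
        from mult_left_mono[OF mult_left_mono[OF mult_left_mono[OF this, of C0], of ?c], of ?N]
        show "?N * (?c * ((1 + R) * (C0 * (H t + M * (4 * R * cap_power \<gamma> t) + M * cap_power \<gamma> t)) + C0 * M * (0 + K t) + (1 + R) * (C0 * M) * cap_power \<gamma> t))
          \<le> C * (H t + M * K t + M * cap_power \<gamma> t)"
          using C0 by (simp add: C_def algebra_simps)
      qed
    qed
    moreover have "norm (f (x + \<phi> x)) \<le> C * M" for x using cls_bound[OF f, of "x + \<phi> x"] M1 by linarith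
    moreover have "(\<lambda>x. f (x + \<phi> x)) differentiable at x" for x
      using D unfolding differentiable_def by blast
    ultimately show ?thesis by simp
  qed
  then show ?case using C' by blast
qed

text \<open>Exponent 0 of \<open>cls_compose\<close>, with the constant modulus
  \<open>4 * M\<close>.\<close>

lemma bd_compose:
  assumes L: "1 \<le> L" and R: "0 \<le> R"
  shows "\<exists>C\<ge>1. \<forall>(f::'a::euclidean_space \<Rightarrow> 'b::real_normed_vector) \<phi> M.
    bd n M f \<longrightarrow> bd n R \<phi> \<longrightarrow> near_id L \<phi> \<longrightarrow> bd n (C * M) (\<lambda>x. f (x + \<phi> x))"
proof -
  obtain C where C: "C \<ge> 1" and *: "\<forall>(f::'a \<Rightarrow> 'b) \<phi> M H K. cls 0 n M H f \<longrightarrow> modulus H \<longrightarrow> cls 0 n R K \<phi> \<longrightarrow> near_id L \<phi> \<longrightarrow>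
    cls 0 n (C * M) (\<lambda>t. C * (H t + M * K t + M * cap_power 0 t)) (\<lambda>x. f (x + \<phi> x))"
    using cls_compose[of 0 L R n, where 'a='a and 'b='b] L R by auto
  have "bd n (C * M) (\<lambda>x. f (x + \<phi> x))" if f: "bd n M f" and "bd n R \<phi>" "near_id L \<phi>" for f :: "'a \<Rightarrow> 'b" and \<phi> M
  proof -
    have "modulus (\<lambda>_. 4 * M)" using cls_nonneg[OF f] by (simp add: modulus_def)
    then show ?thesis using * that by (blast intro: cls_bd)
  qed
  then show ?thesis using C by blast
qed

text \<open>The top derivative of \<open>f\<close> is merely Hoelder, so the uniform distance
  \<open>e\<close> enters as \<open>e powr \<gamma>\<close>, while the distance \<open>d\<close>
  including derivatives enters linearly. Keeping the two apart permits a linear Gronwall argument in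
  \<open>d\<close> once \<open>e\<close> is known.\<close>

lemma bd_compose_diff:
  assumes \<gamma>: "0 \<le> \<gamma>" "\<gamma> \<le> 1" and L: "1 \<le> L" and R: "0 \<le> R"
  shows "\<exists>C\<ge>1. \<forall>(f::'a::euclidean_space \<Rightarrow> 'b::real_normed_vector) \<phi> \<psi> M H e d.
    cls \<gamma> n M H f \<longrightarrow> bd n R \<phi> \<longrightarrow> bd n R \<psi> \<longrightarrow> near_id L \<psi> \<longrightarrow> (\<forall>x. norm (\<phi> x - \<psi> x) \<le> e) \<longrightarrow>
    bd n d (\<lambda>x. \<phi> x - \<psi> x) \<longrightarrow> bd n (C * (M * (e powr \<gamma> + d))) (\<lambda>x. f (x + \<phi> x) - f (x + \<psi> x))"
proof -
  have base: "norm (f (x + \<phi> x) - f (x + \<psi> x)) \<le> 2 * (M * (e powr \<gamma> + d))"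
    if f: "cls \<gamma> n M H f" and e: "\<forall>x. norm (\<phi> x - \<psi> x) \<le> e" and d: "bd n d (\<lambda>x. \<phi> x - \<psi> x)"
    for f :: "'a \<Rightarrow> 'b" and \<phi> \<psi> M H e d x n
  proof -
    note M = cls_nonneg[OF f] and dn = cls_nonneg[OF d]
    have "norm (f (x + \<phi> x) - f (x + \<psi> x)) \<le> 2 * M * norm ((x + \<phi> x) - (x + \<psi> x)) powr \<gamma>"
      by (rule cls_holder[OF f \<gamma>])
    also have "\<dots> \<le> 2 * M * e powr \<gamma>"
      using M \<gamma> e by (intro mult_left_mono powr_mono2) auto
    also have "\<dots> \<le> 2 * (M * (e powr \<gamma> + d))" using M dn by (simp add: distrib_left)
    finally show ?thesis .
  qed
  show ?thesis
  proof (induction n)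
    case 0
    have "bd 0 (2 * (M * (e powr \<gamma> + d))) (\<lambda>x. f (x + \<phi> x) - f (x + \<psi> x))"
      if "cls \<gamma> 0 M H f" "\<forall>x. norm (\<phi> x - \<psi> x) \<le> e" "bd 0 d (\<lambda>x. \<phi> x - \<psi> x)" for f :: "'a \<Rightarrow> 'b" and \<phi> \<psi> M H e d
      by (intro bd_0I base[OF that])
    then show ?case
      by (intro exI[of _ 2] conjI allI impI) (simp del: cls.simps, assumption)
  next
    case (Suc n)
    then obtain C0 where C0: "1 \<le> C0" and IH: "\<And>(f::'a \<Rightarrow> 'b) \<phi> \<psi> M H e d.
      cls \<gamma> n M H f \<Longrightarrow> bd n R \<phi> \<Longrightarrow> bd n R \<psi> \<Longrightarrow> near_id L \<psi> \<Longrightarrow> (\<forall>x. norm (\<phi> x - \<psi> x) \<le> e) \<Longrightarrow>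
      bd n d (\<lambda>x. \<phi> x - \<psi> x) \<Longrightarrow> bd n (C0 * (M * (e powr \<gamma> + d))) (\<lambda>x. f (x + \<phi> x) - f (x + \<psi> x))" by blast
    obtain C1 where C1: "1 \<le> C1" and comp: "\<And>(f::'a \<Rightarrow> 'b) \<phi> M.
      bd n M f \<Longrightarrow> bd n R \<phi> \<Longrightarrow> near_id L \<phi> \<Longrightarrow> bd n (C1 * M) (\<lambda>x. f (x + \<phi> x))"
      using bd_compose[OF L R, of n] by blast
    let ?N = "real (card (Basis :: 'a set))"
    let ?c = "8 * 10 ^ n :: real"
    \<comment> \<open>The 2 serves the bound on the function itself. In the derivative,
      \<open>C0\<close> belongs to the difference of \<open>dderiv j f\<close> along the two maps
      and \<open>C1\<close> to the difference of the inner derivatives.\<close>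
    define C where "C = 2 + ?N * (?c * ((1 + R) * C0 + C1))"
    have C2: "2 \<le> C" using C0 C1 R by (simp add: C_def)
    have "bd (Suc n) (C * (M * (e powr \<gamma> + d))) (\<lambda>x. f (x + \<phi> x) - f (x + \<psi> x))"
      if f: "cls \<gamma> (Suc n) M H f" and \<phi>: "bd (Suc n) R \<phi>" and \<psi>: "bd (Suc n) R \<psi>" and n: "near_id L \<psi>"
        and e: "\<forall>x. norm (\<phi> x - \<psi> x) \<le> e" and d: "bd (Suc n) d (\<lambda>x. \<phi> x - \<psi> x)"
      for f :: "'a \<Rightarrow> 'b" and \<phi> \<psi> M H e d
    proof -
      let ?E = "M * (e powr \<gamma> + d)"
      note M = cls_nonneg[OF f] and dn = cls_nonneg[OF d]
      have E: "0 \<le> ?E" "M * d \<le> ?E" using M dn by (auto simp: distrib_left)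
      have D: "((\<lambda>x. f (x + \<phi> x)) has_derivative (\<lambda>v. \<Sum>j\<in>Basis. ((v + dderiv v \<phi> x) \<bullet> j) *\<^sub>R dderiv j f (x + \<phi> x))) (at x)"
          "((\<lambda>x. f (x + \<psi> x)) has_derivative (\<lambda>v. \<Sum>j\<in>Basis. ((v + dderiv v \<psi> x) \<bullet> j) *\<^sub>R dderiv j f (x + \<psi> x))) (at x)" for x
        using f \<phi> \<psi> by (auto intro!: has_derivative_displacement)
      note D' = has_derivative_diff[OF D]
      have "bd n (C * ?E) (dderiv v (\<lambda>x. f (x + \<phi> x) - f (x + \<psi> x)))" if v: "norm v \<le> 1" for v
      proof -
        have 1: "bd n (C0 * ?E) (\<lambda>x. dderiv j f (x + \<phi> x) - dderiv j f (x + \<psi> x))" if "j \<in> Basis" for j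
        proof -
          have "cls \<gamma> n M H (dderiv j f)" using f that by simp
          from IH[OF this bd_lower[OF \<phi>] bd_lower[OF \<psi>] n e bd_lower[OF d]] show ?thesis .
        qed
        have 2: "bd n (1 + R) (\<lambda>x. (v + dderiv v \<phi> x) \<bullet> j)" if "j \<in> Basis" for j
        proof -
          have "cls 0 n (1 + R) (\<lambda>t. 0 + 4 * R) (\<lambda>x. (v + dderiv v \<phi> x) \<bullet> j)"
            using v \<phi> that by (intro cls_inner cls_add cls_const) auto
          then show ?thesis by (rule cls_bd)
        qed
        have 3: "bd n (C1 * M) (\<lambda>x. dderiv j f (x + \<psi> x))" if "j \<in> Basis" for j
        proof -
          have "bd n M (dderiv j f)" using cls_bd[OF f] that by simp
          from comp[OF this bd_lower[OF \<psi>] n] show ?thesis .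
        qed
        have 4: "bd n d (\<lambda>x. (dderiv v \<phi> x - dderiv v \<psi> x) \<bullet> j)" if "j \<in> Basis" for j
        proof -
          have "bd n d (dderiv v (\<lambda>x. \<phi> x - \<psi> x))" using d v by simp
          also have "dderiv v (\<lambda>x. \<phi> x - \<psi> x) = (\<lambda>x. dderiv v \<phi> x - dderiv v \<psi> x)"
            using \<phi> \<psi> by (intro dderiv_diff) auto
          finally show ?thesis using that by (intro cls_inner) auto
        qed
        have 5: "cls 0 n (?c * ((1 + R) * (C0 * ?E)) + ?c * (d * (C1 * M)))
          (\<lambda>_. 4 * (?c * ((1 + R) * (C0 * ?E))) + 4 * (?c * (d * (C1 * M))))
          (\<lambda>x. ((v + dderiv v \<phi> x) \<bullet> j) *\<^sub>R (dderiv j f (x + \<phi> x) - dderiv j f (x + \<psi> x)) +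
            ((dderiv v \<phi> x - dderiv v \<psi> x) \<bullet> j) *\<^sub>R dderiv j f (x + \<psi> x))" if "j \<in> Basis" for j
          by (rule cls_add[OF bd_mult[OF 2[OF that] 1[OF that]] bd_mult[OF 4[OF that] 3[OF that]]])
        have e: "dderiv v (\<lambda>x. f (x + \<phi> x) - f (x + \<psi> x)) =
          (\<lambda>x. \<Sum>j\<in>Basis. ((v + dderiv v \<phi> x) \<bullet> j) *\<^sub>R (dderiv j f (x + \<phi> x) - dderiv j f (x + \<psi> x)) +
            ((dderiv v \<phi> x - dderiv v \<psi> x) \<bullet> j) *\<^sub>R dderiv j f (x + \<psi> x))"
          unfolding dderiv_eq[OF D'] sum_subtractf[symmetric]
          by (intro ext sum.cong refl) (simp add: algebra_simps)
        have "bd n (?N * (?c * ((1 + R) * (C0 * ?E)) + ?c * (d * (C1 * M)))) (dderiv v (\<lambda>x. f (x + \<phi> x) - f (x + \<psi> x)))"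
          unfolding e by (rule cls_bd[OF cls_sum[OF finite_Basis 5]])
        then show ?thesis
        proof (rule cls_mono)
          have "?c * ((1 + R) * (C0 * ?E)) + ?c * (d * (C1 * M)) \<le> ?c * ((1 + R) * (C0 * ?E)) + ?c * (C1 * ?E)"
            using mult_left_mono[OF mult_left_mono[OF E(2), of C1], of ?c] C1 by (simp add: ac_simps)
          also have "\<dots> = ?c * ((1 + R) * C0 + C1) * ?E" by (simp add: algebra_simps)
          finally have "?N * (?c * ((1 + R) * (C0 * ?E)) + ?c * (d * (C1 * M))) \<le> ?N * (?c * ((1 + R) * C0 + C1) * ?E)"
            by (rule mult_left_mono) simp
          also have "\<dots> = (C - 2) * ?E" by (simp add: C_def algebra_simps)
          also have "\<dots> \<le> C * ?E" using E by (intro mult_right_mono) auto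
          finally show "?N * (?c * ((1 + R) * (C0 * ?E)) + ?c * (d * (C1 * M))) \<le> C * ?E" .
          then show "4 * (?N * (?c * ((1 + R) * (C0 * ?E)) + ?c * (d * (C1 * M)))) \<le> 4 * (C * ?E)" by simp
        qed
      qed
      moreover have "norm (f (x + \<phi> x) - f (x + \<psi> x)) \<le> C * ?E" for x
        using order_trans[OF base[OF f e d] mult_right_mono[OF C2 E(1)]] .
      moreover have "(\<lambda>x. f (x + \<phi> x) - f (x + \<psi> x)) differentiable at x" for x
        using D' unfolding differentiable_def by blast
      ultimately show ?thesis by simp
    qed
    then show ?case using C2 by (intro exI[of _ C]) auto
  qed
qed

text \<open>Mean value inequality for \<open>g\<close> minus its linearization at \<open>x\<close>,
  on the ball of radius \<open>norm w\<close>. Being an explicit inequality, the estimate survives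
  pointwise limits and integrals, which differentiability by itself does not.\<close>

lemma cls_remainder:
  fixes g :: "'a::euclidean_space \<Rightarrow> 'b::real_normed_vector"
  assumes g: "cls \<gamma> (Suc n) M H g" and \<gamma>: "0 \<le> \<gamma>" "\<gamma> \<le> 1"
  shows "norm (g (x + w) - g x - dderiv w g x) \<le> 2 * M * norm w powr (1 + \<gamma>)"
proof -
  note M = cls_nonneg[OF g]
  let ?F = "\<lambda>y. g y - dderiv (y - x) g x"
  have dg: "g differentiable at y" for y using g by simp
  have bl: "bounded_linear (\<lambda>v. dderiv v g x)" using has_derivative_bounded_linear[OF has_derivative_dderiv[OF dg]] .
  have D: "(?F has_derivative (\<lambda>v. dderiv v g y - dderiv v g x)) (at y)" for y
    by (intro has_derivative_diff has_derivative_dderiv dg bounded_linear.has_derivative[OF bl])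
      (auto intro!: derivative_eq_intros)
  have "norm (?F (x + w) - ?F x) \<le> 2 * M * norm w powr \<gamma> * norm (x + w - x)"
  proof (rule differentiable_lipschitz[OF _ D])
    show "convex (cball x (norm w))" by simp
    fix y u assume y: "y \<in> cball x (norm w)"
    have "norm (dderiv u ?F y) \<le> 2 * M * norm w powr \<gamma> * norm u"
    proof (rule dderiv_bound_homogeneous)
      show "?F differentiable at y" using D unfolding differentiable_def by blast
      fix v :: 'a assume "norm v \<le> 1"
      then have "cls \<gamma> n M H (dderiv v g)" using g by simp
      from cls_holder[OF this \<gamma>] have "norm (dderiv v g y - dderiv v g x) \<le> 2 * M * norm (y - x) powr \<gamma>" .
      also have "\<dots> \<le> 2 * M * norm w powr \<gamma>"
        using y M \<gamma> by (intro mult_left_mono powr_mono2) (auto simp: dist_norm norm_minus_commute)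
      finally show "norm (dderiv v ?F y) \<le> 2 * M * norm w powr \<gamma>" unfolding dderiv_eq[OF D] .
    qed
    then show "norm (dderiv u g y - dderiv u g x) \<le> 2 * M * norm w powr \<gamma> * norm u" unfolding dderiv_eq[OF D] .
  qed (auto simp: dist_norm)
  moreover have "dderiv 0 g x = 0" using linear_0[OF linear_dderiv[OF dg]] .
  ultimately show ?thesis by (cases "w = 0") (simp_all add: powr_add algebra_simps)
qed

lemma has_derivative_remainder:
  fixes f :: "'a::euclidean_space \<Rightarrow> 'b::real_normed_vector"
  assumes "linear L" "0 < \<gamma>" "\<And>w. norm (f (x + w) - f x - L w) \<le> c * norm w powr (1 + \<gamma>)"
  shows "(f has_derivative L) (at x)"
  unfolding has_derivative_at
proof
  show "bounded_linear L" using assms(1) by (simp add: linear_conv_bounded_linear)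
  have "((\<lambda>h::'a. norm h powr \<gamma>) \<longlongrightarrow> 0 powr \<gamma>) (at 0)"
    by (rule tendsto_powr') (use assms in \<open>auto intro!: tendsto_eq_intros\<close>)
  then have "((\<lambda>h::'a. c * norm h powr \<gamma>) \<longlongrightarrow> 0) (at 0)" using assms(2) by (auto intro!: tendsto_eq_intros)
  then show "((\<lambda>h. norm (f (x + h) - f x - L h) / norm h) \<longlongrightarrow> 0) (at 0)"
  proof (rule Lim_null_comparison[rotated])
    have "norm (norm (f (x + h) - f x - L h) / norm h) \<le> c * norm h powr \<gamma>" if "h \<noteq> 0" for h
      using assms(3)[of h] that by (simp add: powr_add divide_le_eq ac_simps)
    then show "\<forall>\<^sub>F h in at 0. norm (norm (f (x + h) - f x - L h) / norm h) \<le> c * norm h powr \<gamma>"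
      by (auto simp: eventually_at_filter)
  qed
qed

text \<open>The error is uniform in \<open>x\<close> and over all \<open>g\<close> sharing
  \<open>M\<close>, so derivatives inherit convergence and measurability from values.\<close>

lemma dderiv_quotient_error:
  fixes g :: "'a::euclidean_space \<Rightarrow> 'b::real_normed_vector"
  assumes g: "cls \<gamma> (Suc n) M H g" and \<gamma>: "0 \<le> \<gamma>" "\<gamma> \<le> 1" and r: "0 < r"
  shows "norm (dderiv v g x - (1 / r) *\<^sub>R (g (x + r *\<^sub>R v) - g x)) \<le> 2 * M * norm v powr (1 + \<gamma>) * r powr \<gamma>"
proof -
  have dg: "g differentiable at y" for y using g by simp
  have "dderiv v g x - (1 / r) *\<^sub>R (g (x + r *\<^sub>R v) - g x) = - (1 / r) *\<^sub>R (g (x + r *\<^sub>R v) - g x - dderiv (r *\<^sub>R v) g x)"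
    unfolding dderiv_scaleR_vec[OF dg] using r by (simp add: algebra_simps)
  also have "norm \<dots> \<le> (1 / r) * (2 * M * norm (r *\<^sub>R v) powr (1 + \<gamma>))"
    using mult_left_mono[OF cls_remainder[OF g \<gamma>, of x "r *\<^sub>R v"], of "1 / r"] r by simp
  also have "\<dots> = 2 * M * norm v powr (1 + \<gamma>) * r powr \<gamma>"
    using r by (simp add: powr_mult powr_add field_simps)
  finally show ?thesis .
qed

text \<open>For a fixed step the difference quotients converge, and they approximate the derivatives
  uniformly along the sequence; hence the derivatives are Cauchy. The remainder estimate then
  identifies their limit as the derivative of \<open>g\<close>. A positive \<gamma> is what makes
  the quotient error small.\<close>

lemma cls_limit:
  fixes f :: "nat \<Rightarrow> 'a::euclidean_space \<Rightarrow> 'b::banach"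
  assumes \<gamma>: "0 < \<gamma>" "\<gamma> \<le> 1"
  shows "(\<And>k. cls \<gamma> n M H (f k)) \<Longrightarrow> (\<And>x. (\<lambda>k. f k x) \<longlonglongrightarrow> g x) \<Longrightarrow> cls \<gamma> n M H g"
proof (induction n arbitrary: f g)
  case 0
  have "norm (g x) \<le> M" for x
    by (rule LIMSEQ_le_const2[OF tendsto_norm[OF 0(2)]]) (use 0(1) in auto)
  moreover have "norm (g x - g y) \<le> 2 * M * norm (x - y) powr \<gamma>" for x y
    by (rule LIMSEQ_le_const2[OF tendsto_norm[OF tendsto_diff[OF 0(2) 0(2)]]]) (use 0(1) in auto)
  moreover have "norm (g (x + 2 *\<^sub>R h) - 2 *\<^sub>R g (x + h) + g x) \<le> H (norm h)" for x h
    by (rule LIMSEQ_le_const2[OF tendsto_norm[OF tendsto_add[OF tendsto_diff[OF 0(2) tendsto_scaleR[OF tendsto_const 0(2)]] 0(2)]]])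
      (use 0(1) in auto)
  ultimately show ?case by simp
next
  case (Suc n)
  have \<gamma>0: "0 \<le> \<gamma>" using \<gamma> by simp
  have dg: "f k differentiable at y" for k y using Suc.prems(1) by simp
  have "Cauchy (\<lambda>k. dderiv v (f k) x)" for v x
  proof (rule metric_CauchyI)
    fix e :: real assume e: "0 < e"
    define c where "c = 2 * M * norm v powr (1 + \<gamma>)"
    have c: "0 \<le> c" using cls_nonneg[OF Suc.prems(1)] by (simp add: c_def)
    \<comment> \<open>The step solving \<open>r powr \<gamma> = e / (4 * (c + 1))\<close>; the
      summand 1 admits \<open>c = 0\<close>.\<close>
    define r where "r = (e / (4 * (c + 1))) powr (1 / \<gamma>)"
    have r: "0 < r" using e c by (simp add: r_def)
    have "r powr \<gamma> = e / (4 * (c + 1))" using \<gamma> e c by (simp add: r_def powr_powr)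
    then have "c * r powr \<gamma> = (c / (c + 1)) * (e / 4)" by simp
    also have "\<dots> \<le> 1 * (e / 4)" using e c by (intro mult_right_mono) auto
    finally have cr: "c * r powr \<gamma> \<le> e / 4" by simp
    define q where "q k = (1 / r) *\<^sub>R (f k (x + r *\<^sub>R v) - f k x)" for k
    have "q \<longlonglongrightarrow> (1 / r) *\<^sub>R (g (x + r *\<^sub>R v) - g x)"
      unfolding q_def by (intro tendsto_intros Suc.prems)
    then have "Cauchy q" by (rule LIMSEQ_imp_Cauchy)
    then obtain N where N: "\<forall>m\<ge>N. \<forall>k\<ge>N. dist (q m) (q k) < e / 2"
      using metric_CauchyD[of q "e / 2"] e by auto
    have err: "dist (dderiv v (f k) x) (q k) \<le> e / 4" for k
      using dderiv_quotient_error[OF Suc.prems(1) \<gamma>0 \<gamma>(2) r, of v k x] cr by (simp add: dist_norm q_def c_def)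
    have "dist (dderiv v (f m) x) (dderiv v (f k) x) < e" if "m \<ge> N" "k \<ge> N" for m k
    proof -
      have "dist (dderiv v (f m) x) (dderiv v (f k) x) \<le> dist (dderiv v (f m) x) (q m) + dist (q m) (q k) + dist (q k) (dderiv v (f k) x)"
        by (meson add_mono dist_triangle order_refl order_trans)
      also have "\<dots> < e / 4 + e / 2 + e / 4"
        using err[of m] err[of k] N that by (intro add_le_less_mono add_less_le_mono) (auto simp: dist_commute add_le_less_mono)
      finally show ?thesis by simp
    qed
    then show "\<exists>N. \<forall>m\<ge>N. \<forall>k\<ge>N. dist (dderiv v (f m) x) (dderiv v (f k) x) < e" by blast
  qed
  then have conv: "convergent (\<lambda>k. dderiv v (f k) x)" for v x by (rule Cauchy_convergent)
  define L where "L x v = lim (\<lambda>k. dderiv v (f k) x)" for x v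
  have L: "(\<lambda>k. dderiv v (f k) x) \<longlonglongrightarrow> L x v" for x v
    unfolding L_def using conv convergent_LIMSEQ_iff by blast
  have lin: "linear (L x)" for x
  proof (rule linearI)
    show "L x (a + b) = L x a + L x b" for a b
    proof (rule LIMSEQ_unique[OF L])
      show "(\<lambda>k. dderiv (a + b) (f k) x) \<longlonglongrightarrow> L x a + L x b"
        using tendsto_add[OF L L, of a x b x] by (simp add: linear_add[OF linear_dderiv[OF dg]])
    qed
    show "L x (r *\<^sub>R b) = r *\<^sub>R L x b" for r b
    proof (rule LIMSEQ_unique[OF L])
      show "(\<lambda>k. dderiv (r *\<^sub>R b) (f k) x) \<longlonglongrightarrow> r *\<^sub>R L x b"
        using tendsto_scaleR[OF tendsto_const L, of r b x] by (simp add: linear_cmul[OF linear_dderiv[OF dg]])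
    qed
  qed
  have D: "(g has_derivative L x) (at x)" for x
  proof (rule has_derivative_remainder[OF lin \<gamma>(1)])
    show "norm (g (x + w) - g x - L x w) \<le> 2 * M * norm w powr (1 + \<gamma>)" for w
      by (rule LIMSEQ_le_const2[OF tendsto_norm[OF tendsto_diff[OF tendsto_diff[OF Suc.prems(2) Suc.prems(2)] L]]])
        (use cls_remainder[OF Suc.prems(1) \<gamma>0 \<gamma>(2)] in auto)
  qed
  have "norm (g x) \<le> M" for x
    by (rule LIMSEQ_le_const2[OF tendsto_norm[OF Suc.prems(2)]]) (use Suc.prems(1) in auto)
  moreover have "g differentiable at x" for x using D unfolding differentiable_def by blast
  moreover have "cls \<gamma> n M H (dderiv v g)" if "norm v \<le> 1" for v
  proof (rule Suc.IH)
    show "cls \<gamma> n M H (dderiv v (f k))" for k using Suc.prems(1) that by simp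
    show "(\<lambda>k. dderiv v (f k) x) \<longlonglongrightarrow> dderiv v g x" for x using L by (simp add: dderiv_eq[OF D])
  qed
  ultimately show ?case by simp
qed

text \<open>The same family is assumed in two classes. The one with positive \<gamma> justifies
  differentiating under the integral; the one with the exponent \<open>\<gamma>'\<close> supplies
  the bounds that get integrated. With \<open>\<gamma>' = 0\<close> this integrates plain
  \<open>C\<^sup>n\<close> bounds.\<close>

lemma cls_integral:
  fixes g :: "real \<Rightarrow> 'a::euclidean_space \<Rightarrow> 'b::euclidean_space"
  assumes \<gamma>: "0 < \<gamma>" "\<gamma> \<le> 1" and int: "integrable N m" "integrable N b" "\<And>t. 0 \<le> t \<Longrightarrow> integrable N (\<lambda>s. k s t)"
  shows "(\<And>s. s \<in> space N \<Longrightarrow> cls \<gamma> n (m s) (h s) (g s)) \<Longrightarrow> (\<And>s. s \<in> space N \<Longrightarrow> cls \<gamma>' n (b s) (k s) (g s)) \<Longrightarrow>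
    (\<And>x. (\<lambda>s. g s x) \<in> borel_measurable N) \<Longrightarrow>
    cls \<gamma>' n (\<integral>s. b s \<partial>N) (\<lambda>t. \<integral>s. k s t \<partial>N) (\<lambda>x. \<integral>s. g s x \<partial>N)"
proof (induction n arbitrary: g)
  case 0
  have i: "integrable N (\<lambda>s. g s x)" for x
    using 0 cls_bound[OF 0(2)]
    by (intro Bochner_Integration.integrable_bound[OF int(2)]) (auto intro!: AE_I2 order_trans[OF cls_bound[OF 0(2)]])
  have "norm (\<integral>s. g s x \<partial>N) \<le> (\<integral>s. b s \<partial>N)" for x
    using 0(2) by (intro Bochner_Integration.integral_norm_bound_integral i int) auto
  moreover have "norm ((\<integral>s. g s x \<partial>N) - (\<integral>s. g s y \<partial>N)) \<le> 2 * (\<integral>s. b s \<partial>N) * norm (x - y) powr \<gamma>'" for x y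
  proof -
    have "norm (\<integral>s. g s x - g s y \<partial>N) \<le> (\<integral>s. 2 * b s * norm (x - y) powr \<gamma>' \<partial>N)"
      using 0(2) by (intro Bochner_Integration.integral_norm_bound_integral Bochner_Integration.integrable_diff i
          integrable_mult_left integrable_mult_right int) auto
    then show ?thesis by (simp add: i)
  qed
  moreover have "norm ((\<integral>s. g s (x + 2 *\<^sub>R h) \<partial>N) - 2 *\<^sub>R (\<integral>s. g s (x + h) \<partial>N) + (\<integral>s. g s x \<partial>N)) \<le> (\<integral>s. k s (norm h) \<partial>N)" for x h
  proof -
    have "norm (\<integral>s. g s (x + 2 *\<^sub>R h) - 2 *\<^sub>R g s (x + h) + g s x \<partial>N) \<le> (\<integral>s. k s (norm h) \<partial>N)"
      using 0(2) by (intro Bochner_Integration.integral_norm_bound_integral Bochner_Integration.integrable_add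
         Bochner_Integration.integrable_diff integrable_scaleR_right i int) auto
    then show ?thesis by (simp add: i)
  qed
  ultimately show ?case by simp
next
  case (Suc n)
  have \<gamma>0: "0 \<le> \<gamma>" using \<gamma> by simp
  have dg: "g s differentiable at y" if "s \<in> space N" for s y using Suc.prems(1)[OF that] by simp
  have i: "integrable N (\<lambda>s. g s x)" for x
    using Suc.prems cls_bound[OF Suc.prems(2)]
    by (intro Bochner_Integration.integrable_bound[OF int(2)]) (auto intro!: AE_I2 order_trans[OF cls_bound[OF Suc.prems(2)]])
  \<comment> \<open>For each \<open>s\<close> the derivative is the limit of difference quotients
    with steps \<open>1 / Suc i\<close>, which are measurable in \<open>s\<close>.\<close>
  have dmeas: "(\<lambda>s. dderiv v (g s) x) \<in> borel_measurable N" for v x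
  proof (rule borel_measurable_LIMSEQ_metric)
    let ?q = "\<lambda>i s. (1 / (1 / real (Suc i))) *\<^sub>R (g s (x + (1 / real (Suc i)) *\<^sub>R v) - g s x)"
    show "?q i \<in> borel_measurable N" for i
      using Suc.prems(3) by (intro borel_measurable_scaleR borel_measurable_const borel_measurable_diff)
    fix s assume s: "s \<in> space N"
    have "(\<lambda>i. (1 / real (Suc i)) powr \<gamma>) \<longlonglongrightarrow> 0 powr \<gamma>"
      by (rule tendsto_powr') (use \<gamma> LIMSEQ_inverse_real_of_nat in \<open>auto simp: inverse_eq_divide\<close>)
    then have z: "(\<lambda>i. 2 * m s * norm v powr (1 + \<gamma>) * (1 / real (Suc i)) powr \<gamma>) \<longlonglongrightarrow> 0"
      using tendsto_mult[OF tendsto_const, of "\<lambda>i. (1 / real (Suc i)) powr \<gamma>" 0 sequentially "2 * m s * norm v powr (1 + \<gamma>)"] \<gamma>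
      by simp
    have "(\<lambda>i. ?q i s - dderiv v (g s) x) \<longlonglongrightarrow> 0"
    proof (rule Lim_null_comparison[OF always_eventually z], rule allI)
      fix i
      show "norm (?q i s - dderiv v (g s) x) \<le> 2 * m s * norm v powr (1 + \<gamma>) * (1 / real (Suc i)) powr \<gamma>"
        using dderiv_quotient_error[OF Suc.prems(1)[OF s] \<gamma>0 \<gamma>(2), of "1 / real (Suc i)" v x]
        by (simp add: norm_minus_commute)
    qed
    then show "(\<lambda>i. ?q i s) \<longlonglongrightarrow> dderiv v (g s) x" by (simp add: LIM_zero_iff)
  qed
  define L where "L x v = (\<integral>s. dderiv v (g s) x \<partial>N)" for x v
  have di: "integrable N (\<lambda>s. dderiv v (g s) x)" for v x
  proof (rule Bochner_Integration.integrable_bound)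
    show "integrable N (\<lambda>s. m s * norm v)" using int by simp
    show "AE s in N. norm (dderiv v (g s) x) \<le> norm (m s * norm v)"
    proof (rule AE_I2)
      fix s assume s: "s \<in> space N"
      have "norm (dderiv v (g s) x) \<le> m s * norm v"
      proof (rule dderiv_bound_homogeneous[OF dg[OF s]])
        fix v :: 'a assume "norm v \<le> 1"
        then have "cls \<gamma> n (m s) (h s) (dderiv v (g s))" using Suc.prems(1)[OF s] by simp
        then show "norm (dderiv v (g s) x) \<le> m s" by (rule cls_bound)
      qed
      then show "norm (dderiv v (g s) x) \<le> norm (m s * norm v)" by simp
    qed
  qed (rule dmeas)
  have lin: "linear (L x)" for x
  proof (rule linearI)
    have "L x (a + b) = (\<integral>s. dderiv a (g s) x + dderiv b (g s) x \<partial>N)" for a b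
      unfolding L_def by (intro Bochner_Integration.integral_cong refl linear_add[OF linear_dderiv[OF dg]])
    then show "L x (a + b) = L x a + L x b" for a b by (simp add: di L_def)
    have "L x (r *\<^sub>R b) = (\<integral>s. r *\<^sub>R dderiv b (g s) x \<partial>N)" for r b
      unfolding L_def by (intro Bochner_Integration.integral_cong refl linear_cmul[OF linear_dderiv[OF dg]])
    then show "L x (r *\<^sub>R b) = r *\<^sub>R L x b" for r b by (simp add: L_def)
  qed
  let ?G = "\<lambda>x. \<integral>s. g s x \<partial>N"
  have D: "(?G has_derivative L x) (at x)" for x
  proof (rule has_derivative_remainder[OF lin \<gamma>(1)])
    fix w
    have "norm (\<integral>s. g s (x + w) - g s x - dderiv w (g s) x \<partial>N) \<le> (\<integral>s. 2 * m s * norm w powr (1 + \<gamma>) \<partial>N)"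
      using cls_remainder[OF Suc.prems(1) \<gamma>0 \<gamma>(2)]
      by (intro Bochner_Integration.integral_norm_bound_integral Bochner_Integration.integrable_diff i di
          integrable_mult_left integrable_mult_right int) auto
    then show "norm (?G (x + w) - ?G x - L x w) \<le> 2 * (\<integral>s. m s \<partial>N) * norm w powr (1 + \<gamma>)"
      by (simp add: i di L_def)
  qed
  have "norm (?G x) \<le> (\<integral>s. b s \<partial>N)" for x
    using Suc.prems(2) by (intro Bochner_Integration.integral_norm_bound_integral i int) auto
  moreover have "?G differentiable at x" for x using D unfolding differentiable_def by blast
  moreover have "cls \<gamma>' n (\<integral>s. b s \<partial>N) (\<lambda>t. \<integral>s. k s t \<partial>N) (dderiv v ?G)" if "norm v \<le> 1" for v
  proof -
    have "cls \<gamma>' n (\<integral>s. b s \<partial>N) (\<lambda>t. \<integral>s. k s t \<partial>N) (\<lambda>x. \<integral>s. dderiv v (g s) x \<partial>N)"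
      using Suc.prems that by (intro Suc.IH dmeas) auto
    moreover have "dderiv v ?G = (\<lambda>x. \<integral>s. dderiv v (g s) x \<partial>N)"
      using dderiv_eq[OF D] by (auto simp: L_def)
    ultimately show ?thesis by simp
  qed
  ultimately show ?case by simp
qed

section \<open>Iterated directional derivatives and higher derivatives\<close>

text \<open>The head of the list is the direction differentiated last, as in
  \<open>nderiv\<close>.\<close>

definition iter_dderiv :: "'a::real_normed_vector list \<Rightarrow> ('a \<Rightarrow> 'b::real_normed_vector) \<Rightarrow> 'a \<Rightarrow> 'b" where
  "iter_dderiv hs f = foldr dderiv hs f"

lemma iter_dderiv_simps [simp]: "iter_dderiv [] f = f" "iter_dderiv (h # hs) f = dderiv h (iter_dderiv hs f)"
  by (simp_all add: iter_dderiv_def)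

definition unit_list :: "'a::real_normed_vector list \<Rightarrow> bool" where
  "unit_list hs \<longleftrightarrow> (\<forall>h\<in>set hs. norm h \<le> 1)"

lemma unit_list_simps [simp]: "unit_list []" "unit_list (h # hs) \<longleftrightarrow> norm h \<le> 1 \<and> unit_list hs"
  by (auto simp: unit_list_def)

lemma nderiv_eq_iter_dderiv: "length hs = k \<Longrightarrow> nderiv k f x hs = iter_dderiv hs f x"
proof (induction k arbitrary: hs x)
  case (Suc k)
  then obtain h hs' where hs: "hs = h # hs'" "length hs' = k" by (cases hs) auto
  then have "(\<lambda>y. nderiv k f y hs') = iter_dderiv hs' f" using Suc.IH by auto
  then show ?case by (simp add: hs dderiv_def)
qed simp

lemma cls_iter_dderiv: "cls \<gamma> n M H f \<Longrightarrow> unit_list hs \<Longrightarrow> length hs \<le> n \<Longrightarrow> cls \<gamma> (n - length hs) M H (iter_dderiv hs f)"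
proof (induction hs)
  case (Cons h hs)
  then have "cls \<gamma> (Suc (n - length (h # hs))) M H (iter_dderiv hs f)" by (simp add: Suc_diff_Suc)
  then show ?case using Cons.prems by simp
qed simp

lemma cls_iter_dderiv_bound: "cls \<gamma> n M H f \<Longrightarrow> unit_list hs \<Longrightarrow> length hs \<le> n \<Longrightarrow> norm (iter_dderiv hs f x) \<le> M"
  using cls_bound[OF cls_iter_dderiv] .

lemma cls_iter_dderiv_differentiable: "cls \<gamma> n M H f \<Longrightarrow> unit_list hs \<Longrightarrow> length hs < n \<Longrightarrow> iter_dderiv hs f differentiable at x"
  using cls_iter_dderiv[of \<gamma> n M H f hs] by (cases "n - length hs") auto

lemma cls_iter_dderiv_top: "cls \<gamma> n M H f \<Longrightarrow> unit_list hs \<Longrightarrow> length hs = n \<Longrightarrow> cls \<gamma> 0 M H (iter_dderiv hs f)"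
  using cls_iter_dderiv[of \<gamma> n M H f hs] by simp

lemma cls_ddI:
  assumes "\<And>hs x. unit_list hs \<Longrightarrow> length hs \<le> n \<Longrightarrow> norm (iter_dderiv hs f x) \<le> M"
    "\<And>hs x. unit_list hs \<Longrightarrow> length hs < n \<Longrightarrow> iter_dderiv hs f differentiable at x"
    "\<And>hs. unit_list hs \<Longrightarrow> length hs = n \<Longrightarrow> cls \<gamma> 0 M H (iter_dderiv hs f)"
  shows "cls \<gamma> n M H f"
proof -
  have "unit_list hs \<Longrightarrow> length hs + m = n \<Longrightarrow> cls \<gamma> m M H (iter_dderiv hs f)" for m hs
  proof (induction m arbitrary: hs)
    case 0
    then show ?case using assms(3) by simp
  next
    case (Suc m)
    have "cls \<gamma> m M H (iter_dderiv (v # hs) f)" if "norm v \<le> 1" for v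
      using Suc.prems that by (intro Suc.IH) auto
    then show ?case using assms(1,2) Suc.prems by simp
  qed
  from this[of "[]" n] show ?thesis by simp
qed

lemma norm_sgn_le_1: "norm (sgn h) \<le> 1"
  by (simp add: norm_sgn)

text \<open>The classes speak of unit directions, whereas multilinearity concerns all directions;
  normalization by \<open>sgn\<close>, which maps 0 to 0, transfers the information.\<close>

lemma iter_dderiv_sgn:
  fixes f :: "'a::euclidean_space \<Rightarrow> 'b::real_normed_vector"
  assumes "\<And>hs x. unit_list hs \<Longrightarrow> length hs < n \<Longrightarrow> iter_dderiv hs f differentiable at x" "length hs \<le> n"
  shows "iter_dderiv hs f = (\<lambda>x. (\<Prod>h\<leftarrow>hs. norm h) *\<^sub>R iter_dderiv (map sgn hs) f x)"
  using assms(2)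
proof (induction hs)
  case (Cons h hs)
  let ?c = "\<Prod>h\<leftarrow>hs. norm h"
  have u: "unit_list (map sgn hs)" by (auto simp: unit_list_def norm_sgn_le_1)
  then have d: "iter_dderiv (map sgn hs) f differentiable at x" for x using assms(1) Cons.prems by simp
  have "iter_dderiv hs f = (\<lambda>x. ?c *\<^sub>R iter_dderiv (map sgn hs) f x)" using Cons by simp
  then have "iter_dderiv (h # hs) f = dderiv h (\<lambda>x. ?c *\<^sub>R iter_dderiv (map sgn hs) f x)" by (simp only: iter_dderiv_simps)
  also have "\<dots> = (\<lambda>x. ?c *\<^sub>R dderiv h (iter_dderiv (map sgn hs) f) x)"
    by (rule dderiv_linear[OF d bounded_linear_scaleR_right])
  also have "dderiv h (iter_dderiv (map sgn hs) f) = (\<lambda>x. norm h *\<^sub>R dderiv (sgn h) (iter_dderiv (map sgn hs) f) x)"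
  proof
    have "norm h *\<^sub>R sgn h = h" by (cases "h = 0") (simp_all add: sgn_div_norm)
    then show "dderiv h (iter_dderiv (map sgn hs) f) x = norm h *\<^sub>R dderiv (sgn h) (iter_dderiv (map sgn hs) f) x" for x
      using dderiv_scaleR_vec[OF d, of "norm h" "sgn h"] by simp
  qed
  finally show ?case by (simp add: mult.commute)
qed simp

lemma iter_dderiv_differentiable:
  fixes f :: "'a::euclidean_space \<Rightarrow> 'b::real_normed_vector"
  assumes "\<And>hs x. unit_list hs \<Longrightarrow> length hs < n \<Longrightarrow> iter_dderiv hs f differentiable at x" "length hs < n"
  shows "iter_dderiv hs f differentiable at x"
proof -
  have "(\<lambda>x. (\<Prod>h\<leftarrow>hs. norm h) *\<^sub>R iter_dderiv (map sgn hs) f x) differentiable at x"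
    by (rule differentiable_linear[OF assms(1) bounded_linear_scaleR_right])
      (use assms(2) in \<open>auto simp: unit_list_def norm_sgn_le_1\<close>)
  then show ?thesis using iter_dderiv_sgn[where hs=hs, OF assms(1)] assms(2) by simp
qed

text \<open>At the head this is linearity of a derivative in its direction; in a later slot it is
  linearity of the outer derivative in the function.\<close>

lemma iter_dderiv_update:
  fixes f :: "'a::euclidean_space \<Rightarrow> 'b::real_normed_vector"
  assumes d: "\<And>hs x. length hs < n \<Longrightarrow> iter_dderiv hs f differentiable at x"
  shows "length hs \<le> n \<Longrightarrow> i < length hs \<Longrightarrow>
    iter_dderiv (hs[i := a + b]) f = (\<lambda>x. iter_dderiv (hs[i := a]) f x + iter_dderiv (hs[i := b]) f x) \<and>
    iter_dderiv (hs[i := r *\<^sub>R a]) f = (\<lambda>x. r *\<^sub>R iter_dderiv (hs[i := a]) f x)"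
proof (induction hs arbitrary: i)
  case (Cons h hs)
  show ?case
  proof (cases i)
    case 0
    have l: "linear (\<lambda>v. dderiv v (iter_dderiv hs f) x)" for x using Cons.prems by (intro linear_dderiv d) auto
    show ?thesis using 0 linear_add[OF l] linear_cmul[OF l] by auto
  next
    case (Suc j)
    have IH: "iter_dderiv (hs[j := a + b]) f = (\<lambda>x. iter_dderiv (hs[j := a]) f x + iter_dderiv (hs[j := b]) f x)"
      "iter_dderiv (hs[j := r *\<^sub>R a]) f = (\<lambda>x. r *\<^sub>R iter_dderiv (hs[j := a]) f x)"
      using Cons.IH[of j] Cons.prems Suc by auto
    have d': "iter_dderiv (hs[j := v]) f differentiable at x" for v x using Cons.prems by (intro d) auto
    show ?thesis
      unfolding Suc list_update_code iter_dderiv_simps IH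
      using dderiv_add[OF d' d'] dderiv_linear[OF d' bounded_linear_scaleR_right] by blast
  qed
qed simp

section \<open>Operator norms, membership in \<open>Cn\<close>, and second differences of the top
  derivative\<close>

lemma mlnorm_le: "(\<And>hs. length hs = k \<Longrightarrow> unit_list hs \<Longrightarrow> norm (m hs) \<le> B) \<Longrightarrow> mlnorm k m \<le> ennreal B"
  unfolding mlnorm_def by (rule SUP_least) (auto simp: unit_list_def intro!: ennreal_leI)

lemma mlnorm_ge: "length hs = k \<Longrightarrow> unit_list hs \<Longrightarrow> ennreal (norm (m hs)) \<le> mlnorm k m"
  unfolding mlnorm_def by (rule SUP_upper) (auto simp: unit_list_def)

lemma tendsto_0_ennreal_le:
  assumes "\<And>y. y \<noteq> a \<Longrightarrow> F y \<le> ennreal (g y)" "(g \<longlongrightarrow> 0) (at a)"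
  shows "(F \<longlongrightarrow> (0::ennreal)) (at a)"
proof (rule tendsto_sandwich[OF _ _ tendsto_const])
  show "((\<lambda>y. ennreal (g y)) \<longlongrightarrow> 0) (at a)" using tendsto_ennrealI[OF assms(2)] by simp
  show "\<forall>\<^sub>F y in at a. F y \<le> ennreal (g y)" using assms(1) by (auto simp: eventually_at_filter)
qed simp

lemma tendsto_norm_powr:
  fixes x :: "'a::real_normed_vector"
  assumes "0 < \<gamma>" shows "((\<lambda>y. c * norm (y - x) powr \<gamma>) \<longlongrightarrow> 0) (at x)"
proof -
  have "((\<lambda>y. norm (y - x)) \<longlongrightarrow> norm (x - x)) (at x)" by (intro tendsto_intros)
  then have "((\<lambda>y. norm (y - x) powr \<gamma>) \<longlongrightarrow> 0 powr \<gamma>) (at x)"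
    by (intro tendsto_powr') (use assms in auto)
  then show ?thesis using assms tendsto_mult[OF tendsto_const, of "\<lambda>y. norm (y - x) powr \<gamma>" 0 "at x" c] by simp
qed

text \<open>The remainder and Hoelder estimates have one constant for all unit lists, so they hold
  in the operator norm.\<close>

lemma cls_Cn:
  fixes f :: "'a::euclidean_space \<Rightarrow> 'b::real_normed_vector"
  assumes \<gamma>: "0 < \<gamma>" "\<gamma> \<le> 1" and f: "cls \<gamma> n M H f"
  shows "f \<in> Cn n"
proof -
  have \<gamma>0: "0 \<le> \<gamma>" using \<gamma> by simp
  note du = cls_iter_dderiv_differentiable[OF f]
  note d = iter_dderiv_differentiable[OF du]
  have ml: "bounded_multilinear (Suc k) (nderiv (Suc k) f x)" if k: "k < n" for k x
    unfolding bounded_multilinear_def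
  proof (intro conjI allI impI exI[of _ M])
    fix hs :: "'a list" and i assume hs: "length hs = Suc k" "i < Suc k"
    have eq: "nderiv (Suc k) f x (hs[i := v]) = iter_dderiv (hs[i := v]) f x" for v
      using hs by (intro nderiv_eq_iter_dderiv) auto
    show "linear (\<lambda>v. nderiv (Suc k) f x (hs[i := v]))"
      unfolding eq
    proof (rule linearI)
      fix a b :: 'a and r :: real
      have "length hs \<le> n" "i < length hs" using hs k by auto
      from iter_dderiv_update[where a=a and b=b and r=r, OF d this] 
      show "iter_dderiv (hs[i := a + b]) f x = iter_dderiv (hs[i := a]) f x + iter_dderiv (hs[i := b]) f x"
        "iter_dderiv (hs[i := r *\<^sub>R a]) f x = r *\<^sub>R iter_dderiv (hs[i := a]) f x" by auto
    qed
  next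
    fix hs :: "'a list" assume hs: "length hs = Suc k"
    have p: "0 \<le> (\<Prod>h\<leftarrow>hs. norm h)" by (induction hs) auto
    have "norm (iter_dderiv hs f x) = (\<Prod>h\<leftarrow>hs. norm h) * norm (iter_dderiv (map sgn hs) f x)"
      by (subst iter_dderiv_sgn[where hs=hs, OF du]) (use hs k p in auto)
    also have "\<dots> \<le> (\<Prod>h\<leftarrow>hs. norm h) * M"
      using hs k by (intro mult_left_mono cls_iter_dderiv_bound[OF f] p) (auto simp: unit_list_def norm_sgn_le_1)
    finally show "norm (nderiv (Suc k) f x hs) \<le> M * (\<Prod>h\<leftarrow>hs. norm h)"
      by (simp add: nderiv_eq_iter_dderiv[OF hs] mult.commute del: nderiv.simps)
  qed
  have lim: "((\<lambda>h. mlnorm k (\<lambda>hs. nderiv k f (x + h) hs - nderiv k f x hs - nderiv (Suc k) f x (h # hs)) / ennreal (norm h)) \<longlongrightarrow> 0) (at 0)"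
    if k: "k < n" for k x
  proof (rule tendsto_0_ennreal_le)
    show "((\<lambda>h::'a. 2 * M * norm (h - 0) powr \<gamma>) \<longlongrightarrow> 0) (at 0)" by (rule tendsto_norm_powr[OF \<gamma>(1)])
    fix h :: 'a assume h: "h \<noteq> 0"
    have "mlnorm k (\<lambda>hs. nderiv k f (x + h) hs - nderiv k f x hs - nderiv (Suc k) f x (h # hs)) \<le> ennreal (2 * M * norm h powr (1 + \<gamma>))"
    proof (rule mlnorm_le)
      fix hs :: "'a list" assume hs: "length hs = k" "unit_list hs"
      have "cls \<gamma> (Suc (n - Suc k)) M H (iter_dderiv hs f)" using cls_iter_dderiv[OF f hs(2)] hs k by (simp add: Suc_diff_Suc)
      from cls_remainder[OF this \<gamma>0 \<gamma>(2), of x h] hs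
      show "norm (nderiv k f (x + h) hs - nderiv k f x hs - nderiv (Suc k) f x (h # hs)) \<le> 2 * M * norm h powr (1 + \<gamma>)"
        by (simp add: nderiv_eq_iter_dderiv del: nderiv.simps)
    qed
    then have "mlnorm k (\<lambda>hs. nderiv k f (x + h) hs - nderiv k f x hs - nderiv (Suc k) f x (h # hs)) / ennreal (norm h)
      \<le> ennreal (2 * M * norm h powr (1 + \<gamma>)) / ennreal (norm h)" by (rule divide_right_mono_ennreal)
    also have "\<dots> = ennreal (2 * M * norm (h - 0) powr \<gamma>)"
      using h cls_nonneg[OF f] by (simp add: divide_ennreal powr_add)
    finally show "mlnorm k (\<lambda>hs. nderiv k f (x + h) hs - nderiv k f x hs - nderiv (Suc k) f x (h # hs)) / ennreal (norm h)
      \<le> ennreal (2 * M * norm (h - 0) powr \<gamma>)" .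
  qed
  have cont: "((\<lambda>y. mlnorm n (\<lambda>hs. nderiv n f y hs - nderiv n f x hs)) \<longlongrightarrow> 0) (at x)" for x
  proof (rule tendsto_0_ennreal_le)
    show "((\<lambda>y. 2 * M * norm (y - x) powr \<gamma>) \<longlongrightarrow> 0) (at x)" by (rule tendsto_norm_powr[OF \<gamma>(1)])
    show "mlnorm n (\<lambda>hs. nderiv n f y hs - nderiv n f x hs) \<le> ennreal (2 * M * norm (y - x) powr \<gamma>)" for y
      using cls_holder[OF cls_iter_dderiv_top[OF f] \<gamma>0 \<gamma>(2)] by (intro mlnorm_le) (simp add: nderiv_eq_iter_dderiv)
  qed
  show ?thesis unfolding Cn_def frechet_differentiable_ml_def using ml lim cont by blast
qed

lemma Cb_norm_le_iff:
  assumes "0 \<le> B"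
  shows "Cb_norm n f \<le> ennreal B \<longleftrightarrow> (\<forall>hs x. unit_list hs \<longrightarrow> length hs \<le> n \<longrightarrow> norm (iter_dderiv hs f x) \<le> B)"
proof
  assume L: "Cb_norm n f \<le> ennreal B"
  show "\<forall>hs x. unit_list hs \<longrightarrow> length hs \<le> n \<longrightarrow> norm (iter_dderiv hs f x) \<le> B"
  proof (intro allI impI)
    fix hs :: "'a list" and x assume hs: "unit_list hs" "length hs \<le> n"
    have "ennreal (norm (iter_dderiv hs f x)) = ennreal (norm (nderiv (length hs) f x hs))" by (simp add: nderiv_eq_iter_dderiv)
    also have "\<dots> \<le> mlnorm (length hs) (nderiv (length hs) f x)" by (rule mlnorm_ge[OF refl hs(1)])
    also have "\<dots> \<le> (SUP x. mlnorm (length hs) (nderiv (length hs) f x))" by (rule SUP_upper) simp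
    also have "\<dots> \<le> Cb_norm n f" unfolding Cb_norm_def using hs by (intro SUP_upper) auto
    finally show "norm (iter_dderiv hs f x) \<le> B" using L assms by (metis ennreal_le_iff order_trans)
  qed
next
  assume "\<forall>hs x. unit_list hs \<longrightarrow> length hs \<le> n \<longrightarrow> norm (iter_dderiv hs f x) \<le> B"
  then show "Cb_norm n f \<le> ennreal B"
    unfolding Cb_norm_def by (intro SUP_least mlnorm_le) (simp add: nderiv_eq_iter_dderiv)
qed

text \<open>\<open>enn2real\<close> maps infinity to 0, so this agrees with \<open>eta\<close> only
  where the latter is finite, in particular when the derivatives of order \<open>n\<close> are
  bounded.\<close>

definition eta_real :: "nat \<Rightarrow> ('a::real_normed_vector \<Rightarrow> 'b::real_normed_vector) \<Rightarrow> real \<Rightarrow> real" where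
  "eta_real n f t = enn2real (eta n (nderiv n f) t)"

abbreviation sdiff :: "'a::real_normed_vector list \<Rightarrow> ('a \<Rightarrow> 'b::real_normed_vector) \<Rightarrow> 'a \<Rightarrow> 'a \<Rightarrow> 'b" where
  "sdiff hs f x h \<equiv> iter_dderiv hs f (x + 2 *\<^sub>R h) - 2 *\<^sub>R iter_dderiv hs f (x + h) + iter_dderiv hs f x"

lemma eta_least:
  assumes "\<And>hs x h. unit_list hs \<Longrightarrow> length hs = n \<Longrightarrow> norm h \<le> t \<Longrightarrow> norm (sdiff hs f x h) \<le> c"
  shows "eta n (nderiv n f) t \<le> ennreal c"
  unfolding eta_def using assms by (intro SUP_least mlnorm_le) (simp add: nderiv_eq_iter_dderiv)

lemma eta_upper:
  assumes "unit_list hs" "length hs = n" "norm h \<le> t"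
  shows "ennreal (norm (sdiff hs f x h)) \<le> eta n (nderiv n f) t"
proof -
  let ?m = "\<lambda>x h hs. nderiv n f (x + 2 *\<^sub>R h) hs - 2 *\<^sub>R nderiv n f (x + h) hs + nderiv n f x hs"
  have "ennreal (norm (sdiff hs f x h)) = ennreal (norm (?m x h hs))" using assms by (simp add: nderiv_eq_iter_dderiv)
  also have "\<dots> \<le> mlnorm n (?m x h)" using mlnorm_ge[OF assms(2,1), of "?m x h"] .
  also have "\<dots> \<le> (SUP h\<in>cball 0 t. mlnorm n (?m x h))" using assms by (intro SUP_upper) auto
  also have "\<dots> \<le> eta n (nderiv n f) t" unfolding eta_def
    by (rule SUP_upper2[of x]) auto
  finally show ?thesis .
qed

lemma eta_finite:
  assumes "\<And>hs x. unit_list hs \<Longrightarrow> length hs = n \<Longrightarrow> norm (iter_dderiv hs f x) \<le> B"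
  shows "eta n (nderiv n f) t \<le> ennreal (4 * B)"
  using assms by (intro eta_least norm_second_diff_le)

lemma eta_eta_real:
  assumes "\<And>hs x. unit_list hs \<Longrightarrow> length hs = n \<Longrightarrow> norm (iter_dderiv hs f x) \<le> B"
  shows "eta n (nderiv n f) t = ennreal (eta_real n f t)"
proof -
  have "eta n (nderiv n f) t < top" using eta_finite[OF assms] by (rule le_less_trans) auto
  then show ?thesis by (simp add: eta_real_def)
qed

lemma eta_real_nonneg [simp]: "0 \<le> eta_real n f t" by (simp add: eta_real_def)

lemma eta_real_least:
  assumes "\<And>hs x h. unit_list hs \<Longrightarrow> length hs = n \<Longrightarrow> norm h \<le> t \<Longrightarrow> norm (sdiff hs f x h) \<le> c" "0 \<le> c"
  shows "eta_real n f t \<le> c"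
proof -
  have "eta n (nderiv n f) t \<le> ennreal c" by (rule eta_least) (rule assms(1))
  from enn2real_mono[OF this] assms(2) show ?thesis by (simp add: eta_real_def)
qed

lemma eta_real_upper:
  assumes "\<And>hs x. unit_list hs \<Longrightarrow> length hs = n \<Longrightarrow> norm (iter_dderiv hs f x) \<le> B" "unit_list hs" "length hs = n" "norm h \<le> t"
  shows "norm (sdiff hs f x h) \<le> eta_real n f t"
  using eta_upper[OF assms(2-4), of f x] eta_eta_real[of n f B t, OF assms(1)] by simp

text \<open>A second difference of step \<open>2 * h\<close> is a sum of three of step
  \<open>h\<close> with weights 1, 2, 1; hence the factor 4.\<close>

lemma modulus_eta_real:
  fixes f :: "'a::euclidean_space \<Rightarrow> 'b::real_normed_vector"
  assumes B: "\<And>hs x. unit_list hs \<Longrightarrow> length hs = n \<Longrightarrow> norm (iter_dderiv hs f x) \<le> B"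
  shows "modulus (eta_real n f)"
  unfolding modulus_def
proof (intro conjI allI impI)
  fix s t :: real assume "0 \<le> s" "s \<le> t"
  then show "eta_real n f s \<le> eta_real n f t"
    by (intro eta_real_least eta_real_upper[OF B]) auto
next
  fix t :: real assume t: "0 \<le> t"
  show "eta_real n f (2 * t) \<le> 4 * eta_real n f t"
  proof (rule eta_real_least)
    fix hs :: "'a list" and x k :: 'a assume hs: "unit_list hs" "length hs = n" and k: "norm k \<le> 2 * t"
    define h where "h = (1 / 2) *\<^sub>R k"
    have h: "norm h \<le> t" "k = 2 *\<^sub>R h" using k by (auto simp: h_def)
    note u = eta_real_upper[OF B hs h(1)]
    have e: "sdiff hs f x k = sdiff hs f (x + 2 *\<^sub>R h) h + 2 *\<^sub>R sdiff hs f (x + h) h + sdiff hs f x h"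
      unfolding h(2) by (simp add: algebra_simps scaleR_2)
    have "norm (a + 2 *\<^sub>R b + c) \<le> 4 * r" if "norm a \<le> r" "norm b \<le> r" "norm c \<le> r" for a b c :: 'b and r
      using norm_triangle_ineq[of "a + 2 *\<^sub>R b" c] norm_triangle_ineq[of a "2 *\<^sub>R b"] that by simp
    from this[OF u u u] show "norm (sdiff hs f x k) \<le> 4 * eta_real n f t" unfolding e .
  qed simp
qed

lemma iter_dderiv_diff:
  fixes f g :: "'a::euclidean_space \<Rightarrow> 'b::real_normed_vector"
  assumes f: "cls \<gamma> n M H f" and g: "cls \<gamma> n M' H' g"
  shows "unit_list hs \<Longrightarrow> length hs \<le> n \<Longrightarrow> iter_dderiv hs (\<lambda>x. f x - g x) = (\<lambda>x. iter_dderiv hs f x - iter_dderiv hs g x)"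
proof (induction hs)
  case (Cons h hs)
  then show ?case using cls_iter_dderiv_differentiable[OF f, of hs] cls_iter_dderiv_differentiable[OF g, of hs]
    by (simp add: dderiv_diff)
qed simp

lemma eta_real_diff:
  fixes f g :: "'a::euclidean_space \<Rightarrow> 'b::real_normed_vector"
  assumes f: "cls \<gamma> n M H f" and g: "cls \<gamma> n M' H' g"
  shows "eta_real n (\<lambda>x. f x - g x) t \<le> eta_real n f t + eta_real n g t"
proof (rule eta_real_least)
  have b: "norm (iter_dderiv hs f x) \<le> M" "norm (iter_dderiv hs g x) \<le> M'" if "unit_list hs" "length hs = n" for hs x
    using cls_iter_dderiv_bound[OF f, of hs] cls_iter_dderiv_bound[OF g, of hs] that by auto
  fix hs :: "'a list" and x h :: 'a assume hs: "unit_list hs" "length hs = n" "norm h \<le> t"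
  have "sdiff hs (\<lambda>x. f x - g x) x h = sdiff hs f x h - sdiff hs g x h"
    using iter_dderiv_diff[OF f g hs(1)] hs by (simp add: algebra_simps)
  also have "norm \<dots> \<le> norm (sdiff hs f x h) + norm (sdiff hs g x h)" by (rule norm_triangle_ineq4)
  also have "\<dots> \<le> eta_real n f t + eta_real n g t"
    by (intro add_mono eta_real_upper[OF b(1) hs] eta_real_upper[OF b(2) hs])
  finally show "norm (sdiff hs (\<lambda>x. f x - g x) x h) \<le> eta_real n f t + eta_real n g t" .
qed simp

text \<open>Evaluating the operator-norm limit at a single unit list leaves ordinary Frechet
  differentiability of that iterated derivative.\<close>

lemma Cn_iter_dderiv_differentiable:
  fixes f :: "'a::euclidean_space \<Rightarrow> 'b::real_normed_vector"
  assumes f: "f \<in> Cn n" and hs: "unit_list hs" "length hs < n"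
  shows "iter_dderiv hs f differentiable at x"
proof -
  let ?k = "length hs"
  have ml: "bounded_multilinear (Suc ?k) (nderiv (Suc ?k) f x)"
    and lim: "((\<lambda>h. mlnorm ?k (\<lambda>hs. nderiv ?k f (x + h) hs - nderiv ?k f x hs - nderiv (Suc ?k) f x (h # hs)) / ennreal (norm h)) \<longlongrightarrow> 0) (at 0)"
    using f hs unfolding Cn_def frechet_differentiable_ml_def by blast+
  let ?L = "\<lambda>v. nderiv (Suc ?k) f x (v # hs)"
  have "\<forall>hs' i. length hs' = Suc ?k \<longrightarrow> i < Suc ?k \<longrightarrow> linear (\<lambda>v. nderiv (Suc ?k) f x (hs'[i := v]))"
    using ml unfolding bounded_multilinear_def by blast
  from this[rule_format, of "0 # hs" 0] have lin: "linear ?L" by simp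
  have "(iter_dderiv hs f has_derivative ?L) (at x)"
    unfolding has_derivative_at
  proof
    show "bounded_linear ?L" using lin by (simp add: linear_conv_bounded_linear)
    let ?q = "\<lambda>h. norm (iter_dderiv hs f (x + h) - iter_dderiv hs f x - ?L h) / norm h"
    have "((\<lambda>h. ennreal (?q h)) \<longlongrightarrow> 0) (at 0)"
    proof (rule tendsto_sandwich[OF _ _ tendsto_const lim])
      have "ennreal (?q h) \<le> mlnorm ?k (\<lambda>hs. nderiv ?k f (x + h) hs - nderiv ?k f x hs - nderiv (Suc ?k) f x (h # hs)) / ennreal (norm h)"
        if "h \<noteq> 0" for h
      proof -
        have "ennreal (norm (iter_dderiv hs f (x + h) - iter_dderiv hs f x - ?L h)) \<le>
            mlnorm ?k (\<lambda>hs. nderiv ?k f (x + h) hs - nderiv ?k f x hs - nderiv (Suc ?k) f x (h # hs))"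
          using mlnorm_ge[OF refl hs(1), of "\<lambda>hs. nderiv ?k f (x + h) hs - nderiv ?k f x hs - nderiv (Suc ?k) f x (h # hs)"]
          by (simp add: nderiv_eq_iter_dderiv del: nderiv.simps)
        from divide_right_mono_ennreal[OF this, of "ennreal (norm h)"] that show ?thesis
          by (simp add: divide_ennreal)
      qed
      then show "\<forall>\<^sub>F h in at 0. ennreal (?q h) \<le> mlnorm ?k (\<lambda>hs. nderiv ?k f (x + h) hs - nderiv ?k f x hs - nderiv (Suc ?k) f x (h # hs)) / ennreal (norm h)"
        by (auto simp: eventually_at_filter)
    qed simp
    then have "((\<lambda>h. ennreal (?q h)) \<longlongrightarrow> ennreal 0) (at 0)" by simp
    then show "(?q \<longlongrightarrow> 0) (at 0)"
      by (subst (asm) tendsto_ennreal_iff) auto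
  qed
  then show ?thesis unfolding differentiable_def by blast
qed

text \<open>Twice the increment for \<open>h\<close> is the increment for \<open>2 * h\<close> up to
  a second difference. Iterating this halves the a priori bound \<open>2 * B\<close> each time, and
  \<open>?K\<close> is the fixed point of the recursion for the Hoelder constant; it is finite
  because \<gamma> < 1.\<close>

lemma zygmund_holder:
  fixes g :: "'a::real_normed_vector \<Rightarrow> 'b::real_normed_vector"
  assumes \<gamma>: "0 < \<gamma>" "\<gamma> < 1" and B: "\<And>x. norm (g x) \<le> B" and c: "0 \<le> c"
    and sd: "\<And>x h. norm (g (x + 2 *\<^sub>R h) - 2 *\<^sub>R g (x + h) + g x) \<le> c * norm h powr \<gamma>"
  shows "norm (g x - g y) \<le> c / (2 * (1 - 2 powr (\<gamma> - 1))) * norm (x - y) powr \<gamma>"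
proof -
  let ?p = "2 powr (\<gamma> - 1) :: real"
  let ?K = "c / (2 * (1 - ?p))"
  have p: "?p < 1" using \<gamma> powr_less_mono[of "\<gamma> - 1" 0 2] by simp
  have "c / (2 * q) * q = c / 2" if "0 < q" for q using that by simp
  from this[of "1 - ?p"] p have "?K * (1 - ?p) = c / 2" by linarith
  then have K: "c / 2 + ?K * ?p = ?K" by (simp only: right_diff_distrib)
  have it: "norm (g (x + h) - g x) \<le> (1 / 2) ^ k * (2 * B) + ?K * norm h powr \<gamma>" for k x h
  proof (induction k arbitrary: h)
    case 0
    have "0 \<le> ?K * norm h powr \<gamma>" using p c by simp
    then show ?case using norm_triangle_ineq4[of "g (x + h)" "g x"] B[of "x + h"] B[of x] by simp
  next
    case (Suc k)
    have "2 *\<^sub>R (g (x + h) - g x) = (g (x + 2 *\<^sub>R h) - g x) - (g (x + 2 *\<^sub>R h) - 2 *\<^sub>R g (x + h) + g x)"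
      by (simp add: algebra_simps scaleR_2)
    then have "2 * norm (g (x + h) - g x) \<le> norm (g (x + 2 *\<^sub>R h) - g x) + norm (g (x + 2 *\<^sub>R h) - 2 *\<^sub>R g (x + h) + g x)"
      by (metis abs_numeral norm_scaleR norm_triangle_ineq4)
    also have "\<dots> \<le> ((1 / 2) ^ k * (2 * B) + ?K * norm (2 *\<^sub>R h) powr \<gamma>) + c * norm h powr \<gamma>"
      by (intro add_mono Suc.IH sd)
    also have "norm (2 *\<^sub>R h) powr \<gamma> = 2 * ?p * norm h powr \<gamma>"
      by (simp add: powr_mult powr_diff)
    also have "((1 / 2) ^ k * (2 * B) + ?K * (2 * ?p * norm h powr \<gamma>)) + c * norm h powr \<gamma>
      = (1 / 2) ^ k * (2 * B) + 2 * ((c / 2 + ?K * ?p) * norm h powr \<gamma>)" by (simp add: algebra_simps)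
    finally show ?case unfolding K by simp
  qed
  have "(\<lambda>k. (1 / 2) ^ k * (2 * B) + ?K * norm (x - y) powr \<gamma>) \<longlonglongrightarrow> 0 * (2 * B) + ?K * norm (x - y) powr \<gamma>"
    by (intro tendsto_intros LIMSEQ_power_zero) auto
  then have "norm (g (y + (x - y)) - g y) \<le> 0 * (2 * B) + ?K * norm (x - y) powr \<gamma>"
    by (rule LIMSEQ_le_const) (use it in blast)
  then show ?thesis by simp
qed

section \<open>The Besov functional of a modulus\<close>

definition besov_integral :: "real \<Rightarrow> real \<Rightarrow> (real \<Rightarrow> real) \<Rightarrow> ennreal" where
  "besov_integral \<beta> q H = (\<integral>\<^sup>+t\<in>{0<..}. ennreal ((H t / t powr \<beta>) powr q / t) \<partial>lborel)"

text \<open>States that the Besov functional is at most \<open>a\<close>. For finite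
  \<open>p\<close> both sides are raised to the power \<open>p\<close>, so that no roots occur and
  integrals can be compared directly.\<close>

definition besov_bound :: "real \<Rightarrow> ennreal \<Rightarrow> real \<Rightarrow> (real \<Rightarrow> real) \<Rightarrow> bool" where
  "besov_bound \<beta> p a H \<longleftrightarrow> (if p = \<infinity> then \<forall>t>0. H t \<le> a * t powr \<beta>
     else besov_integral \<beta> (enn2real p) H \<le> ennreal (a powr enn2real p))"

lemma enn2real_ge_1: "1 \<le> p \<Longrightarrow> p \<noteq> (\<infinity>::ennreal) \<Longrightarrow> 1 \<le> enn2real p"
  by (metis enn2real_1 enn2real_mono infinity_ennreal_def less_top)

lemma modulus_nonneg: "modulus H \<Longrightarrow> 0 \<le> t \<Longrightarrow> 0 \<le> H t"
  unfolding modulus_def by (smt (verit, best))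

lemma modulus_mono: "modulus H \<Longrightarrow> 0 \<le> s \<Longrightarrow> s \<le> t \<Longrightarrow> H s \<le> H t"
  unfolding modulus_def by blast

lemma modulus_add: "modulus H \<Longrightarrow> modulus K \<Longrightarrow> modulus (\<lambda>t. H t + K t)"
  unfolding modulus_def by (auto intro: add_mono)

lemma modulus_cmult: "0 \<le> c \<Longrightarrow> modulus H \<Longrightarrow> modulus (\<lambda>t. c * H t)"
  unfolding modulus_def
  by (auto intro: mult_left_mono) (metis mult.left_commute mult_left_mono)

lemma modulus_cap_power: "0 \<le> \<gamma> \<Longrightarrow> \<gamma> \<le> 1 \<Longrightarrow> modulus (cap_power \<gamma>)"
  unfolding modulus_def using cap_power_mono cap_power_double by blast

text \<open>A modulus is monotone on nonnegative arguments only; clamped by \<open>max 0\<close> it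
  is monotone on the whole line and hence Borel.\<close>

lemma besov_integral_measurable:
  assumes "modulus H"
  shows "(\<lambda>t. ennreal ((H t / t powr \<beta>) powr q / t) * indicator {0<..} t) \<in> borel_measurable borel"
proof -
  have "mono (\<lambda>t. H (max 0 t))"
    by (rule monoI, rule modulus_mono[OF assms]) (auto simp: max_def)
  note [measurable] = borel_measurable_mono[OF this]
  have "(\<lambda>t. ennreal ((H (max 0 t) / t powr \<beta>) powr q / t) * indicator {0<..} t) \<in> borel_measurable borel"
    by measurable
  moreover have "(\<lambda>t. ennreal ((H (max 0 t) / t powr \<beta>) powr q / t) * indicator {0<..} t) =
    (\<lambda>t. ennreal ((H t / t powr \<beta>) powr q / t) * indicator {0<..} t)"
    by (auto simp: indicator_def max_def)
  ultimately show ?thesis by simp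
qed

lemma besov_integral_mono:
  assumes "\<And>t. 0 < t \<Longrightarrow> 0 \<le> K t \<and> K t \<le> H t" "0 \<le> q"
  shows "besov_integral \<beta> q K \<le> besov_integral \<beta> q H"
  unfolding besov_integral_def using assms
  by (intro nn_integral_mono) (auto simp: indicator_def intro!: ennreal_leI divide_right_mono powr_mono2)

lemma besov_integral_scale:
  assumes "modulus H" "0 \<le> c"
  shows "besov_integral \<beta> q (\<lambda>t. c * H t) = ennreal (c powr q) * besov_integral \<beta> q H"
proof -
  have "ennreal ((c * H t / t powr \<beta>) powr q / t) * indicator {0<..} t =
     ennreal (c powr q) * (ennreal ((H t / t powr \<beta>) powr q / t) * indicator {0<..} t)" for t
  proof (cases "0 < t")
    case True
    then have "(c * H t / t powr \<beta>) powr q / t = c powr q * ((H t / t powr \<beta>) powr q / t)"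
      using assms modulus_nonneg[OF assms(1), of t]
      by (subst times_divide_eq_right[symmetric], subst powr_mult) auto
    then show ?thesis using True assms(2) by (simp add: ennreal_mult'' del: times_divide_eq_right)
  qed simp
  then show ?thesis unfolding besov_integral_def
    by (simp add: nn_integral_cmult besov_integral_measurable[OF assms(1)])
qed

text \<open>Extends convexity from positive arguments to the boundary, where
  \<open>r powr q \<le> r\<close> for \<open>0 < r < 1\<close> suffices.\<close>

lemma powr_convex_nonneg:
  assumes "1 \<le> q" "0 \<le> (x::real)" "0 \<le> y" "0 < l" "l < 1"
  shows "(l * x + (1 - l) * y) powr q \<le> l * x powr q + (1 - l) * y powr q"
proof (cases "x = 0 \<or> y = 0")
  case True
  have le: "r powr q \<le> r" if "0 < r" "r < 1" for r :: real
    using powr_mono'[of 1 q r] assms(1) that by simp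
  show ?thesis
  proof (cases "x = 0")
    case True
    then show ?thesis using assms le[of "1 - l"] by (simp add: powr_mult mult_right_mono)
  next
    case False
    then have "y = 0" using \<open>x = 0 \<or> y = 0\<close> by simp
    then show ?thesis using assms le[of l] by (simp add: powr_mult mult_right_mono)
  qed
next
  case False
  then show ?thesis
    using convex_onD[OF powr_convex[OF assms(1)], of l y x] assms by (simp add: add.commute)
qed

lemma besov_integral_convex:
  assumes H: "modulus H" and K: "modulus K" and q: "1 \<le> q" and l: "0 < l" "l < 1"
  shows "besov_integral \<beta> q (\<lambda>t. l * H t + (1 - l) * K t) \<le> ennreal l * besov_integral \<beta> q H + ennreal (1 - l) * besov_integral \<beta> q K"
proof -
  let ?i = "\<lambda>H t. ennreal ((H t / t powr \<beta>) powr q / t) * indicator {0<..} t"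
  have "?i (\<lambda>t. l * H t + (1 - l) * K t) t \<le> ennreal l * ?i H t + ennreal (1 - l) * ?i K t" for t
  proof (cases "0 < t")
    case True
    let ?x = "H t / t powr \<beta>" and ?y = "K t / t powr \<beta>"
    have n: "0 \<le> ?x" "0 \<le> ?y" using True modulus_nonneg[OF H] modulus_nonneg[OF K] by auto
    have "(l * H t + (1 - l) * K t) / t powr \<beta> = l * ?x + (1 - l) * ?y" by (simp add: add_divide_distrib)
    then have "((l * H t + (1 - l) * K t) / t powr \<beta>) powr q / t \<le> (l * ?x powr q + (1 - l) * ?y powr q) / t"
      using powr_convex_nonneg[OF q n l] True by (simp add: divide_right_mono)
    also have "\<dots> = l * (?x powr q / t) + (1 - l) * (?y powr q / t)" by (simp add: add_divide_distrib)
    finally have "ennreal (((l * H t + (1 - l) * K t) / t powr \<beta>) powr q / t) \<le>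
      ennreal (l * (?x powr q / t) + (1 - l) * (?y powr q / t))" by (rule ennreal_leI)
    also have "\<dots> = ennreal l * ennreal (?x powr q / t) + ennreal (1 - l) * ennreal (?y powr q / t)"
      using l True by (simp flip: ennreal_plus ennreal_mult)
    finally show ?thesis using True by simp
  qed simp
  then have "besov_integral \<beta> q (\<lambda>t. l * H t + (1 - l) * K t) \<le> (\<integral>\<^sup>+t. ennreal l * ?i H t + ennreal (1 - l) * ?i K t \<partial>lborel)"
    unfolding besov_integral_def by (rule nn_integral_mono)
  also have "\<dots> = ennreal l * besov_integral \<beta> q H + ennreal (1 - l) * besov_integral \<beta> q K"
    unfolding besov_integral_def using besov_integral_measurable[OF H, of \<beta> q] besov_integral_measurable[OF K, of \<beta> q]
    by (subst nn_integral_add) (auto simp: nn_integral_cmult)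
  finally show ?thesis .
qed

lemma besov_bound_mono:
  assumes "besov_bound \<beta> p a H" "1 \<le> p" "0 \<le> a" "a \<le> b" "\<And>t. 0 < t \<Longrightarrow> 0 \<le> K t \<and> K t \<le> H t"
  shows "besov_bound \<beta> p b K"
proof (cases "p = \<infinity>")
  case True
  have "K t \<le> b * t powr \<beta>" if "0 < t" for t
  proof -
    have "K t \<le> H t" using assms that by blast
    also have "\<dots> \<le> a * t powr \<beta>" using assms(1) True that by (simp add: besov_bound_def)
    also have "\<dots> \<le> b * t powr \<beta>" using assms by (intro mult_right_mono) auto
    finally show ?thesis .
  qed
  then show ?thesis using True by (simp add: besov_bound_def)
next
  case False
  note q = enn2real_ge_1[OF assms(2) False]
  have "besov_integral \<beta> (enn2real p) K \<le> besov_integral \<beta> (enn2real p) H" using assms(5) q by (intro besov_integral_mono) auto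
  also have "\<dots> \<le> ennreal (a powr enn2real p)" using assms(1) False by (simp add: besov_bound_def)
  also have "\<dots> \<le> ennreal (b powr enn2real p)" using assms q by (intro ennreal_leI powr_mono2) auto
  finally show ?thesis using False by (simp add: besov_bound_def)
qed

lemma besov_bound_scale:
  assumes "besov_bound \<beta> p a H" "modulus H" "0 \<le> c" "0 \<le> a"
  shows "besov_bound \<beta> p (c * a) (\<lambda>t. c * H t)"
proof (cases "p = \<infinity>")
  case True
  then show ?thesis using assms by (simp add: besov_bound_def mult.assoc mult_left_mono)
next
  case False
  have "ennreal (c powr enn2real p) * besov_integral \<beta> (enn2real p) H \<le> ennreal (c powr enn2real p) * ennreal (a powr enn2real p)"
    using assms(1) False by (intro mult_left_mono) (auto simp: besov_bound_def)
  then show ?thesis using False assms by (simp add: besov_bound_def besov_integral_scale powr_mult ennreal_mult)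
qed

text \<open>Minkowski's inequality: after scaling, \<open>H / a\<close> and \<open>K / b\<close> lie
  in the unit ball, and the sum divided by \<open>a + b\<close> is their convex combination with
  weight \<open>l = a / (a + b)\<close>, so convexity of the integral applies.\<close>

lemma besov_bound_add:
  assumes H: "besov_bound \<beta> p a H" "modulus H" "0 < a" and K: "besov_bound \<beta> p b K" "modulus K" "0 < b" and p: "1 \<le> p"
  shows "besov_bound \<beta> p (a + b) (\<lambda>t. H t + K t)"
proof (cases "p = \<infinity>")
  case True
  then show ?thesis using H(1) K(1) by (auto simp: besov_bound_def distrib_right intro: add_mono)
next
  case False
  let ?q = "enn2real p"
  define l where "l = a / (a + b)"
  have l: "0 < l" "l < 1" "1 - l = b / (a + b)" using H(3) K(3) by (auto simp: l_def field_simps)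
  have one: "besov_integral \<beta> ?q (\<lambda>t. (1 / c) * G t) \<le> 1" if "besov_bound \<beta> p c G" "modulus G" "0 < c" for c G
  proof -
    have "besov_bound \<beta> p ((1 / c) * c) (\<lambda>t. (1 / c) * G t)" using that by (intro besov_bound_scale) auto
    then show ?thesis using that False by (simp add: besov_bound_def)
  qed
  have m: "modulus (\<lambda>t. (1 / a) * H t)" "modulus (\<lambda>t. (1 / b) * K t)"
    using H K by (auto intro!: modulus_cmult simp del: times_divide_eq_left)
  have "besov_integral \<beta> ?q (\<lambda>t. l * ((1 / a) * H t) + (1 - l) * ((1 / b) * K t)) \<le>
    ennreal l * besov_integral \<beta> ?q (\<lambda>t. (1 / a) * H t) + ennreal (1 - l) * besov_integral \<beta> ?q (\<lambda>t. (1 / b) * K t)"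
    by (rule besov_integral_convex[OF m enn2real_ge_1[OF p False] l(1,2)])
  also have "\<dots> \<le> ennreal l * 1 + ennreal (1 - l) * 1"
    by (intro add_mono mult_left_mono one H K) auto
  also have "\<dots> = 1" using l by (simp flip: ennreal_plus)
  finally have z: "besov_integral \<beta> ?q (\<lambda>t. l * ((1 / a) * H t) + (1 - l) * ((1 / b) * K t)) \<le> 1" .
  have "(\<lambda>t. l * ((1 / a) * H t) + (1 - l) * ((1 / b) * K t)) = (\<lambda>t. (1 / (a + b)) * (H t + K t))"
    using H(3) K(3) unfolding l(3) by (auto simp: l_def add_divide_distrib)
  with z have "besov_bound \<beta> p 1 (\<lambda>t. (1 / (a + b)) * (H t + K t))" using False by (simp add: besov_bound_def)
  from besov_bound_scale[OF this modulus_cmult[OF _ modulus_add[OF H(2) K(2)]], of "a + b"] H(3) K(3)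
  show ?thesis by simp
qed

text \<open>Removes slack of size \<open>e\<close>: first that of making \<open>a\<close> and
  \<open>b\<close> positive for the normalization in Minkowski's inequality, later that of
  approximating a curve by simple ones.\<close>

lemma besov_bound_closed:
  assumes "\<And>e. 0 < e \<Longrightarrow> besov_bound \<beta> p (a + e) H" "1 \<le> p" "0 \<le> a"
  shows "besov_bound \<beta> p a H"
proof -
  have lim: "(\<lambda>n. a + 1 / real (Suc n)) \<longlonglongrightarrow> a + 0"
    using LIMSEQ_inverse_real_of_nat by (intro tendsto_intros) (simp add: inverse_eq_divide)
  show ?thesis
  proof (cases "p = \<infinity>")
    case True
    have "H t \<le> (a + 0) * t powr \<beta>" if "0 < t" for t
    proof (rule LIMSEQ_le_const[OF tendsto_mult[OF lim tendsto_const]])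
      show "\<exists>N. \<forall>n\<ge>N. H t \<le> (a + 1 / real (Suc n)) * t powr \<beta>"
        using assms(1) True that by (auto simp: besov_bound_def)
    qed
    then show ?thesis using True by (simp add: besov_bound_def)
  next
    case False
    note q = enn2real_ge_1[OF assms(2) False]
    have "(\<lambda>n. ennreal ((a + 1 / real (Suc n)) powr enn2real p)) \<longlonglongrightarrow> ennreal ((a + 0) powr enn2real p)"
      using q assms(3) by (intro tendsto_ennrealI tendsto_powr' lim tendsto_const) auto
    then have "besov_integral \<beta> (enn2real p) H \<le> ennreal ((a + 0) powr enn2real p)"
    proof (rule LIMSEQ_le_const)
      show "\<exists>N. \<forall>n\<ge>N. besov_integral \<beta> (enn2real p) H \<le> ennreal ((a + 1 / real (Suc n)) powr enn2real p)"
        using assms(1)[of "1 / real (Suc _)"] False by (auto simp: besov_bound_def)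
    qed
    then show ?thesis using False by (simp add: besov_bound_def)
  qed
qed

lemma besov_bound_add_nonneg:
  assumes H: "besov_bound \<beta> p a H" "modulus H" "0 \<le> a" and K: "besov_bound \<beta> p b K" "modulus K" "0 \<le> b" and p: "1 \<le> p"
  shows "besov_bound \<beta> p (a + b) (\<lambda>t. H t + K t)"
proof (rule besov_bound_closed[OF _ p])
  fix e :: real assume e: "0 < e"
  have "besov_bound \<beta> p (a + e / 2) H" "besov_bound \<beta> p (b + e / 2) K"
    using besov_bound_mono[OF H(1) p H(3)] besov_bound_mono[OF K(1) p K(3)] modulus_nonneg[OF H(2)] modulus_nonneg[OF K(2)] e by auto
  from besov_bound_add[OF this(1) H(2) _ this(2) K(2) _ p] e H(3) K(3)
  show "besov_bound \<beta> p (a + b + e) (\<lambda>t. H t + K t)" by (simp add: algebra_simps)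
qed (use H K in auto)

text \<open>For finite \<open>p\<close> this is Fatou's lemma.\<close>

lemma besov_bound_limit:
  assumes "\<And>j. besov_bound \<beta> p a (H j)" "\<And>j. modulus (H j)" "\<And>t. 0 < t \<Longrightarrow> (\<lambda>j. H j t) \<longlonglongrightarrow> G t" "1 \<le> p"
  shows "besov_bound \<beta> p a G"
proof (cases "p = \<infinity>")
  case True
  have "G t \<le> a * t powr \<beta>" if "0 < t" for t
    by (rule LIMSEQ_le_const2[OF assms(3)[OF that]]) (use assms(1) True that in \<open>auto simp: besov_bound_def\<close>)
  then show ?thesis using True by (simp add: besov_bound_def)
next
  case False
  let ?q = "enn2real p"
  note q = enn2real_ge_1[OF assms(4) False]
  let ?i = "\<lambda>H t. ennreal ((H t / t powr \<beta>) powr ?q / t) * indicator {0<..} t"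
  have "(\<lambda>j. ?i (H j) t) \<longlonglongrightarrow> ?i G t" for t
  proof (cases "0 < t")
    case True
    have "(\<lambda>j. (H j t / t powr \<beta>) powr ?q / t) \<longlonglongrightarrow> (G t / t powr \<beta>) powr ?q / t"
      using assms(3)[OF True] True q modulus_nonneg[OF assms(2)] by (intro tendsto_intros tendsto_powr') auto
    from tendsto_ennrealI[OF this] True show ?thesis by simp
  qed simp
  then have "?i G t = liminf (\<lambda>j. ?i (H j) t)" for t
    by (metis lim_imp_Liminf trivial_limit_sequentially)
  then have "besov_integral \<beta> ?q G = (\<integral>\<^sup>+t. liminf (\<lambda>j. ?i (H j) t) \<partial>lborel)" unfolding besov_integral_def by simp
  also have "\<dots> \<le> liminf (\<lambda>j. besov_integral \<beta> ?q (H j))" unfolding besov_integral_def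
    by (rule nn_integral_liminf) (use besov_integral_measurable[OF assms(2)] in simp)
  also have "\<dots> \<le> liminf (\<lambda>j. ennreal (a powr ?q))"
    using assms(1) False by (intro Liminf_mono always_eventually) (auto simp: besov_bound_def)
  also have "\<dots> = ennreal (a powr ?q)" by (simp add: Liminf_const)
  finally show ?thesis using False by (simp add: besov_bound_def)
qed

text \<open>The integrand is the power \<open>(2 * \<gamma> - \<beta>) * ?q - 1\<close> of
  \<open>t\<close> below 1 and the power \<open>- (\<beta> * ?q) - 1\<close> above. Then \<beta> < 2
  * \<gamma> gives integrability at 0 and 0 < \<beta> gives it at infinity.\<close>

lemma besov_bound_cap_power:
  assumes \<gamma>: "\<beta> < 2 * \<gamma>" "0 < \<beta>" and p: "1 \<le> p"
  shows "\<exists>a>0. besov_bound \<beta> p a (cap_power \<gamma>)"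
proof (cases "p = \<infinity>")
  case True
  have "cap_power \<gamma> t \<le> 1 * t powr \<beta>" if t: "0 < t" for t
  proof (cases "t \<le> 1")
    case True
    then show ?thesis using powr_mono'[of \<beta> "2 * \<gamma>" t] t \<gamma> by (simp add: cap_power_eq)
  next
    case False
    then show ?thesis using ge_one_powr_ge_zero[of t \<beta>] cap_power_le_1[of \<gamma> t] \<gamma> by simp
  qed
  then show ?thesis using True by (intro exI[of _ 1]) (simp add: besov_bound_def)
next
  case False
  let ?q = "enn2real p"
  note q = enn2real_ge_1[OF p False]
  let ?e = "(2 * \<gamma> - \<beta>) * ?q - 1" and ?f = "- (\<beta> * ?q) - 1"
  have e: "- 1 < ?e" using \<gamma> q by (simp add: mult_pos_pos)
  have f: "?f < - 1" using \<gamma> q by (simp add: mult_pos_pos)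
  have "ennreal ((cap_power \<gamma> t / t powr \<beta>) powr ?q / t) * indicator {0<..} t \<le>
    ennreal (t powr ?e) * indicator {0..1} t + ennreal (t powr ?f) * indicator {1..} t" for t
  proof (cases "0 < t")
    case t: True
    show ?thesis
    proof (cases "t \<le> 1")
      case True
      then have "cap_power \<gamma> t / t powr \<beta> = t powr (2 * \<gamma> - \<beta>)" using t \<gamma> by (simp add: cap_power_eq powr_diff)
      then have "(cap_power \<gamma> t / t powr \<beta>) powr ?q / t = t powr ?e"
        using t by (simp only: powr_powr) (simp add: powr_diff)
      then show ?thesis using t True by simp
    next
      case False
      then have "(cap_power \<gamma> t / t powr \<beta>) powr ?q / t = t powr ?f"
        using t \<gamma> by (simp add: cap_power_eq powr_diff powr_minus powr_divide powr_powr field_simps)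
      then show ?thesis using t False by simp
    qed
  qed simp
  then have "besov_integral \<beta> ?q (cap_power \<gamma>) \<le> (\<integral>\<^sup>+t. ennreal (t powr ?e) * indicator {0..1} t + ennreal (t powr ?f) * indicator {1..} t \<partial>lborel)"
    unfolding besov_integral_def by (rule nn_integral_mono)
  also have "\<dots> = (\<integral>\<^sup>+t. ennreal (t powr ?e) * indicator {0..1} t \<partial>lborel) + (\<integral>\<^sup>+t. ennreal (t powr ?f) * indicator {1..} t \<partial>lborel)"
    by (rule nn_integral_add) auto
  also have "\<dots> < \<infinity>"
    using nn_integral_has_integral_lebesgue'[OF _ has_integral_powr_from_0[OF e, of 1]]
      nn_integral_has_integral_lebesgue'[OF _ has_integral_powr_to_inf[OF f, of 1]] by simp
  finally obtain r where r: "0 \<le> r" "besov_integral \<beta> ?q (cap_power \<gamma>) = ennreal r" by (auto simp: less_top elim: ennreal_cases)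
  let ?a = "(r + 1) powr (1 / ?q)"
  have "besov_bound \<beta> p ?a (cap_power \<gamma>)" using False q r by (simp add: besov_bound_def powr_powr ennreal_leI)
  then show ?thesis using r by (intro exI[of _ ?a]) auto
qed

text \<open>By monotonicity the integral over \<open>{t..2 * t}\<close> alone controls
  \<open>H t\<close>. That interval has measure at least 1/2 with respect to \<open>dt / t\<close>;
  this factor 2 and \<open>2 powr \<beta> \<le> 2\<close> make the 4.\<close>

lemma besov_bound_embedding:
  assumes H: "besov_bound \<beta> p a H" "modulus H" "0 \<le> a" and p: "1 \<le> p" and \<beta>: "0 < \<beta>" "\<beta> \<le> 1" and t: "0 < t"
  shows "H t \<le> 4 * a * t powr \<beta>"
proof (cases "p = \<infinity>")
  case True
  then have "H t \<le> a * t powr \<beta>" using H t by (simp add: besov_bound_def)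
  also have "\<dots> \<le> 4 * a * t powr \<beta>" using H by (intro mult_right_mono) auto
  finally show ?thesis .
next
  case False
  let ?q = "enn2real p"
  note q = enn2real_ge_1[OF p False]
  note n = modulus_nonneg[OF H(2)]
  let ?c = "(H t / (2 * t) powr \<beta>) powr ?q / (2 * t)"
  have "ennreal (?c * t) = (\<integral>\<^sup>+s. ennreal ?c * indicator {t..2 * t} s \<partial>lborel)"
    using t by (simp add: nn_integral_cmult_indicator flip: ennreal_mult)
  also have "\<dots> \<le> besov_integral \<beta> ?q H"
    unfolding besov_integral_def
  proof (rule nn_integral_mono)
    fix s
    have "?c \<le> (H s / s powr \<beta>) powr ?q / s" if "t \<le> s" "s \<le> 2 * t"
      using that t q \<beta> n modulus_mono[OF H(2), of t s]
      by (intro frac_le powr_mono2) auto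
    then show "ennreal ?c * indicator {t..2 * t} s \<le> ennreal ((H s / s powr \<beta>) powr ?q / s) * indicator {0<..} s"
      using t by (auto simp: indicator_def intro!: ennreal_leI)
  qed
  also have "\<dots> \<le> ennreal (a powr ?q)" using H False by (simp add: besov_bound_def)
  finally have "?c * t \<le> a powr ?q" by simp
  then have "(H t / (2 * t) powr \<beta>) powr ?q \<le> 2 * a powr ?q" using t by simp
  also have "\<dots> \<le> 2 powr ?q * a powr ?q"
    using powr_mono[OF q, of 2] by (intro mult_right_mono) auto
  also have "\<dots> = (2 * a) powr ?q" using H by (simp add: powr_mult)
  finally have "H t / (2 * t) powr \<beta> \<le> 2 * a"
    using q H powr_less_mono2[of ?q "2 * a" "H t / (2 * t) powr \<beta>"] by linarith
  then have "H t \<le> 2 * a * (2 * t) powr \<beta>" using t by (simp add: divide_le_eq)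
  also have "\<dots> = 2 * a * 2 powr \<beta> * t powr \<beta>" using t by (simp add: powr_mult)
  also have "\<dots> \<le> 2 * a * 2 * t powr \<beta>"
    using powr_mono[OF \<beta>(2), of 2] H by (intro mult_right_mono mult_left_mono) auto
  finally show ?thesis by simp
qed

text \<open>The range is split at \<open>d powr (1 / \<beta>)\<close>, where
  \<open>t powr \<beta> = d\<close>. Below it the bound of order \<beta> gains
  \<open>t powr (\<beta> - \<alpha>)\<close>; above it the bound \<open>4 * d\<close> suffices, the
  weight being integrable at infinity as \<alpha> > 0. Both parts scale like
  \<open>d powr ((\<beta> - \<alpha>) / \<beta>)\<close>.\<close>

lemma besov_bound_interpolation:
  assumes \<alpha>: "0 < \<alpha>" "\<alpha> < \<beta>" and p: "1 \<le> p" and a: "0 \<le> a"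
  shows "\<exists>C\<ge>0. \<forall>H d. modulus H \<longrightarrow> besov_bound \<beta> p a H \<longrightarrow> 0 < d \<longrightarrow> (\<forall>t>0. H t \<le> 4 * d) \<longrightarrow>
    besov_bound \<alpha> p (C * d powr ((\<beta> - \<alpha>) / \<beta>)) H"
proof (cases "p = \<infinity>")
  case True
  have "H t \<le> (a + 4) * d powr ((\<beta> - \<alpha>) / \<beta>) * t powr \<alpha>"
    if H: "modulus H" "\<forall>t>0. H t \<le> a * t powr \<beta>" and d: "0 < d" "\<forall>t>0. H t \<le> 4 * d" and t: "0 < t" for H t d
  proof (cases "t \<le> d powr (1 / \<beta>)")
    case True
    have "t powr (\<beta> - \<alpha>) \<le> (d powr (1 / \<beta>)) powr (\<beta> - \<alpha>)" using True \<alpha> t by (intro powr_mono2) auto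
    then have *: "t powr (\<beta> - \<alpha>) \<le> d powr ((\<beta> - \<alpha>) / \<beta>)" by (simp add: powr_powr)
    have "H t \<le> a * (t powr (\<beta> - \<alpha>) * t powr \<alpha>)" using H t by (simp flip: powr_add)
    also have "\<dots> \<le> (a + 4) * (d powr ((\<beta> - \<alpha>) / \<beta>) * t powr \<alpha>)"
      using * a by (intro mult_mono mult_right_mono) auto
    finally show ?thesis by (simp add: mult.assoc)
  next
    case False
    have "(d powr (1 / \<beta>)) powr \<alpha> \<le> t powr \<alpha>" using False \<alpha> by (intro powr_mono2) auto
    then have *: "d powr (\<alpha> / \<beta>) \<le> t powr \<alpha>" by (simp add: powr_powr)
    have "(\<beta> - \<alpha>) / \<beta> + \<alpha> / \<beta> = 1" using \<alpha> by (simp flip: add_divide_distrib)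
    then have "d = d powr ((\<beta> - \<alpha>) / \<beta>) * d powr (\<alpha> / \<beta>)" using d by (simp flip: powr_add)
    then have "H t \<le> 4 * (d powr ((\<beta> - \<alpha>) / \<beta>) * d powr (\<alpha> / \<beta>))" using d t by metis
    also have "\<dots> \<le> (a + 4) * (d powr ((\<beta> - \<alpha>) / \<beta>) * t powr \<alpha>)"
      using * a by (intro mult_mono mult_left_mono) auto
    finally show ?thesis by (simp add: mult.assoc)
  qed
  then show ?thesis using True a by (intro exI[of _ "a + 4"]) (simp add: besov_bound_def)
next
  case False
  let ?q = "enn2real p"
  let ?th = "(\<beta> - \<alpha>) / \<beta>"
  note q = enn2real_ge_1[OF p False]
  \<comment> \<open>\<open>a powr ?q\<close> comes from the part below the splitting point,
    \<open>4 powr ?q / (\<alpha> * ?q)\<close> from the tail integral above it.\<close>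
  define C where "C = (a powr ?q + 4 powr ?q / (\<alpha> * ?q)) powr (1 / ?q)"
  have "besov_integral \<alpha> ?q H \<le> ennreal ((C * d powr ?th) powr ?q)"
    if H: "modulus H" "besov_integral \<beta> ?q H \<le> ennreal (a powr ?q)" and d: "0 < d" "\<forall>t>0. H t \<le> 4 * d" for H d
  proof -
    note n = modulus_nonneg[OF H(1)]
    let ?r = "d powr (1 / \<beta>)"
    let ?e = "- (\<alpha> * ?q) - 1"
    have e: "?e < - 1" using \<alpha> q by (simp add: mult_pos_pos)
    have r: "0 < ?r" using d by simp
    let ?i = "\<lambda>t. ennreal ((H t / t powr \<beta>) powr ?q / t) * indicator {0<..} t"
    let ?A = "?r powr ((\<beta> - \<alpha>) * ?q)"
    have "ennreal ((H t / t powr \<alpha>) powr ?q / t) * indicator {0<..} t \<le>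
      ennreal ?A * ?i t + ennreal ((4 * d) powr ?q) * (ennreal (t powr ?e) * indicator {?r..} t)" for t
    proof (cases "0 < t")
      case t: True
      show ?thesis
      proof (cases "t \<le> ?r")
        case True
        have "H t / t powr \<alpha> = t powr (\<beta> - \<alpha>) * (H t / t powr \<beta>)"
          using t by (simp add: powr_diff)
        then have "(H t / t powr \<alpha>) powr ?q = t powr ((\<beta> - \<alpha>) * ?q) * (H t / t powr \<beta>) powr ?q"
          using t n[of t] by (simp add: powr_mult powr_powr del: times_divide_eq_right)
        also have "\<dots> \<le> ?A * (H t / t powr \<beta>) powr ?q"
          using True t \<alpha> q by (intro mult_right_mono powr_mono2) auto
        finally have "(H t / t powr \<alpha>) powr ?q / t \<le> ?A * ((H t / t powr \<beta>) powr ?q / t)"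
          using t by (simp add: divide_right_mono)
        then have "ennreal ((H t / t powr \<alpha>) powr ?q / t) \<le> ennreal ?A * ennreal ((H t / t powr \<beta>) powr ?q / t)"
          using t by (subst ennreal_mult[symmetric]) (auto intro: ennreal_leI)
        then show ?thesis using t by (simp add: add_increasing2)
      next
        case False
        have "(H t / t powr \<alpha>) powr ?q / t \<le> (4 * d / t powr \<alpha>) powr ?q / t"
          using t d n[of t] q by (intro divide_right_mono powr_mono2) auto
        also have "\<dots> = (4 * d) powr ?q * t powr ?e"
          using t d by (simp add: powr_divide powr_powr powr_diff powr_minus field_simps)
        finally have "ennreal ((H t / t powr \<alpha>) powr ?q / t) \<le> ennreal ((4 * d) powr ?q) * ennreal (t powr ?e)"
          by (subst ennreal_mult[symmetric]) (auto intro: ennreal_leI)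
        then show ?thesis using t False by (simp add: add_increasing)
      qed
    qed simp
    then have "besov_integral \<alpha> ?q H \<le> (\<integral>\<^sup>+t. ennreal ?A * ?i t + ennreal ((4 * d) powr ?q) * (ennreal (t powr ?e) * indicator {?r..} t) \<partial>lborel)"
      unfolding besov_integral_def by (rule nn_integral_mono)
    also have "\<dots> = ennreal ?A * besov_integral \<beta> ?q H + ennreal ((4 * d) powr ?q) * (\<integral>\<^sup>+t. ennreal (t powr ?e) * indicator {?r..} t \<partial>lborel)"
      unfolding besov_integral_def using besov_integral_measurable[OF H(1), of \<beta> ?q]
      by (subst nn_integral_add) (auto simp: nn_integral_cmult)
    also have "(\<integral>\<^sup>+t. ennreal (t powr ?e) * indicator {?r..} t \<partial>lborel) = ennreal (- (?r powr (?e + 1)) / (?e + 1))"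
      by (rule nn_integral_has_integral_lebesgue'[OF _ has_integral_powr_to_inf[OF e r]]) simp
    also have "- (?r powr (?e + 1)) / (?e + 1) = ?r powr (- (\<alpha> * ?q)) / (\<alpha> * ?q)" by simp
    also have "ennreal ?A * besov_integral \<beta> ?q H + ennreal ((4 * d) powr ?q) * ennreal (?r powr (- (\<alpha> * ?q)) / (\<alpha> * ?q))
      \<le> ennreal ?A * ennreal (a powr ?q) + ennreal ((4 * d) powr ?q) * ennreal (?r powr (- (\<alpha> * ?q)) / (\<alpha> * ?q))"
      using H by (intro add_mono mult_left_mono) auto
    also have "\<dots> = ennreal (?A * a powr ?q + (4 * d) powr ?q * (?r powr (- (\<alpha> * ?q)) / (\<alpha> * ?q)))"
    proof -
      have "0 < \<alpha> * ?q" using \<alpha> q by simp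
      then show ?thesis by (simp flip: ennreal_plus ennreal_mult)
    qed
    also have "?A * a powr ?q + (4 * d) powr ?q * (?r powr (- (\<alpha> * ?q)) / (\<alpha> * ?q)) = (C * d powr ?th) powr ?q"
    proof -
      have "?A = d powr (?th * ?q)" by (simp add: powr_powr)
      moreover have "(4 * d) powr ?q * ?r powr (- (\<alpha> * ?q)) = 4 powr ?q * d powr (?th * ?q)"
      proof -
        have "?q + 1 / \<beta> * (- (\<alpha> * ?q)) = ?th * ?q" using \<alpha> by (simp add: field_simps)
        then have "d powr ?q * ?r powr (- (\<alpha> * ?q)) = d powr (?th * ?q)"
          by (simp add: powr_powr flip: powr_add)
        then show ?thesis using d by (simp add: powr_mult)
      qed
      moreover have "(C * d powr ?th) powr ?q = (a powr ?q + 4 powr ?q / (\<alpha> * ?q)) * d powr (?th * ?q)"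
        using q \<alpha> a d by (simp add: C_def powr_mult powr_powr add_nonneg_nonneg)
      ultimately show ?thesis by (simp add: algebra_simps)
    qed
    finally show ?thesis .
  qed
  then show ?thesis using False by (intro exI[of _ C]) (simp add: besov_bound_def C_def)
qed

lemma ennpowr_ennreal: "0 \<le> x \<Longrightarrow> ennpowr (ennreal x) r = ennreal (x powr r)"
  by (simp add: ennpowr_def)

lemma Zsemi_le_iff:
  assumes e: "\<And>t. eta n (nderiv n f) t = ennreal (eta_real n f t)" and a: "0 \<le> a" and p: "1 \<le> p"
  shows "Zsemi n \<beta> p (nderiv n f) \<le> ennreal a \<longleftrightarrow> besov_bound \<beta> p a (eta_real n f)"
proof -
  have d: "eta n (nderiv n f) t / ennreal (t powr \<beta>) = ennreal (eta_real n f t / t powr \<beta>)" if "0 < t" for t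
    using that by (simp add: e divide_ennreal)
  show ?thesis
  proof (cases "p = \<infinity>")
    case True
    have "Zsemi n \<beta> p (nderiv n f) \<le> ennreal a \<longleftrightarrow> (\<forall>t>0. ennreal (eta_real n f t / t powr \<beta>) \<le> ennreal a)"
      using True d by (auto simp: Zsemi_def SUP_le_iff)
    also have "\<dots> \<longleftrightarrow> (\<forall>t>0. eta_real n f t \<le> a * t powr \<beta>)"
      using a by (simp add: divide_le_eq)
    finally show ?thesis using True by (simp add: besov_bound_def)
  next
    case False
    let ?q = "enn2real p"
    note q = enn2real_ge_1[OF p False]
    have "(\<integral>\<^sup>+t\<in>{0<..}. (ennpowr (eta n (nderiv n f) t / ennreal (t powr \<beta>)) ?q / ennreal t) \<partial>lborel) = besov_integral \<beta> ?q (eta_real n f)"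
      unfolding besov_integral_def
    proof (rule nn_integral_cong)
      show "ennpowr (eta n (nderiv n f) t / ennreal (t powr \<beta>)) ?q / ennreal t * indicator {0<..} t =
          ennreal ((eta_real n f t / t powr \<beta>) powr ?q / t) * indicator {0<..} t" for t
        by (cases "0 < t") (simp_all add: d ennpowr_ennreal divide_ennreal)
    qed
    then have "Zsemi n \<beta> p (nderiv n f) = ennpowr (besov_integral \<beta> ?q (eta_real n f)) (1 / ?q)"
      using False by (simp add: Zsemi_def)
    moreover have "ennpowr I (1 / ?q) \<le> ennreal a \<longleftrightarrow> I \<le> ennreal (a powr ?q)" for I
    proof (cases I rule: ennreal_cases)
      case (real r)
      have "r powr (1 / ?q) \<le> a \<longleftrightarrow> r \<le> a powr ?q"
      proof
        assume "r powr (1 / ?q) \<le> a"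
        then have "(r powr (1 / ?q)) powr ?q \<le> a powr ?q" using q by (intro powr_mono2) auto
        then show "r \<le> a powr ?q" using q real by (simp add: powr_powr)
      next
        assume "r \<le> a powr ?q"
        then have "r powr (1 / ?q) \<le> (a powr ?q) powr (1 / ?q)" using q real by (intro powr_mono2) auto
        then show "r powr (1 / ?q) \<le> a" using q a by (simp add: powr_powr)
      qed
      then show ?thesis using real a by (simp add: ennpowr_ennreal)
    next
      case top
      then show ?thesis by (simp add: ennpowr_def top_unique)
    qed
    ultimately show ?thesis using False by (simp add: besov_bound_def)
  qed
qed

section \<open>Integrable curves in Besov spaces\<close>

text \<open>With \<open>c = 4 * B\<close>, \<open>zygmund_holder\<close> gives the Hoelder constant
  \<open>2 * B / (1 - 2 powr (\<gamma> - 1))\<close>. The extra 1 makes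
  \<open>holder_const \<gamma> * B\<close> dominate the bound \<open>B\<close> of the function as
  well.\<close>

definition holder_const :: "real \<Rightarrow> real" where "holder_const \<gamma> = 1 + 1 / (1 - 2 powr (\<gamma> - 1))"

lemma holder_const_ge: "\<gamma> < 1 \<Longrightarrow> 1 \<le> holder_const \<gamma>"
  using powr_less_mono[of "\<gamma> - 1" 0 2] by (simp add: holder_const_def)

lemma eta_real_le:
  fixes f :: "'a::euclidean_space \<Rightarrow> 'b::real_normed_vector"
  assumes f: "cls \<gamma> n M H f" and H: "modulus H" and t: "0 \<le> t"
  shows "eta_real n f t \<le> H t"
proof (rule eta_real_least)
  fix hs :: "'a list" and x h :: 'a assume hs: "unit_list hs" "length hs = n" and h: "norm h \<le> t"
  have "norm (sdiff hs f x h) \<le> H (norm h)" using cls_iter_dderiv_top[OF f hs] by simp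
  also have "\<dots> \<le> H t" by (rule modulus_mono[OF H norm_ge_zero h])
  finally show "norm (sdiff hs f x h) \<le> H t" .
qed (rule modulus_nonneg[OF H t])

lemma besov_normI:
  fixes f :: "'a::euclidean_space \<Rightarrow> 'b::real_normed_vector"
  assumes \<gamma>: "0 < \<gamma>" "\<gamma> \<le> 1" and p: "1 \<le> p" and f: "cls \<gamma> n M H f" and B: "bd n B f" and z: "besov_bound \<beta> p B (eta_real n f)"
  shows "f \<in> besov n \<beta> p" "besov_norm n \<beta> p f \<le> ennreal B"
proof -
  note B0 = cls_nonneg[OF B]
  have b: "norm (iter_dderiv hs f x) \<le> B" if "unit_list hs" "length hs \<le> n" for hs x
    using cls_iter_dderiv_bound[OF B that] .
  have "Cb_norm n f \<le> ennreal B" using b by (subst Cb_norm_le_iff[OF B0]) blast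
  moreover have "Zsemi n \<beta> p (nderiv n f) \<le> ennreal B"
    using z by (subst Zsemi_le_iff[OF eta_eta_real B0 p]) (auto intro: b)
  ultimately show le: "besov_norm n \<beta> p f \<le> ennreal B" by (simp add: besov_norm_def)
  then have "besov_norm n \<beta> p f < \<infinity>" by (rule le_less_trans) simp
  then show "f \<in> besov n \<beta> p" using cls_Cn[OF \<gamma> f] by (simp add: besov_def)
qed

text \<open>The Hoelder bound is not part of the Besov norm. Second differences of order \<gamma>
  come from \<open>besov_bound_embedding\<close> for short steps and from the bound \<open>B\<close>
  for long ones; \<open>zygmund_holder\<close> then requires an exponent below 1, even when \<beta>
  = 1.\<close>

lemma besov_normD:
  fixes f :: "'a::euclidean_space \<Rightarrow> 'b::real_normed_vector"
  assumes \<gamma>: "0 < \<gamma>" "\<gamma> < \<beta>" "\<beta> \<le> 1" and p: "1 \<le> p"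
    and f: "f \<in> besov n \<beta> p" and le: "besov_norm n \<beta> p f \<le> ennreal B" and B0: "0 \<le> B"
  shows "bd n B f" "besov_bound \<beta> p B (eta_real n f)" "modulus (eta_real n f)" "cls \<gamma> n (holder_const \<gamma> * B) (eta_real n f) f"
proof -
  have Cn: "f \<in> Cn n" using f by (simp add: besov_def)
  have "Cb_norm n f \<le> ennreal B" "Zsemi n \<beta> p (nderiv n f) \<le> ennreal B" using le by (auto simp: besov_norm_def)
  then have b: "norm (iter_dderiv hs f x) \<le> B" if "unit_list hs" "length hs \<le> n" for hs x
    using Cb_norm_le_iff[OF B0, of n f] that by blast
  show bd: "bd n B f"
    by (rule cls_ddI[OF b Cn_iter_dderiv_differentiable[OF Cn]]) (auto intro!: bd_0I b simp del: cls.simps)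
  have be: "eta n (nderiv n f) t = ennreal (eta_real n f t)" for t by (rule eta_eta_real) (auto intro: b)
  show z: "besov_bound \<beta> p B (eta_real n f)"
    using \<open>Zsemi n \<beta> p (nderiv n f) \<le> ennreal B\<close> Zsemi_le_iff[OF be B0 p] by blast
  show m: "modulus (eta_real n f)" by (rule modulus_eta_real) (auto intro: b)
  have hk1: "B \<le> holder_const \<gamma> * B" using mult_right_mono[OF holder_const_ge B0] \<gamma> by simp
  show "cls \<gamma> n (holder_const \<gamma> * B) (eta_real n f) f"
  proof (rule cls_ddI[OF _ Cn_iter_dderiv_differentiable[OF Cn]])
    show "norm (iter_dderiv hs f x) \<le> holder_const \<gamma> * B" if "unit_list hs" "length hs \<le> n" for hs x
      using b[OF that] hk1 by (rule order_trans)
    fix hs :: "'a list" assume hs: "unit_list hs" "length hs = n"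
    have e: "norm (sdiff hs f x h) \<le> eta_real n f (norm h)" for x h
      by (rule eta_real_upper[OF _ hs]) (auto intro: b)
    have sd: "norm (sdiff hs f x h) \<le> 4 * B * norm h powr \<gamma>" for x h
    proof (cases "h = 0")
      case True
      then show ?thesis by (simp add: scaleR_2)
    next
      case False
      show ?thesis
      proof (cases "norm h \<le> 1")
        case True
        have "norm (sdiff hs f x h) \<le> 4 * B * norm h powr \<beta>"
          using order_trans[OF e besov_bound_embedding[OF z m B0 p]] False \<gamma> by simp
        also have "\<dots> \<le> 4 * B * norm h powr \<gamma>"
          using True \<gamma> B0 by (intro mult_left_mono powr_mono') auto
        finally show ?thesis .
      next
        case False
        have "norm (sdiff hs f x h) \<le> 4 * B * 1"
          using norm_second_diff_le[of "iter_dderiv hs f" B] b[of hs] hs by simp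
        also have "\<dots> \<le> 4 * B * norm h powr \<gamma>"
          using False B0 \<gamma> by (intro mult_left_mono ge_one_powr_ge_zero) auto
        finally show ?thesis .
      qed
    qed
    have "norm (iter_dderiv hs f x - iter_dderiv hs f y) \<le> 2 * (holder_const \<gamma> * B) * norm (x - y) powr \<gamma>" for x y
    proof -
      have "norm (iter_dderiv hs f x - iter_dderiv hs f y) \<le> 4 * B / (2 * (1 - 2 powr (\<gamma> - 1))) * norm (x - y) powr \<gamma>"
        using \<gamma> B0 hs by (intro zygmund_holder[OF _ _ b _ sd]) auto
      also have "4 * B / (2 * (1 - 2 powr (\<gamma> - 1))) = 2 * ((holder_const \<gamma> - 1) * B)"
      proof -
        have "4 * B / (2 * q) = 2 * ((1 + 1 / q - 1) * B)" for q by simp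
        then show ?thesis unfolding holder_const_def .
      qed
      also have "\<dots> * norm (x - y) powr \<gamma> \<le> 2 * (holder_const \<gamma> * B) * norm (x - y) powr \<gamma>"
        using B0 by (intro mult_right_mono) (auto simp: algebra_simps)
      finally show ?thesis .
    qed
    moreover have "norm (iter_dderiv hs f x) \<le> holder_const \<gamma> * B" for x using b[of hs x] hs hk1 by simp
    ultimately show "cls \<gamma> 0 (holder_const \<gamma> * B) (eta_real n f) (iter_dderiv hs f)" using e by simp
  qed
qed

lemma modulus_integral:
  assumes "\<And>t. t \<in> {0..1} \<Longrightarrow> modulus (h t)" "\<And>\<tau>. 0 \<le> \<tau> \<Longrightarrow> integrable (lebesgue_on {0..1}) (\<lambda>t. h t \<tau>)"
  shows "modulus (\<lambda>\<tau>. \<integral>t. h t \<tau> \<partial>(lebesgue_on {0..1}))"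
  unfolding modulus_def
proof (intro conjI allI impI)
  fix \<tau> :: real assume "0 \<le> \<tau>"
  then have "(\<integral>t. h t (2 * \<tau>) \<partial>(lebesgue_on {0..1})) \<le> (\<integral>t. 4 * h t \<tau> \<partial>(lebesgue_on {0..1}))"
    using assms by (intro integral_mono integrable_mult_right) (auto simp: modulus_def)
  then show "(\<integral>t. h t (2 * \<tau>) \<partial>(lebesgue_on {0..1})) \<le> 4 * (\<integral>t. h t \<tau> \<partial>(lebesgue_on {0..1}))" by simp
next
  fix s \<tau> :: real assume "0 \<le> s" "s \<le> \<tau>"
  then show "(\<integral>t. h t s \<partial>(lebesgue_on {0..1})) \<le> (\<integral>t. h t \<tau> \<partial>(lebesgue_on {0..1}))"
    using assms by (intro integral_mono) (auto simp: modulus_def)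
qed

text \<open>Here \<gamma> is an auxiliary Hoelder exponent of the top derivatives, free between
  \<beta> / 2 and \<beta>; the exponent of the flow map is obtained from it by
  interpolation.\<close>

locale besov_setting =
  fixes n :: nat and \<beta> \<gamma> :: real and p :: ennreal
  assumes \<gamma>: "0 < \<gamma>" "\<gamma> < \<beta>" and \<beta>: "\<beta> \<le> 1" "\<beta> < 2 * \<gamma>" and p: "1 \<le> p" and n: "2 \<le> n"
begin

abbreviation N :: "('a::euclidean_space \<Rightarrow> 'a) \<Rightarrow> ennreal" where "N \<equiv> besov_norm n \<beta> p"
abbreviation V :: "('a::euclidean_space \<Rightarrow> 'a) set" where "V \<equiv> besov n \<beta> p"
abbreviation X :: "(real \<Rightarrow> 'a::euclidean_space \<Rightarrow> 'a) set" where "X \<equiv> L1_curves V N"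

definition bnorm :: "('a::euclidean_space \<Rightarrow> 'a) \<Rightarrow> real" where "bnorm f = enn2real (N f)"

lemma bnorm_nonneg [simp]: "0 \<le> bnorm f" by (simp add: bnorm_def)

lemma N_eq: "f \<in> V \<Longrightarrow> N f = ennreal (bnorm f)"
  by (auto simp: besov_def bnorm_def)

lemma V_bounds:
  assumes "f \<in> V"
  shows "bd n (bnorm f) f" "besov_bound \<beta> p (bnorm f) (eta_real n f)" "modulus (eta_real n f)" "cls \<gamma> n (holder_const \<gamma> * bnorm f) (eta_real n f) f"
  using besov_normD[OF \<gamma> \<beta>(1) p assms, of "bnorm f"] N_eq[OF assms] by auto

lemma \<gamma>1: "\<gamma> \<le> 1" "\<gamma> < 1" "0 \<le> \<gamma>" using \<gamma> \<beta> by auto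

lemma V_eta_real_diff:
  assumes "f \<in> V" "g \<in> V"
  shows "eta_real n (\<lambda>x. f x - g x) t \<le> eta_real n f t + eta_real n g t"
  by (rule eta_real_diff[OF V_bounds(4)[OF assms(1)] V_bounds(4)[OF assms(2)]])

text \<open>Only differences of fields are formed; together with zero they yield symmetry and the
  triangle inequality in the forms used below.\<close>

lemma V_diff:
  assumes "f \<in> V" "g \<in> V"
  shows "f - g \<in> V" "bnorm (f - g) \<le> bnorm f + bnorm g"
proof -
  let ?d = "\<lambda>x. f x - g x"
  note c = cls_diff[OF V_bounds(4)[OF assms(1)] V_bounds(4)[OF assms(2)]]
  have b: "bd n (bnorm f + bnorm g) ?d" by (rule cls_bd[OF cls_diff[OF V_bounds(1)[OF assms(1)] V_bounds(1)[OF assms(2)]]])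
  have "besov_bound \<beta> p (bnorm f + bnorm g) (\<lambda>t. eta_real n f t + eta_real n g t)"
    using V_bounds[OF assms(1)] V_bounds[OF assms(2)] p by (intro besov_bound_add_nonneg) auto
  then have z: "besov_bound \<beta> p (bnorm f + bnorm g) (eta_real n ?d)"
    using V_eta_real_diff[OF assms] p by (rule_tac besov_bound_mono) auto
  note B = besov_normI[OF \<gamma>(1) \<gamma>1(1) p c b z]
  then show "f - g \<in> V" by (simp add: fun_diff_def)
  have "N (f - g) \<le> ennreal (bnorm f + bnorm g)" using B(2) by (simp add: fun_diff_def)
  from enn2real_mono[OF this] show "bnorm (f - g) \<le> bnorm f + bnorm g" unfolding bnorm_def[of "f - g"] by (simp del: ennreal_plus)
qed

lemma V_zero: "(\<lambda>_::'a::euclidean_space. 0::'a) \<in> V" "bnorm (\<lambda>_::'a. 0::'a) = 0"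
proof -
  have c: "cls \<gamma> n 0 (\<lambda>_. 0) (\<lambda>_::'a. 0::'a)" by (rule cls_const) simp
  have m: "modulus (\<lambda>_. 0)" by (simp add: modulus_def)
  have "besov_bound \<beta> p 0 (\<lambda>_. 0)" using enn2real_ge_1[OF p] by (auto simp: besov_bound_def besov_integral_def)
  moreover have "0 \<le> eta_real n (\<lambda>_::'a. 0::'a) t \<and> eta_real n (\<lambda>_::'a. 0::'a) t \<le> 0" if "0 < t" for t
    using eta_real_le[OF c m, of t] that by simp
  ultimately have z: "besov_bound \<beta> p 0 (eta_real n (\<lambda>_::'a. 0::'a))" using p by (rule_tac besov_bound_mono) auto
  note B = besov_normI[OF \<gamma>(1) \<gamma>1(1) p c cls_bd[OF c] z]
  show "(\<lambda>_::'a. 0::'a) \<in> V" "bnorm (\<lambda>_::'a. 0::'a) = 0" using B by (auto simp: bnorm_def)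
qed

lemma bnorm_swap:
  assumes "f \<in> V" "g \<in> V" shows "bnorm (f - g) = bnorm (g - f)"
proof -
  have "bnorm (f - g) \<le> bnorm (g - f)" if "f \<in> V" "g \<in> V" for f g :: "'a \<Rightarrow> 'a"
  proof -
    have "(\<lambda>_. 0) - (g - f) = f - g" by (simp add: fun_eq_iff)
    then show ?thesis using V_diff(2)[OF V_zero(1) V_diff(1)[OF that(2,1)]] by (simp add: V_zero(2))
  qed
  then show ?thesis using assms by (simp add: order_antisym)
qed

lemma bnorm_tri:
  assumes "f \<in> V" "g \<in> V" shows "bnorm f \<le> bnorm g + bnorm (f - g)"
proof -
  have "g - (g - f) = f" by (simp add: fun_eq_iff)
  then show ?thesis using V_diff(2)[OF assms(2) V_diff(1)[OF assms(2,1)]] bnorm_swap[OF assms] by simp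
qed

lemma bnorm_abs:
  assumes "f \<in> V" "g \<in> V" shows "\<bar>bnorm f - bnorm g\<bar> \<le> bnorm (f - g)"
  using bnorm_tri[OF assms] bnorm_tri[OF assms(2,1)] bnorm_swap[OF assms] by simp

lemma eta_real_bnorm:
  assumes "f \<in> V" shows "eta_real n f t \<le> 4 * bnorm f"
proof (rule eta_real_least)
  fix hs :: "'a list" and x h :: 'a assume "unit_list hs" "length hs = n"
  then show "norm (sdiff hs f x h) \<le> 4 * bnorm f"
    using cls_iter_dderiv_bound[OF V_bounds(1)[OF assms]] by (intro norm_second_diff_le) auto
qed simp

lemma eta_real_abs:
  assumes "f \<in> V" "g \<in> V" shows "\<bar>eta_real n f t - eta_real n g t\<bar> \<le> 4 * bnorm (f - g)"
proof -
  have "eta_real n f t \<le> eta_real n g t + 4 * bnorm (f - g)" if "f \<in> V" "g \<in> V" for f g :: "'a \<Rightarrow> 'a"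
  proof -
    have "eta_real n (\<lambda>x. g x - (g - f) x) t \<le> eta_real n g t + eta_real n (g - f) t"
      by (rule V_eta_real_diff[OF that(2) V_diff(1)[OF that(2,1)]])
    moreover have "(\<lambda>x. g x - (g - f) x) = f" by (simp add: fun_eq_iff)
    ultimately show ?thesis using eta_real_bnorm[OF V_diff(1)[OF that(2,1)], of t] bnorm_swap[OF that] by simp
  qed
  from this[OF assms] this[OF assms(2,1)] show ?thesis using bnorm_swap[OF assms] by simp
qed

lemma V_eval:
  assumes "f \<in> V" "g \<in> V" shows "norm (f x - g x) \<le> bnorm (f - g)"
  using cls_bound[OF V_bounds(1)[OF V_diff(1)[OF assms]], of x] by simp

lemma V_continuous:
  assumes "f \<in> V" shows "continuous_on UNIV f"
proof -
  obtain k where "n = Suc k" using n by (cases n) auto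
  then have "f differentiable at x" for x using V_bounds(1)[OF assms] by simp
  then show ?thesis by (simp add: continuous_at_imp_continuous_on differentiable_imp_continuous_within)
qed

section \<open>Measurability and integrability along Bochner integrable curves\<close>

abbreviation I01 :: "real measure" where "I01 \<equiv> lebesgue_on {0..1}"

lemma X_simple_approx:
  assumes "u \<in> X"
  obtains s where "\<And>j. simple_function I01 (s j)" "\<And>j t. t \<in> {0..1} \<Longrightarrow> s j t \<in> V"
    "AE t in I01. (\<lambda>j. bnorm (u t - s j t)) \<longlonglongrightarrow> 0"
    "(\<lambda>j. L1_norm N (\<lambda>t. u t - s j t)) \<longlonglongrightarrow> 0"
proof -
  have uV: "u t \<in> V" if "t \<in> {0..1}" for t using assms that by (simp add: L1_curves_def)
  obtain s where s: "\<And>j. simple_function I01 (s j)" "\<And>j t. t \<in> {0..1} \<Longrightarrow> s j t \<in> V"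
    "AE t in I01. (\<lambda>j. N (u t - s j t)) \<longlonglongrightarrow> 0"
    "(\<lambda>j. L1_norm N (\<lambda>t. u t - s j t)) \<longlonglongrightarrow> 0"
    using assms unfolding L1_curves_def by blast
  have "AE t in I01. (\<lambda>j. bnorm (u t - s j t)) \<longlonglongrightarrow> 0"
    using s(3) AE_space
  proof eventually_elim
    case (elim t)
    then have t: "t \<in> {0..1}" by simp
    have "N (u t - s j t) = ennreal (bnorm (u t - s j t))" for j
      by (rule N_eq[OF V_diff(1)[OF uV[OF t] s(2)[OF t]]])
    then have "(\<lambda>j. ennreal (bnorm (u t - s j t))) \<longlonglongrightarrow> ennreal 0" using elim(1) by simp
    then show ?case by (subst (asm) tendsto_ennreal_iff) auto
  qed
  then show ?thesis using that s by blast
qed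

lemma X_V: "u \<in> X \<Longrightarrow> t \<in> {0..1} \<Longrightarrow> u t \<in> V"
  by (simp add: L1_curves_def)

lemma simple_compose_measurable:
  fixes F :: "('a::euclidean_space \<Rightarrow> 'a) \<Rightarrow> real \<Rightarrow> 'c::euclidean_space"
  assumes "simple_function I01 s" "\<And>t. t \<in> {0..1} \<Longrightarrow> s t \<in> V" "\<And>f. f \<in> V \<Longrightarrow> F f \<in> borel_measurable I01"
  shows "(\<lambda>t. F (s t) t) \<in> borel_measurable I01"
proof (rule measurable_compose_countable'[where I="s ` {0..1}" and f=F and g=s])
  have f: "finite (s ` {0..1})" using simple_functionD(1)[OF assms(1)] by simp
  show "s \<in> measurable I01 (count_space (s ` {0..1}))"
    using simple_functionD(2)[OF assms(1)] f by (simp add: measurable_count_space_eq2)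
  show "countable (s ` {0..1})" using f by (rule countable_finite)
qed (use assms in auto)

text \<open>No sigma-algebra is put on the Besov space. Along a simple curve \<open>F\<close> is
  pieced together from finitely many measurable functions; since \<open>F\<close> is Lipschitz in
  the norm, convergence of the approximating curves almost everywhere carries over to its
  values.\<close>

lemma X_measurable:
  fixes F :: "('a::euclidean_space \<Rightarrow> 'a) \<Rightarrow> real \<Rightarrow> 'c::euclidean_space"
  assumes u: "u \<in> X" and F: "\<And>f. f \<in> V \<Longrightarrow> F f \<in> borel_measurable I01"
    and le: "\<And>f g t. f \<in> V \<Longrightarrow> g \<in> V \<Longrightarrow> t \<in> {0..1} \<Longrightarrow> norm (F f t - F g t) \<le> c * bnorm (f - g)"
  shows "(\<lambda>t. F (u t) t) \<in> borel_measurable I01"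
proof -
  obtain s where s: "\<And>j. simple_function I01 (s j)" "\<And>j t. t \<in> {0..1} \<Longrightarrow> s j t \<in> V"
    "AE t in I01. (\<lambda>j. bnorm (u t - s j t)) \<longlonglongrightarrow> 0"
    by (rule X_simple_approx[OF u]) blast
  \<comment> \<open>Convergence may fail on a null set, where \<open>lim\<close> takes some
    arbitrary value; completeness of Lebesgue measure makes this harmless.\<close>
  define G where "G t = lim (\<lambda>j. F (s j t) t)" for t
  have "(\<lambda>t. F (s j t) t) \<in> borel_measurable I01" for j
    by (rule simple_compose_measurable[OF s(1) s(2) F])
  then have "G \<in> borel_measurable I01" unfolding G_def by (rule borel_measurable_lim_metric)
  then have G: "(\<lambda>t. indicator {0..1} t *\<^sub>R G t) \<in> borel_measurable lebesgue"
    by (subst (asm) borel_measurable_restrict_space_iff) auto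
  have "AE t in I01. G t = F (u t) t"
    using s(3) AE_space
  proof eventually_elim
    case (elim t)
    then have t: "t \<in> {0..1}" by simp
    have "(\<lambda>j. c * bnorm (u t - s j t)) \<longlonglongrightarrow> c * 0" by (intro tendsto_intros elim)
    then have l: "(\<lambda>j. c * bnorm (u t - s j t)) \<longlonglongrightarrow> 0" by (simp only: mult_zero_right)
    have "norm (F (s j t) t - F (u t) t) \<le> c * bnorm (u t - s j t)" for j
      using le[OF X_V[OF u t] s(2)[OF t] t, of j] by (simp only: norm_minus_commute)
    then have "\<forall>\<^sub>F j in sequentially. norm (F (s j t) t - F (u t) t) \<le> c * bnorm (u t - s j t)"
      by (simp only: eventually_True)
    from Lim_null_comparison[OF this l] have "(\<lambda>j. F (s j t) t - F (u t) t) \<longlonglongrightarrow> 0" .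
    then show ?case unfolding G_def by (simp add: LIM_zero_iff limI)
  qed
  then have "AE t in lebesgue. t \<in> {0..1} \<longrightarrow> G t = F (u t) t"
    by (subst (asm) AE_restrict_space_iff) auto
  then have "AE t in lebesgue. indicator {0..1} t *\<^sub>R G t = indicator {0..1} t *\<^sub>R F (u t) t"
    by eventually_elim (auto simp: indicator_def)
  from borel_measurable_AE[OF G this] show ?thesis
    by (subst borel_measurable_restrict_space_iff) auto
qed

lemma X_bnorm_measurable:
  assumes "u \<in> X" shows "(\<lambda>t. bnorm (u t)) \<in> borel_measurable I01"
  by (rule X_measurable[OF assms, of "\<lambda>f t. bnorm f" 1]) (use bnorm_abs in auto)

lemma X_bnorm_diff_measurable:
  assumes "u \<in> X" "\<And>f. f \<in> V \<Longrightarrow> (\<lambda>t. bnorm (f - s t)) \<in> borel_measurable I01" "\<And>t. t \<in> {0..1} \<Longrightarrow> s t \<in> V"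
  shows "(\<lambda>t. bnorm (u t - s t)) \<in> borel_measurable I01"
proof (rule X_measurable[OF assms(1), of "\<lambda>f t. bnorm (f - s t)" 1])
  fix f g :: "'a \<Rightarrow> 'a" and t :: real assume fg: "f \<in> V" "g \<in> V" "t \<in> {0..1}"
  have "(f - s t) - (g - s t) = f - g" by (simp add: fun_eq_iff)
  then show "norm (bnorm (f - s t) - bnorm (g - s t)) \<le> 1 * bnorm (f - g)"
    using bnorm_abs[OF V_diff(1)[OF fg(1) assms(3)[OF fg(3)]] V_diff(1)[OF fg(2) assms(3)[OF fg(3)]]]
    unfolding real_norm_def mult_1 by metis
qed (rule assms(2))

lemma X_simple_diff_measurable:
  assumes "u \<in> X" "simple_function I01 s" "\<And>t. t \<in> {0..1} \<Longrightarrow> s t \<in> V"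
  shows "(\<lambda>t. bnorm (u t - s t)) \<in> borel_measurable I01"
proof (rule X_bnorm_diff_measurable[OF assms(1) _ assms(3)])
  show "(\<lambda>t. bnorm (f - s t)) \<in> borel_measurable I01" if "f \<in> V" for f
    by (rule simple_compose_measurable[OF assms(2,3), where F="\<lambda>g t. bnorm (f - g)"]) auto
qed

lemma L1_norm_eq:
  assumes "\<And>t. t \<in> {0..1} \<Longrightarrow> w t \<in> V"
  shows "L1_norm N w = (\<integral>\<^sup>+t. ennreal (bnorm (w t)) \<partial>I01)"
  unfolding L1_norm_def using assms by (intro nn_integral_cong) (simp add: N_eq)

lemma simple_bnorm_integrable:
  assumes "simple_function I01 s" "\<And>t. t \<in> {0..1} \<Longrightarrow> s t \<in> V"
  shows "integrable I01 (\<lambda>t. bnorm (s t))"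
proof -
  have "finite (bnorm ` s ` {0..1})" using simple_functionD(1)[OF assms(1)] by simp
  then obtain B where B: "\<And>t. t \<in> {0..1} \<Longrightarrow> bnorm (s t) \<le> B"
    by (metis (no_types, lifting) Max_ge image_eqI)
  show ?thesis
  proof (rule Bochner_Integration.integrable_bound[of I01 "\<lambda>_. B"])
    show "integrable I01 (\<lambda>_. B)" by simp
    show "(\<lambda>t. bnorm (s t)) \<in> borel_measurable I01"
      by (rule simple_compose_measurable[OF assms, where F="\<lambda>g t. bnorm g"]) auto
    show "AE t in I01. norm (bnorm (s t)) \<le> norm B"
      by (rule AE_I2) (use B in \<open>force intro: order_trans[OF _ abs_ge_self]\<close>)
  qed
qed

lemma X_approx:
  assumes u: "u \<in> X" and e: "0 < e"
  obtains s where "simple_function I01 s" "\<And>t. t \<in> {0..1} \<Longrightarrow> s t \<in> V"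
    "integrable I01 (\<lambda>t. bnorm (u t - s t))" "(\<integral>t. bnorm (u t - s t) \<partial>I01) < e"
proof -
  obtain s where s: "\<And>j. simple_function I01 (s j)" "\<And>j t. t \<in> {0..1} \<Longrightarrow> s j t \<in> V"
    "(\<lambda>j. L1_norm N (\<lambda>t. u t - s j t)) \<longlonglongrightarrow> 0"
    by (rule X_simple_approx[OF u]) blast
  have "\<forall>\<^sub>F j in sequentially. L1_norm N (\<lambda>t. u t - s j t) < ennreal e"
    using order_tendstoD(2)[OF s(3)] e by simp
  then obtain j where j: "L1_norm N (\<lambda>t. u t - s j t) < ennreal e"
    by (auto simp: eventually_sequentially)
  have V: "u t - s j t \<in> V" if "t \<in> {0..1}" for t using V_diff(1)[OF X_V[OF u that] s(2)[OF that]] .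
  have m: "(\<lambda>t. bnorm (u t - s j t)) \<in> borel_measurable I01"
    by (rule X_simple_diff_measurable[OF u s(1,2)])
  have l: "(\<integral>\<^sup>+t. ennreal (bnorm (u t - s j t)) \<partial>I01) < ennreal e"
    using j by (simp only: L1_norm_eq[OF V])
  have i: "integrable I01 (\<lambda>t. bnorm (u t - s j t))"
    by (rule integrableI_nonneg[OF m]) (use l order_less_trans in \<open>auto simp: less_top[symmetric]\<close>)
  have "ennreal (\<integral>t. bnorm (u t - s j t) \<partial>I01) < ennreal e"
    using l by (simp add: nn_integral_eq_integral[OF i])
  then have "(\<integral>t. bnorm (u t - s j t) \<partial>I01) < e" using e by (simp add: ennreal_less_iff)
  then show ?thesis using that[OF s(1,2) i] by blast
qed

lemma X_bnorm_integrable: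
  assumes u: "u \<in> X" shows "integrable I01 (\<lambda>t. bnorm (u t))"
proof -
  obtain s where s: "simple_function I01 s" "\<And>t. t \<in> {0..1} \<Longrightarrow> s t \<in> V" "integrable I01 (\<lambda>t. bnorm (u t - s t))"
    by (rule X_approx[OF u, of 1]) auto
  show ?thesis
  proof (rule Bochner_Integration.integrable_bound)
    show "integrable I01 (\<lambda>t. bnorm (s t) + bnorm (u t - s t))"
      using simple_bnorm_integrable[OF s(1,2)] s(3) by (rule Bochner_Integration.integrable_add)
    show "AE t in I01. norm (bnorm (u t)) \<le> norm (bnorm (s t) + bnorm (u t - s t))"
      by (rule AE_I2) (use bnorm_tri[OF X_V[OF u] s(2)] in auto)
  qed (rule X_bnorm_measurable[OF u])
qed

lemma X_L1_norm:
  assumes u: "u \<in> X" shows "L1_norm N u = ennreal (\<integral>t. bnorm (u t) \<partial>I01)"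
proof -
  have "L1_norm N u = (\<integral>\<^sup>+t. ennreal (bnorm (u t)) \<partial>I01)" by (rule L1_norm_eq) (rule X_V[OF u])
  also have "\<dots> = ennreal (\<integral>t. bnorm (u t) \<partial>I01)" by (rule nn_integral_eq_integral[OF X_bnorm_integrable[OF u]]) simp
  finally show ?thesis .
qed

lemma X_diff:
  assumes u: "u \<in> X" and v: "v \<in> X" shows "u - v \<in> X"
proof -
  obtain s where s: "\<And>j. simple_function I01 (s j)" "\<And>j t. t \<in> {0..1} \<Longrightarrow> s j t \<in> V"
    "AE t in I01. (\<lambda>j. bnorm (u t - s j t)) \<longlonglongrightarrow> 0" "(\<lambda>j. L1_norm N (\<lambda>t. u t - s j t)) \<longlonglongrightarrow> 0"
    by (rule X_simple_approx[OF u]) blast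
  obtain r where r: "\<And>j. simple_function I01 (r j)" "\<And>j t. t \<in> {0..1} \<Longrightarrow> r j t \<in> V"
    "AE t in I01. (\<lambda>j. bnorm (v t - r j t)) \<longlonglongrightarrow> 0" "(\<lambda>j. L1_norm N (\<lambda>t. v t - r j t)) \<longlonglongrightarrow> 0"
    by (rule X_simple_approx[OF v]) blast
  let ?q = "\<lambda>j t. s j t - r j t"
  have VV: "u t - s j t \<in> V" "v t - r j t \<in> V" "(u - v) t - ?q j t \<in> V" if t: "t \<in> {0..1}" for t j
  proof -
    show 1: "u t - s j t \<in> V" by (rule V_diff(1)[OF X_V[OF u t] s(2)[OF t]])
    show 2: "v t - r j t \<in> V" by (rule V_diff(1)[OF X_V[OF v t] r(2)[OF t]])
    have "(u - v) t - ?q j t = (u t - s j t) - (v t - r j t)" by (simp add: fun_eq_iff)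
    then show "(u - v) t - ?q j t \<in> V" using V_diff(1)[OF 1 2] by metis
  qed
  have le: "bnorm ((u - v) t - ?q j t) \<le> bnorm (u t - s j t) + bnorm (v t - r j t)" if t: "t \<in> {0..1}" for t j
  proof -
    have "(u - v) t - ?q j t = (u t - s j t) - (v t - r j t)" by (simp add: fun_eq_iff)
    then show ?thesis using V_diff(2)[OF VV(1,2)[OF t]] by metis
  qed
  have "AE t in I01. (\<lambda>j. N ((u - v) t - ?q j t)) \<longlonglongrightarrow> 0"
    using s(3) r(3) AE_space
  proof eventually_elim
    case (elim t)
    then have t: "t \<in> {0..1}" by simp
    have "(\<lambda>j. bnorm (u t - s j t) + bnorm (v t - r j t)) \<longlonglongrightarrow> 0" using tendsto_add[OF elim(1,2)] by simp
    then have "(\<lambda>j. bnorm ((u - v) t - ?q j t)) \<longlonglongrightarrow> 0"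
      by (rule Lim_null_comparison[rotated]) (use le[OF t] in auto)
    from tendsto_ennrealI[OF this] show ?case using N_eq[OF VV(3)[OF t]] by simp
  qed
  moreover have "(\<lambda>j. L1_norm N (\<lambda>t. (u - v) t - ?q j t)) \<longlonglongrightarrow> 0"
  proof (rule tendsto_sandwich[OF _ _ tendsto_const])
    have "(\<lambda>j. L1_norm N (\<lambda>t. u t - s j t) + L1_norm N (\<lambda>t. v t - r j t)) \<longlonglongrightarrow> 0 + 0"
      by (intro tendsto_add s r)
    then show "(\<lambda>j. L1_norm N (\<lambda>t. u t - s j t) + L1_norm N (\<lambda>t. v t - r j t)) \<longlonglongrightarrow> 0" by simp
    have "L1_norm N (\<lambda>t. (u - v) t - ?q j t) \<le> L1_norm N (\<lambda>t. u t - s j t) + L1_norm N (\<lambda>t. v t - r j t)" for j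
    proof -
      have "L1_norm N (\<lambda>t. (u - v) t - ?q j t) = (\<integral>\<^sup>+t. ennreal (bnorm ((u - v) t - ?q j t)) \<partial>I01)"
        by (rule L1_norm_eq[OF VV(3)])
      also have "\<dots> \<le> (\<integral>\<^sup>+t. ennreal (bnorm (u t - s j t)) + ennreal (bnorm (v t - r j t)) \<partial>I01)"
        using le by (intro nn_integral_mono) (auto simp flip: ennreal_plus intro!: ennreal_leI)
      also have "\<dots> = (\<integral>\<^sup>+t. ennreal (bnorm (u t - s j t)) \<partial>I01) + (\<integral>\<^sup>+t. ennreal (bnorm (v t - r j t)) \<partial>I01)"
        using X_simple_diff_measurable[OF u s(1,2)] X_simple_diff_measurable[OF v r(1,2)]
        by (intro nn_integral_add) auto
      finally show ?thesis by (simp only: L1_norm_eq[OF VV(1)] L1_norm_eq[OF VV(2)])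
    qed
    then show "\<forall>\<^sub>F j in sequentially. L1_norm N (\<lambda>t. (u - v) t - ?q j t) \<le> L1_norm N (\<lambda>t. u t - s j t) + L1_norm N (\<lambda>t. v t - r j t)"
      by simp
  qed simp
  moreover have "simple_function I01 (?q j)" for j using simple_function_compose2[OF s(1) r(1)] .
  moreover have "?q j t \<in> V" if "t \<in> {0..1}" for j t using V_diff(1)[OF s(2)[OF that] r(2)[OF that]] .
  moreover have "(u - v) t \<in> V" if "t \<in> {0..1}" for t using V_diff(1)[OF X_V[OF u that] X_V[OF v that]] by simp
  ultimately show ?thesis unfolding L1_curves_def
    by (intro CollectI conjI ballI exI[of _ ?q] allI)
qed

lemma X_eta_real_integrable:
  assumes u: "u \<in> X" shows "integrable I01 (\<lambda>t. eta_real n (u t) \<tau>)"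
proof (rule Bochner_Integration.integrable_bound)
  show "integrable I01 (\<lambda>t. 4 * bnorm (u t))" using X_bnorm_integrable[OF u] by simp
  show "(\<lambda>t. eta_real n (u t) \<tau>) \<in> borel_measurable I01"
    by (rule X_measurable[OF u, of "\<lambda>f t. eta_real n f \<tau>" 4]) (use eta_real_abs in auto)
  show "AE t in I01. norm (eta_real n (u t) \<tau>) \<le> norm (4 * bnorm (u t))"
    by (rule AE_I2) (use eta_real_bnorm[OF X_V[OF u]] in auto)
qed

text \<open>Needed for the integrand of the flow equation. It rests on evaluation at a point being
  1-Lipschitz in the Besov norm.\<close>

lemma X_eval_measurable:
  assumes u: "u \<in> X" and \<xi>: "continuous_on {0..1} \<xi>"
  shows "(\<lambda>t. u t (\<xi> t)) \<in> borel_measurable I01"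
proof (rule X_measurable[OF u, of "\<lambda>f t. f (\<xi> t)" 1])
  show "(\<lambda>t. f (\<xi> t)) \<in> borel_measurable I01" if "f \<in> V" for f
    by (rule continuous_imp_measurable_on_sets_lebesgue[OF continuous_on_compose2[OF V_continuous[OF that] \<xi>]]) auto
qed (use V_eval in auto)

section \<open>Minkowski's integral inequality for the averaged modulus\<close>

definition mean_modulus :: "(real \<Rightarrow> 'a::euclidean_space \<Rightarrow> 'a) \<Rightarrow> real \<Rightarrow> real" where
  "mean_modulus u \<tau> = (\<integral>t. eta_real n (u t) \<tau> \<partial>I01)"

lemma modulus_A: "u \<in> X \<Longrightarrow> modulus (mean_modulus u)"
  unfolding mean_modulus_def using X_eta_real_integrable V_bounds(3)[OF X_V] by (intro modulus_integral)

lemma simple_integral_sum: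
  fixes F :: "('a::euclidean_space \<Rightarrow> 'a) \<Rightarrow> real"
  assumes "simple_function I01 s"
  shows "(\<integral>t. F (s t) \<partial>I01) = (\<Sum>f\<in>s ` {0..1}. measure I01 (s -` {f} \<inter> {0..1}) * F f)"
proof -
  let ?S = "s ` {0..1}" and ?B = "\<lambda>f. s -` {f} \<inter> {0..1}"
  have fin: "finite ?S" using simple_functionD(1)[OF assms] by simp
  have B: "?B f \<in> sets I01" for f using simple_functionD(2)[OF assms, of "{f}"] by simp
  have i: "integrable I01 (\<lambda>t. indicat_real (?B f) t * F f)" for f
  proof -
    interpret finite_measure I01 by (rule finite_measure_lebesgue_on) simp
    show ?thesis using B by (intro integrable_mult_left integrable_real_indicator) (simp_all add: less_top[symmetric])
  qed
  have "(\<integral>t. F (s t) \<partial>I01) = (\<integral>t. (\<Sum>f\<in>?S. indicat_real (?B f) t * F f) \<partial>I01)"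
  proof (rule Bochner_Integration.integral_cong)
    fix t assume "t \<in> space I01"
    then have t: "t \<in> {0..1}" by simp
    have "(\<Sum>f\<in>?S. indicat_real (?B f) t * F f) = (\<Sum>f\<in>{s t}. indicat_real (?B f) t * F f)"
      using fin t by (intro sum.mono_neutral_right) (auto simp: indicator_def)
    also have "\<dots> = F (s t)" using t by (simp add: indicator_def)
    finally show "F (s t) = (\<Sum>f\<in>?S. indicat_real (?B f) t * F f)" by (rule sym)
  qed simp
  also have "\<dots> = (\<Sum>f\<in>?S. measure I01 (?B f) * F f)"
    using i B by (subst Bochner_Integration.integral_sum) auto
  finally show ?thesis .
qed

lemma besov_bound_A_simple:
  assumes s: "simple_function I01 s" "\<And>t. t \<in> {0..1} \<Longrightarrow> s t \<in> V"
  shows "besov_bound \<beta> p (\<integral>t. bnorm (s t) \<partial>I01) (mean_modulus s) \<and> modulus (mean_modulus s)"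
proof -
  let ?c = "\<lambda>f. measure I01 (s -` {f} \<inter> {0..1})"
  have fin: "finite (s ` {0..1})" using simple_functionD(1)[OF s(1)] by simp
  have "besov_bound \<beta> p (\<Sum>f\<in>S. ?c f * bnorm f) (\<lambda>\<tau>. \<Sum>f\<in>S. ?c f * eta_real n f \<tau>) \<and> modulus (\<lambda>\<tau>. \<Sum>f\<in>S. ?c f * eta_real n f \<tau>)"
    if "finite S" "S \<subseteq> V" for S
    using that
  proof (induction rule: finite_induct)
    case empty
    have "besov_bound \<beta> p 0 (\<lambda>_. 0)" using enn2real_ge_1[OF p] by (auto simp: besov_bound_def besov_integral_def)
    then show ?case by (simp add: modulus_def)
  next
    case (insert f S)
    then have f: "f \<in> V" by simp
    have m: "modulus (\<lambda>\<tau>. ?c f * eta_real n f \<tau>)" by (intro modulus_cmult V_bounds f) simp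
    have "besov_bound \<beta> p (?c f * bnorm f) (\<lambda>\<tau>. ?c f * eta_real n f \<tau>)" by (intro besov_bound_scale V_bounds f) auto
    then have "besov_bound \<beta> p (?c f * bnorm f + (\<Sum>f\<in>S. ?c f * bnorm f)) (\<lambda>\<tau>. ?c f * eta_real n f \<tau> + (\<Sum>f\<in>S. ?c f * eta_real n f \<tau>))"
      using m insert p by (intro besov_bound_add_nonneg) (auto intro!: sum_nonneg)
    moreover have "modulus (\<lambda>\<tau>. ?c f * eta_real n f \<tau> + (\<Sum>f\<in>S. ?c f * eta_real n f \<tau>))"
      using m insert by (intro modulus_add) auto
    ultimately show ?case using insert by simp
  qed
  moreover have "mean_modulus s = (\<lambda>\<tau>. \<Sum>f\<in>s ` {0..1}. ?c f * eta_real n f \<tau>)"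
    unfolding mean_modulus_def using simple_integral_sum[OF s(1), of "\<lambda>f. eta_real n f _"] by (intro ext)
  moreover have "(\<integral>t. bnorm (s t) \<partial>I01) = (\<Sum>f\<in>s ` {0..1}. ?c f * bnorm f)"
    by (rule simple_integral_sum[OF s(1)])
  moreover have "s ` {0..1} \<subseteq> V" using s(2) by blast
  ultimately show ?thesis using fin by simp
qed

text \<open>For simple curves this is the inequality for finite sums. Approximants with error
  \<open>e / Suc j\<close> have mass larger by at most \<open>e\<close>, their averaged moduli
  converge pointwise, and \<open>besov_bound_limit\<close> passes to the limit.\<close>

lemma besov_bound_A:
  assumes u: "u \<in> X" shows "besov_bound \<beta> p (\<integral>t. bnorm (u t) \<partial>I01) (mean_modulus u)"
proof (rule besov_bound_closed[OF _ p])
  fix e :: real assume e: "0 < e"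
  have "\<forall>j. \<exists>s. simple_function I01 s \<and> (\<forall>t\<in>{0..1}. s t \<in> V) \<and> integrable I01 (\<lambda>t. bnorm (u t - s t)) \<and>
      (\<integral>t. bnorm (u t - s t) \<partial>I01) < e / real (Suc j)"
  proof
    fix j
    show "\<exists>s. simple_function I01 s \<and> (\<forall>t\<in>{0..1}. s t \<in> V) \<and> integrable I01 (\<lambda>t. bnorm (u t - s t)) \<and>
      (\<integral>t. bnorm (u t - s t) \<partial>I01) < e / real (Suc j)"
      by (rule X_approx[OF u, of "e / real (Suc j)"]) (use e in auto)
  qed
  from choice[OF this] obtain s where "\<forall>j. simple_function I01 (s j) \<and> (\<forall>t\<in>{0..1}. s j t \<in> V) \<and>
      integrable I01 (\<lambda>t. bnorm (u t - s j t)) \<and> (\<integral>t. bnorm (u t - s j t) \<partial>I01) < e / real (Suc j)" by blast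
  then have s: "\<And>j. simple_function I01 (s j)" "\<And>j t. t \<in> {0..1} \<Longrightarrow> s j t \<in> V"
    "\<And>j. integrable I01 (\<lambda>t. bnorm (u t - s j t))" "\<And>j. (\<integral>t. bnorm (u t - s j t) \<partial>I01) < e / real (Suc j)"
    by simp_all
  show "besov_bound \<beta> p ((\<integral>t. bnorm (u t) \<partial>I01) + e) (mean_modulus u)"
  proof (rule besov_bound_limit[OF _ _ _ p])
    fix j
    have z: "besov_bound \<beta> p (\<integral>t. bnorm (s j t) \<partial>I01) (mean_modulus (s j))" and m: "modulus (mean_modulus (s j))"
      using besov_bound_A_simple[OF s(1)[of j] s(2)[of _ j]] by blast+
    show "modulus (mean_modulus (s j))" by (rule m)
    have "(\<integral>t. bnorm (s j t) \<partial>I01) \<le> (\<integral>t. bnorm (u t) + bnorm (u t - s j t) \<partial>I01)"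
    proof (rule integral_mono[OF simple_bnorm_integrable[OF s(1,2)] Bochner_Integration.integrable_add[OF X_bnorm_integrable[OF u] s(3)]])
      fix t assume "t \<in> space I01"
      then have t: "t \<in> {0..1}" by simp
      show "bnorm (s j t) \<le> bnorm (u t) + bnorm (u t - s j t)"
        using bnorm_tri[OF s(2)[OF t] X_V[OF u t]] bnorm_swap[OF s(2)[OF t] X_V[OF u t]] by metis
    qed simp
    also have "\<dots> = (\<integral>t. bnorm (u t) \<partial>I01) + (\<integral>t. bnorm (u t - s j t) \<partial>I01)"
      by (rule Bochner_Integration.integral_add[OF X_bnorm_integrable[OF u] s(3)])
    also have "(\<integral>t. bnorm (u t - s j t) \<partial>I01) \<le> e"
    proof -
      have "e / real (Suc j) \<le> e / 1" using e by (intro divide_left_mono) auto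
      then show ?thesis using s(4)[of j] by simp
    qed
    finally have le: "(\<integral>t. bnorm (s j t) \<partial>I01) \<le> (\<integral>t. bnorm (u t) \<partial>I01) + e" by simp
    show "besov_bound \<beta> p ((\<integral>t. bnorm (u t) \<partial>I01) + e) (mean_modulus (s j))"
    proof (rule besov_bound_mono[OF z p _ le])
      show "0 \<le> (\<integral>t. bnorm (s j t) \<partial>I01)" by simp
      show "0 \<le> mean_modulus (s j) t \<and> mean_modulus (s j) t \<le> mean_modulus (s j) t" if "0 < t" for t
        using modulus_nonneg[OF m, of t] that by simp
    qed
  next
    fix \<tau> :: real
    have si: "integrable I01 (\<lambda>t. eta_real n (s j t) \<tau>)" for j
    proof (rule Bochner_Integration.integrable_bound)
      show "integrable I01 (\<lambda>t. 4 * bnorm (s j t))" using simple_bnorm_integrable[OF s(1,2)] by simp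
      show "(\<lambda>t. eta_real n (s j t) \<tau>) \<in> borel_measurable I01"
        by (rule simple_compose_measurable[OF s(1,2), where F="\<lambda>g t. eta_real n g \<tau>"]) auto
      show "AE t in I01. norm (eta_real n (s j t) \<tau>) \<le> norm (4 * bnorm (s j t))"
        by (rule AE_I2) (use eta_real_bnorm[OF s(2)] in auto)
    qed
    have "norm (mean_modulus (s j) \<tau> - mean_modulus u \<tau>) \<le> 4 * (e / real (Suc j))" for j
    proof -
      have "norm (\<integral>t. eta_real n (s j t) \<tau> - eta_real n (u t) \<tau> \<partial>I01) \<le> (\<integral>t. 4 * bnorm (u t - s j t) \<partial>I01)"
      proof (rule Bochner_Integration.integral_norm_bound_integral[OF
            Bochner_Integration.integrable_diff[OF si X_eta_real_integrable[OF u]] integrable_mult_right[OF s(3)]])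
        fix t assume "t \<in> space I01"
        then have t: "t \<in> {0..1}" by simp
        show "norm (eta_real n (s j t) \<tau> - eta_real n (u t) \<tau>) \<le> 4 * bnorm (u t - s j t)"
          using eta_real_abs[OF s(2)[OF t] X_V[OF u t], of j \<tau>] bnorm_swap[OF s(2)[OF t] X_V[OF u t], of j]
          unfolding real_norm_def by metis
      qed
      also have "\<dots> \<le> 4 * (e / real (Suc j))" using s(4)[of j] by simp
      finally show ?thesis by (simp add: mean_modulus_def si X_eta_real_integrable[OF u])
    qed
    then have le: "\<forall>\<^sub>F j in sequentially. norm (mean_modulus (s j) \<tau> - mean_modulus u \<tau>) \<le> 4 * (e * inverse (real (Suc j)))"
      by (simp only: divide_inverse eventually_True)
    have "(\<lambda>j. 4 * (e * inverse (real (Suc j)))) \<longlonglongrightarrow> 4 * (e * 0)"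
      by (intro tendsto_mult tendsto_const LIMSEQ_inverse_real_of_nat)
    then have "(\<lambda>j. 4 * (e * inverse (real (Suc j)))) \<longlonglongrightarrow> 0" by (simp only: mult_zero_right)
    from Lim_null_comparison[OF le this] have "(\<lambda>j. mean_modulus (s j) \<tau> - mean_modulus u \<tau>) \<longlonglongrightarrow> 0" .
    then show "(\<lambda>j. mean_modulus (s j) \<tau>) \<longlonglongrightarrow> mean_modulus u \<tau>" by (simp add: LIM_zero_iff)
  qed
qed (auto intro!: integral_nonneg_AE)

end

section \<open>Flows of time-dependent vector fields\<close>

abbreviation lint :: "real \<Rightarrow> real \<Rightarrow> (real \<Rightarrow> 'b::euclidean_space) \<Rightarrow> 'b" where
  "lint a b f \<equiv> integral\<^sup>L (lebesgue_on {a..b}) f"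

lemma lint_same [simp]: "integral\<^sup>L (lebesgue_on {a::real}) f = (0::'b::euclidean_space)"
proof -
  have "AE x in lebesgue. x \<notin> {a}" by (rule AE_not_in) simp
  then have "AE x in lebesgue. indicat_real {a} x *\<^sub>R f x = 0" by eventually_elim simp
  then show ?thesis by (subst integral_restrict_space) (simp_all add: integral_eq_zero_AE)
qed

lemma integrable_sub:
  fixes f :: "real \<Rightarrow> 'b::euclidean_space"
  assumes "integrable (lebesgue_on {0..1}) f" "0 \<le> a" "b \<le> 1"
  shows "integrable (lebesgue_on {a..b}) f"
  by (rule Equivalence_Lebesgue_Henstock_Integration.integrable_subinterval[OF assms(1)]) (use assms in auto)

lemma lint_combine:
  fixes f :: "real \<Rightarrow> 'b::euclidean_space"
  assumes "integrable (lebesgue_on {a..c}) f" "a \<le> b" "b \<le> c"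
  shows "lint a c f = lint a b f + lint b c f"
  by (rule Equivalence_Measurable_On_Borel.integral_combine[OF assms])

lemma lint_nonneg: "(\<And>s. s \<in> {a..b} \<Longrightarrow> 0 \<le> f s) \<Longrightarrow> 0 \<le> lint a b (f :: real \<Rightarrow> real)"
  by (rule integral_nonneg_AE) (auto intro: AE_I2)

lemma lint_mono:
  fixes f g :: "real \<Rightarrow> real"
  assumes "integrable (lebesgue_on {a..b}) f" "integrable (lebesgue_on {a..b}) g" "\<And>s. s \<in> {a..b} \<Longrightarrow> f s \<le> g s"
  shows "lint a b f \<le> lint a b g"
  by (rule integral_mono[OF assms(1,2)]) (use assms(3) in auto)

lemma lint_norm_le:
  fixes f :: "real \<Rightarrow> 'b::euclidean_space"
  assumes "integrable (lebesgue_on {a..b}) f" "integrable (lebesgue_on {a..b}) g" "\<And>s. s \<in> {a..b} \<Longrightarrow> norm (f s) \<le> g s"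
  shows "norm (lint a b f) \<le> lint a b g"
  by (rule Bochner_Integration.integral_norm_bound_integral[OF assms(1,2)]) (use assms(3) in auto)

lemma lint_sub_le:
  fixes f :: "real \<Rightarrow> real"
  assumes i: "integrable (lebesgue_on {0..1}) f" and "0 \<le> a" "a \<le> b" "b \<le> 1" "\<And>s. s \<in> {0..1} \<Longrightarrow> 0 \<le> f s"
  shows "lint a b f \<le> lint 0 1 f"
proof -
  have "lint 0 1 f = lint 0 a f + lint a 1 f" using assms by (intro lint_combine i) auto
  moreover have "lint a 1 f = lint a b f + lint b 1 f" using assms by (intro lint_combine integrable_sub[OF i]) auto
  moreover have "0 \<le> lint 0 a f" "0 \<le> lint b 1 f" using assms by (auto intro!: lint_nonneg)
  ultimately show ?thesis by linarith
qed

primrec gronwall_const :: "nat \<Rightarrow> real" where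
  "gronwall_const 0 = 1" | "gronwall_const (Suc k) = 2 * (gronwall_const k + 1)"

lemma gronwall_const_ge_1: "1 \<le> gronwall_const k" by (induction k) auto

lemma lint_level:
  fixes m :: "real \<Rightarrow> real"
  assumes m: "integrable (lebesgue_on {0..1}) m" and T: "0 \<le> T" "T \<le> 1" and y: "0 \<le> y" "y \<le> lint 0 T m"
  obtains a where "0 \<le> a" "a \<le> T" "lint 0 a m = y"
proof -
  have "continuous_on {0..T} (\<lambda>x. lint 0 x m)"
    by (rule indefinite_integral_continuous_real[OF integrable_sub[OF m]]) (use T in auto)
  from IVT'[OF _ y(2) T(1) this] y(1) show ?thesis using that by auto
qed

text \<open>No measurability of \<open>f\<close> is assumed, so its increments are bounded through a
  supremum \<open>S\<close> rather than an integral of \<open>f\<close>. On an interval where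
  \<open>m\<close> has integral at most 1/2 this gives \<open>S \<le> f a + c + S / 2\<close>, hence
  \<open>S \<le> 2 * (f a + c)\<close>; \<open>k\<close> counts such intervals.\<close>

lemma gronwall:
  fixes f m :: "real \<Rightarrow> real"
  assumes m: "integrable (lebesgue_on {0..1}) m"
    and f0: "\<And>t. t \<in> {0..1} \<Longrightarrow> 0 \<le> f t" and fB: "\<And>t. t \<in> {0..1} \<Longrightarrow> f t \<le> B" and c: "0 \<le> c"
    and m0: "\<And>t. t \<in> {0..1} \<Longrightarrow> 0 \<le> m t"
    and st: "\<And>a b S. 0 \<le> a \<Longrightarrow> a \<le> b \<Longrightarrow> b \<le> 1 \<Longrightarrow> (\<And>s. s \<in> {a..b} \<Longrightarrow> f s \<le> S) \<Longrightarrow> f b \<le> f a + c + lint a b m * S"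
  shows "T \<in> {0..1} \<Longrightarrow> lint 0 T m \<le> real k / 2 \<Longrightarrow> f T \<le> gronwall_const k * (f 0 + c)"
proof (induction k arbitrary: T)
  case 0
  then have "lint 0 T m = 0" using lint_nonneg[of 0 T m] m0 by fastforce
  with st[of 0 T B] 0 fB have "f T \<le> f 0 + c" by auto
  then show ?case by simp
next
  case (Suc k)
  have fc: "0 \<le> f 0 + c" using f0[of 0] c by simp
  show ?case
  proof (cases "lint 0 T m \<le> real k / 2")
    case True
    have "f T \<le> gronwall_const k * (f 0 + c)" using Suc True by blast
    also have "\<dots> \<le> gronwall_const (Suc k) * (f 0 + c)" using gronwall_const_ge_1[of k] fc by (intro mult_right_mono) auto
    finally show ?thesis .
  next
    case False
    have T: "0 \<le> T" "T \<le> 1" using Suc.prems by auto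
    obtain a where a: "0 \<le> a" "a \<le> T" "lint 0 a m = real k / 2"
      by (rule lint_level[OF m T, of "real k / 2"]) (use False in auto)
    have fa: "f a \<le> gronwall_const k * (f 0 + c)" using Suc.IH[of a] a T by auto
    define S where "S = Sup (f ` {a..T})"
    have bdd: "bdd_above (f ` {a..T})" using fB a T by (intro bdd_aboveI2[of _ _ B]) auto
    have S: "f s \<le> S" if "s \<in> {a..T}" for s unfolding S_def using bdd that by (intro cSup_upper) auto
    have S0: "0 \<le> S" using S[of a] f0[of a] a T by auto
    have "f s \<le> f a + c + S / 2" if s: "s \<in> {a..T}" for s
    proof -
      have "f s \<le> f a + c + lint a s m * S" using s a T S by (intro st) auto
      moreover have "lint a s m \<le> 1 / 2"
      proof -
        have "lint 0 T m = lint 0 a m + lint a T m" using a T by (intro lint_combine integrable_sub[OF m]) auto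
        moreover have "lint a T m = lint a s m + lint s T m" using s a T by (intro lint_combine integrable_sub[OF m]) auto
        moreover have "0 \<le> lint s T m" using s a T m0 by (intro lint_nonneg) auto
        ultimately show ?thesis using Suc.prems(2) a(3) by (simp add: field_simps)
      qed
      ultimately show ?thesis using mult_right_mono[of "lint a s m" "1 / 2" S] S0 by simp
    qed
    then have "S \<le> f a + c + S / 2" unfolding S_def using a by (intro cSup_least) auto
    then have "f T \<le> 2 * (f a + c)" using S[of T] a by simp
    also have "\<dots> \<le> 2 * (gronwall_const k * (f 0 + c) + (f 0 + c))" using fa f0[of 0] by simp
    finally show ?thesis by (simp add: algebra_simps)
  qed
qed

text \<open>Keeps of a field only what the integral equation and the class estimates use. The Besov
  norm is absent, and as a predicate the locale lets constants be chosen before the field is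
  given.\<close>

locale caratheodory_field =
  fixes \<gamma> :: real and n :: nat and w :: "real \<Rightarrow> 'a::euclidean_space \<Rightarrow> 'a" and m :: "real \<Rightarrow> real" and h :: "real \<Rightarrow> real \<Rightarrow> real"
  assumes \<gamma>: "0 < \<gamma>" "\<gamma> \<le> 1" and n: "2 \<le> n"
    and w: "\<And>t. t \<in> {0..1} \<Longrightarrow> cls \<gamma> n (m t) (h t) (w t)"
    and h: "\<And>t. t \<in> {0..1} \<Longrightarrow> modulus (h t)"
    and im: "integrable (lebesgue_on {0..1}) m"
    and ih: "\<And>\<tau>. 0 \<le> \<tau> \<Longrightarrow> integrable (lebesgue_on {0..1}) (\<lambda>t. h t \<tau>)"
    and ms: "\<And>\<xi>. continuous_on {0..1} \<xi> \<Longrightarrow> (\<lambda>t. w t (\<xi> t)) \<in> borel_measurable (lebesgue_on {0..1})"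
begin

lemma \<gamma>0: "0 \<le> \<gamma>" using \<gamma> by simp

lemma m_nonneg: "t \<in> {0..1} \<Longrightarrow> 0 \<le> m t" using cls_nonneg[OF w] .

lemma w_bound: "t \<in> {0..1} \<Longrightarrow> norm (w t x) \<le> m t" using cls_bound[OF w] .

lemma w_lipschitz: assumes "t \<in> {0..1}" shows "norm (w t x - w t y) \<le> m t * norm (x - y)"
proof -
  obtain k where "n = Suc k" using n by (cases n) auto
  then show ?thesis using cls_lipschitz w[OF assms] by blast
qed

lemma w_measurable:
  assumes ab: "0 \<le> a" "a \<le> b" "b \<le> 1" and \<xi>: "continuous_on {a..b} \<xi>"
  shows "(\<lambda>t. w t (\<xi> t)) \<in> borel_measurable (lebesgue_on {a..b})"
proof -
  \<comment> \<open>Clamping time to \<open>{a..b}\<close> extends the path continuously to all of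
    \<open>{0..1}\<close>, where measurability is assumed.\<close>
  have "continuous_on {0..1} (\<lambda>t. \<xi> (max a (min b t)))"
    by (rule continuous_on_compose2[OF \<xi>]) (use ab in \<open>auto intro!: continuous_intros\<close>)
  from ms[OF this] have "(\<lambda>t. w t (\<xi> (max a (min b t)))) \<in> borel_measurable (lebesgue_on {0..1})" .
  then have "(\<lambda>t. w t (\<xi> (max a (min b t)))) \<in> borel_measurable (lebesgue_on {a..b})"
    by (rule measurable_restrict_mono) (use ab in auto)
  then show ?thesis by (rule measurable_cong[THEN iffD1, rotated]) auto
qed

lemma w_integrable:
  assumes ab: "0 \<le> a" "a \<le> b" "b \<le> 1" and \<xi>: "continuous_on {a..b} \<xi>"
  shows "integrable (lebesgue_on {a..b}) (\<lambda>t. w t (\<xi> t))"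
  by (rule Bochner_Integration.integrable_bound[OF integrable_sub[OF im ab(1,3)] w_measurable[OF ab \<xi>]])
    (rule AE_I2, use w_bound m_nonneg ab in force)

lemma im_sub: "0 \<le> a \<Longrightarrow> b \<le> 1 \<Longrightarrow> integrable (lebesgue_on {a..b}) m"
  by (rule integrable_sub[OF im])

definition sol :: "real \<Rightarrow> real \<Rightarrow> 'a \<Rightarrow> (real \<Rightarrow> 'a) \<Rightarrow> bool" where
  "sol a b x y \<longleftrightarrow> continuous_on {a..b} y \<and> (\<forall>t\<in>{a..b}. y t = x + lint a t (\<lambda>s. w s (y s)))"

lemma sol_increment:
  assumes y: "sol 0 1 x y" and ab: "0 \<le> a" "a \<le> b" "b \<le> 1"
  shows "y b = y a + lint a b (\<lambda>s. w s (y s))"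
proof -
  have "continuous_on {0..b} y" using y ab by (auto simp: sol_def intro: continuous_on_subset)
  then have "lint 0 b (\<lambda>s. w s (y s)) = lint 0 a (\<lambda>s. w s (y s)) + lint a b (\<lambda>s. w s (y s))"
    using ab by (intro lint_combine w_integrable) auto
  then show ?thesis using y ab by (auto simp: sol_def)
qed

lemma sol_unique:
  assumes y: "sol 0 1 x y" and z: "sol 0 1 x z" and t: "t \<in> {0..1}"
  shows "y t = z t"
proof -
  let ?f = "\<lambda>t. norm (y t - z t)"
  have cont: "continuous_on {0..1} y" "continuous_on {0..1} z" using y z by (auto simp: sol_def)
  have cf: "continuous_on {0..1} ?f" by (intro continuous_intros cont)
  obtain B where "\<forall>t\<in>{0..1}. ?f t \<le> B"
    using compact_continuous_image[OF cf compact_Icc, THEN compact_imp_bounded] by (auto simp: bounded_iff)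
  then have B: "?f t \<le> B" if "t \<in> {0..1}" for t using that by blast
  obtain k :: nat where k: "2 * lint 0 t m \<le> real k" using real_arch_simple by blast
  have "?f t \<le> gronwall_const k * (?f 0 + 0)"
  proof (rule gronwall[OF im _ B])
    fix a b S :: real assume ab: "0 \<le> a" "a \<le> b" "b \<le> 1" and S: "\<And>s. s \<in> {a..b} \<Longrightarrow> ?f s \<le> S"
    have iy: "integrable (lebesgue_on {a..b}) (\<lambda>s. w s (y s))" "integrable (lebesgue_on {a..b}) (\<lambda>s. w s (z s))"
      using ab by (auto intro!: w_integrable continuous_on_subset[OF cont(1)] continuous_on_subset[OF cont(2)])
    have "y b - z b = (y a - z a) + lint a b (\<lambda>s. w s (y s) - w s (z s))"
      using sol_increment[OF y ab] sol_increment[OF z ab] by (simp add: iy)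
    moreover have "norm (lint a b (\<lambda>s. w s (y s) - w s (z s))) \<le> lint a b (\<lambda>s. m s * S)"
    proof (rule lint_norm_le)
      fix s assume s: "s \<in> {a..b}"
      then have "norm (w s (y s) - w s (z s)) \<le> m s * ?f s" using ab by (intro w_lipschitz) auto
      also have "\<dots> \<le> m s * S" using s S m_nonneg ab by (intro mult_left_mono) auto
      finally show "norm (w s (y s) - w s (z s)) \<le> m s * S" .
    qed (use iy im_sub ab in auto)
    ultimately show "?f b \<le> ?f a + 0 + lint a b m * S"
      using norm_triangle_ineq[of "y a - z a" "lint a b (\<lambda>s. w s (y s) - w s (z s))"] by simp
  qed (use t k m_nonneg in auto)
  moreover have "y 0 = z 0" using y z by (simp add: sol_def)
  ultimately show ?thesis by simp
qed

definition Ah :: "real \<Rightarrow> real" where "Ah \<tau> = lint 0 1 (\<lambda>s. h s \<tau>)"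

lemma modulus_Ah: "modulus Ah"
  unfolding Ah_def by (rule modulus_integral[OF h ih])

primrec picard :: "real \<Rightarrow> nat \<Rightarrow> real \<Rightarrow> 'a \<Rightarrow> 'a" where
  "picard a 0 = (\<lambda>t x. x)"
| "picard a (Suc k) = (\<lambda>t x. x + lint a t (\<lambda>s. w s (picard a k s x)))"

lemma picard_continuous:
  assumes ab: "0 \<le> a" "a \<le> b" "b \<le> 1"
  shows "continuous_on {a..b} (\<lambda>t. picard a k t x)"
proof (induction k)
  case (Suc k)
  have "continuous_on {a..b} (\<lambda>t. lint a t (\<lambda>s. w s (picard a k s x)))"
    by (rule indefinite_integral_continuous_real[OF w_integrable[OF ab Suc]])
  then show ?case by (auto intro!: continuous_intros)
qed (simp add: continuous_intros)

lemma picard_integrable: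
  assumes "0 \<le> a" "a \<le> b" "b \<le> 1"
  shows "integrable (lebesgue_on {a..b}) (\<lambda>s. w s (picard a k s x))"
  by (rule w_integrable[OF assms picard_continuous[OF assms]])

text \<open>The radius 1 gives \<open>near_id 3\<close>. The modulus is the fixed point of
  \<open>K \<mapsto> C * Ah + (K + cap_power \<gamma>) / 2\<close>, which bounds one Picard step
  once \<open>C * lint a b m \<le> 1 / 2\<close>. The composition estimate is a hypothesis so that
  \<open>C\<close> precedes the field.\<close>

lemma picard_cls:
  assumes C1: "\<And>(f::'a \<Rightarrow> 'a) \<phi> M H K. cls \<gamma> n M H f \<Longrightarrow> modulus H \<Longrightarrow> cls \<gamma> n 1 K \<phi> \<Longrightarrow> near_id 3 \<phi> \<Longrightarrow>
      cls \<gamma> n (C * M) (\<lambda>t. C * (H t + M * K t + M * cap_power \<gamma> t)) (\<lambda>x. f (x + \<phi> x))" "1 \<le> C"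
    and ab: "0 \<le> a" "a \<le> b" "b \<le> 1" and small: "C * lint a b m \<le> 1 / 2"
  shows "t \<in> {a..b} \<Longrightarrow> cls \<gamma> n 1 (\<lambda>\<tau>. 2 * C * Ah \<tau> + cap_power \<gamma> \<tau>) (\<lambda>x. picard a k t x - x)"
proof (induction k arbitrary: t)
  case 0
  have "cls \<gamma> n 1 (\<lambda>_. 0) (\<lambda>_::'a. 0::'a)" by (rule cls_const) simp
  then have "cls \<gamma> n 1 (\<lambda>\<tau>. 2 * C * Ah \<tau> + cap_power \<gamma> \<tau>) (\<lambda>_::'a. 0::'a)"
  proof (rule cls_mono)
    show "0 \<le> 2 * C * Ah \<tau> + cap_power \<gamma> \<tau>" if "0 \<le> \<tau>" for \<tau>
      using mult_nonneg_nonneg[of "2 * C" "Ah \<tau>"] modulus_nonneg[OF modulus_Ah that] C1(2) cap_power_nonneg[of \<gamma> \<tau>] by linarith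
  qed simp
  then show ?case by simp
next
  case (Suc k)
  let ?K = "\<lambda>\<tau>. 2 * C * Ah \<tau> + cap_power \<gamma> \<tau>"
  have t: "a \<le> t" "t \<le> 1" using Suc.prems ab by auto
  let ?N = "lebesgue_on {a..t}"
  have c: "cls \<gamma> n (C * m s) (\<lambda>\<tau>. C * (h s \<tau> + m s * ?K \<tau> + m s * cap_power \<gamma> \<tau>)) (\<lambda>x. w s (picard a k s x))"
    if s: "s \<in> space ?N" for s
  proof -
    have s': "s \<in> {a..b}" "s \<in> {0..1}" using s ab Suc.prems by auto
    have IH: "cls \<gamma> n 1 ?K (\<lambda>x. picard a k s x - x)" by (rule Suc.IH[OF s'(1)])
    have "near_id 3 (\<lambda>x. picard a k s x - x)" using cls_near_id[OF IH n] by simp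
    from C1(1)[OF w[OF s'(2)] h[OF s'(2)] IH this] show ?thesis by simp
  qed
  have ih': "integrable ?N (\<lambda>s. h s \<tau>)" if "0 \<le> \<tau>" for \<tau>
    by (rule integrable_sub[OF ih[OF that] ab(1) t(2)])
  have im': "integrable ?N m" by (rule im_sub[OF ab(1) t(2)])
  have iK: "integrable ?N (\<lambda>s. C * (h s \<tau> + m s * ?K \<tau> + m s * cap_power \<gamma> \<tau>))" if "0 \<le> \<tau>" for \<tau>
    by (intro integrable_mult_right Bochner_Integration.integrable_add integrable_mult_left ih'[OF that] im')
  have "cls \<gamma> n (\<integral>s. C * m s \<partial>?N) (\<lambda>\<tau>. \<integral>s. C * (h s \<tau> + m s * ?K \<tau> + m s * cap_power \<gamma> \<tau>) \<partial>?N)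
      (\<lambda>x. \<integral>s. w s (picard a k s x) \<partial>?N)"
  proof (rule cls_integral[OF \<gamma> _ _ iK c c])
    show "(\<lambda>s. w s (picard a k s x)) \<in> borel_measurable ?N" for x
      by (rule borel_measurable_integrable[OF picard_integrable[OF ab(1) t]])
  qed (use im' in auto)
  then have "cls \<gamma> n 1 ?K (\<lambda>x. \<integral>s. w s (picard a k s x) \<partial>?N)"
  proof (rule cls_mono)
    have mb: "lint a t m \<le> lint a b m"
    proof -
      have "lint a b m = lint a t m + lint t b m" using Suc.prems ab by (intro lint_combine im_sub) auto
      moreover have "0 \<le> lint t b m" using Suc.prems ab m_nonneg by (intro lint_nonneg) auto
      ultimately show ?thesis by simp
    qed
    have "C * lint a t m \<le> C * lint a b m" using C1(2) by (intro mult_left_mono mb) simp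
    then have Cm: "C * lint a t m \<le> 1 / 2" using small by linarith
    then show "(\<integral>s. C * m s \<partial>?N) \<le> 1" by simp
    fix \<tau> :: real assume \<tau>: "0 \<le> \<tau>"
    have hA: "lint a t (\<lambda>s. h s \<tau>) \<le> Ah \<tau>" unfolding Ah_def
      using ab t modulus_nonneg[OF h \<tau>] by (intro lint_sub_le ih \<tau>) auto
    have Kn: "0 \<le> ?K \<tau> + cap_power \<gamma> \<tau>"
      using mult_nonneg_nonneg[of "2 * C" "Ah \<tau>"] modulus_nonneg[OF modulus_Ah \<tau>] C1(2) cap_power_nonneg[of \<gamma> \<tau>] by linarith
    have "(\<integral>s. C * (h s \<tau> + m s * ?K \<tau> + m s * cap_power \<gamma> \<tau>) \<partial>?N) = C * (lint a t (\<lambda>s. h s \<tau>) + lint a t m * ?K \<tau> + lint a t m * cap_power \<gamma> \<tau>)"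
      using ih'[OF \<tau>] im' by simp
    also have "\<dots> = C * lint a t (\<lambda>s. h s \<tau>) + (C * lint a t m) * (?K \<tau> + cap_power \<gamma> \<tau>)"
      by (simp add: algebra_simps)
    also have "\<dots> \<le> C * Ah \<tau> + 1 / 2 * (?K \<tau> + cap_power \<gamma> \<tau>)"
      using hA C1(2) Cm Kn by (intro add_mono mult_left_mono mult_right_mono) auto
    also have "\<dots> = ?K \<tau>" by simp
    finally show "(\<integral>s. C * (h s \<tau> + m s * ?K \<tau> + m s * cap_power \<gamma> \<tau>) \<partial>?N) \<le> ?K \<tau>" .
  qed
  then show ?case by simp
qed

text \<open>As \<open>m\<close> has integral at most 1/2 over the interval, successive iterates
  differ by at most \<open>(1 / 2) ^ k\<close>, so they converge uniformly in time. The class common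
  to all iterates passes to the limit by \<open>cls_limit\<close>; convergence of derivatives need
  not be estimated.\<close>

lemma short_flow:
  assumes C1: "\<And>(f::'a \<Rightarrow> 'a) \<phi> M H K. cls \<gamma> n M H f \<Longrightarrow> modulus H \<Longrightarrow> cls \<gamma> n 1 K \<phi> \<Longrightarrow> near_id 3 \<phi> \<Longrightarrow>
      cls \<gamma> n (C * M) (\<lambda>t. C * (H t + M * K t + M * cap_power \<gamma> t)) (\<lambda>x. f (x + \<phi> x))" "1 \<le> C"
    and ab: "0 \<le> a" "a \<le> b" "b \<le> 1" and small: "C * lint a b m \<le> 1 / 2"
  shows "\<exists>P. (\<forall>x. sol a b x (\<lambda>t. P t x)) \<and>
    (\<forall>t\<in>{a..b}. cls \<gamma> n 1 (\<lambda>\<tau>. 2 * C * Ah \<tau> + cap_power \<gamma> \<tau>) (\<lambda>x. P t x - x))"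
proof -
  have K0: "0 \<le> lint a b m" using ab m_nonneg by (intro lint_nonneg) auto
  have K: "lint a b m \<le> 1 / 2" using mult_right_mono[OF C1(2) K0] small by simp
  have Kt: "lint a t m \<le> 1 / 2" if "t \<in> {a..b}" for t
  proof -
    have "lint a b m = lint a t m + lint t b m" using that ab by (intro lint_combine im_sub) auto
    moreover have "0 \<le> lint t b m" using that ab m_nonneg by (intro lint_nonneg) auto
    ultimately show ?thesis using K by simp
  qed
  let ?d = "\<lambda>k t x. picard a (Suc k) t x - picard a k t x"
  have d: "norm (?d k t x) \<le> (1 / 2) ^ k" if "t \<in> {a..b}" for k t x
    using that
  proof (induction k arbitrary: t)
    case 0
    have "norm (lint a t (\<lambda>s. w s x)) \<le> lint a t m"
      using 0 ab w_bound picard_integrable[of a t 0 x] by (intro lint_norm_le im_sub) auto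
    then show ?case using Kt[OF 0] by simp
  next
    case (Suc k)
    have t: "0 \<le> a" "a \<le> t" "t \<le> 1" using Suc.prems ab by auto
    note i = picard_integrable[OF t]
    have "norm (lint a t (\<lambda>s. w s (picard a (Suc k) s x) - w s (picard a k s x))) \<le> lint a t (\<lambda>s. m s * (1 / 2) ^ k)"
    proof (rule lint_norm_le[OF Bochner_Integration.integrable_diff[OF i i]])
      show "integrable (lebesgue_on {a..t}) (\<lambda>s. m s * (1 / 2) ^ k)" using im_sub[OF t(1,3)] by simp
      fix s assume s: "s \<in> {a..t}"
      then have "norm (w s (picard a (Suc k) s x) - w s (picard a k s x)) \<le> m s * norm (?d k s x)"
        using t by (intro w_lipschitz) auto
      also have "\<dots> \<le> m s * (1 / 2) ^ k"
        using s t Suc.prems m_nonneg by (intro mult_left_mono Suc.IH) auto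
      finally show "norm (w s (picard a (Suc k) s x) - w s (picard a k s x)) \<le> m s * (1 / 2) ^ k" .
    qed
    also have "\<dots> \<le> 1 / 2 * (1 / 2) ^ k" using Kt[OF Suc.prems] by (simp add: mult_right_mono)
    also have "lint a t (\<lambda>s. w s (picard a (Suc k) s x) - w s (picard a k s x)) = ?d (Suc k) t x"
      using Bochner_Integration.integral_diff[OF i i, of "Suc k" x k x] by simp
    finally show ?case by simp
  qed
  define P where "P t x = x + (\<Sum>k. ?d k t x)" for t x
  have ul: "uniform_limit {a..b} (\<lambda>k t. picard a k t x) (\<lambda>t. P t x) sequentially" for x
  proof -
    have "uniform_limit {a..b} (\<lambda>N t. \<Sum>k<N. ?d k t x) (\<lambda>t. \<Sum>k. ?d k t x) sequentially"
      by (rule Weierstrass_m_test[OF d]) (auto intro: summable_geometric)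
    from uniform_limit_add[OF uniform_limit_const this, of "\<lambda>t. x"]
    have "uniform_limit {a..b} (\<lambda>N t. x + (\<Sum>k<N. ?d k t x)) (\<lambda>t. P t x) sequentially"
      unfolding P_def .
    moreover have "x + (\<Sum>k<N. ?d k t x) = picard a N t x" for N t
      using sum_lessThan_telescope[of "\<lambda>k. picard a k t x" N] by simp
    ultimately show ?thesis by simp
  qed
  have lim: "(\<lambda>k. picard a k t x) \<longlonglongrightarrow> P t x" if "t \<in> {a..b}" for t x
    by (rule tendsto_uniform_limitI[OF ul that])
  have cont: "continuous_on {a..b} (\<lambda>t. P t x)" for x
    by (rule uniform_limit_theorem[OF _ ul]) (use picard_continuous[OF ab] in auto)
  have "P t x = x + lint a t (\<lambda>s. w s (P s x))" if t: "t \<in> {a..b}" for t x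
  proof -
    have t': "0 \<le> a" "a \<le> t" "t \<le> 1" using t ab by auto
    have "(\<lambda>k. lint a t (\<lambda>s. w s (picard a k s x))) \<longlonglongrightarrow> lint a t (\<lambda>s. w s (P s x))"
    proof (rule integral_dominated_convergence)
      show "integrable (lebesgue_on {a..t}) m" by (rule im_sub[OF t'(1,3)])
      show "(\<lambda>s. w s (P s x)) \<in> borel_measurable (lebesgue_on {a..t})"
        using t by (intro w_measurable[OF t'] continuous_on_subset[OF cont]) auto
      show "(\<lambda>s. w s (picard a k s x)) \<in> borel_measurable (lebesgue_on {a..t})" for k
        by (rule borel_measurable_integrable[OF picard_integrable[OF t']])
      show "AE s in lebesgue_on {a..t}. norm (w s (picard a k s x)) \<le> m s" for k
        by (rule AE_I2) (use w_bound t' in auto)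
      show "AE s in lebesgue_on {a..t}. (\<lambda>k. w s (picard a k s x)) \<longlonglongrightarrow> w s (P s x)"
      proof (rule AE_I2)
        fix s assume "s \<in> space (lebesgue_on {a..t})"
        then have s: "s \<in> {a..b}" "s \<in> {0..1}" using t t' by auto
        have "(\<lambda>k. m s * norm (picard a k s x - P s x)) \<longlonglongrightarrow> m s * 0"
          by (intro tendsto_mult tendsto_const tendsto_norm_zero LIM_zero lim[OF s(1)])
        then have l: "(\<lambda>k. m s * norm (picard a k s x - P s x)) \<longlonglongrightarrow> 0" by (simp only: mult_zero_right)
        have "\<forall>\<^sub>F k in sequentially. norm (w s (picard a k s x) - w s (P s x)) \<le> m s * norm (picard a k s x - P s x)"
          by (intro always_eventually allI w_lipschitz[OF s(2)])
        from Lim_null_comparison[OF this l] have "(\<lambda>k. w s (picard a k s x) - w s (P s x)) \<longlonglongrightarrow> 0" .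
        then show "(\<lambda>k. w s (picard a k s x)) \<longlonglongrightarrow> w s (P s x)" by (simp add: LIM_zero_iff)
      qed
    qed
    then have "(\<lambda>k. picard a (Suc k) t x) \<longlonglongrightarrow> x + lint a t (\<lambda>s. w s (P s x))"
      by (auto intro!: tendsto_intros)
    from LIMSEQ_unique[OF LIMSEQ_Suc[OF lim[OF t]] this] show ?thesis .
  qed
  then have "\<forall>x. sol a b x (\<lambda>t. P t x)" using cont by (simp add: sol_def)
  moreover have "cls \<gamma> n 1 (\<lambda>\<tau>. 2 * C * Ah \<tau> + cap_power \<gamma> \<tau>) (\<lambda>x. P t x - x)" if t: "t \<in> {a..b}" for t
    by (rule cls_limit[OF \<gamma> picard_cls[OF C1 ab small t]]) (auto intro!: tendsto_intros lim t)
  ultimately show ?thesis by blast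
qed

lemma sol_append:
  assumes y: "sol 0 c x y" and z: "sol c T (y c) z" and c: "0 \<le> c" "c \<le> T" "T \<le> 1"
  shows "sol 0 T x (\<lambda>t. if t \<le> c then y t else z t)"
proof -
  let ?q = "\<lambda>t. if t \<le> c then y t else z t"
  have zc: "z c = y c" using z c by (simp add: sol_def)
  have "continuous_on ({0..c} \<union> {c..T}) ?q"
    using y z zc by (intro continuous_on_If) (auto simp: sol_def)
  moreover have "{0..c} \<union> {c..T} = {0..T}" using c by auto
  ultimately have cont: "continuous_on {0..T} ?q" by simp
  have "?q t = x + lint 0 t (\<lambda>s. w s (?q s))" if t: "t \<in> {0..T}" for t
  proof (cases "t \<le> c")
    case True
    have "lint 0 t (\<lambda>s. w s (?q s)) = lint 0 t (\<lambda>s. w s (y s))"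
      by (rule Bochner_Integration.integral_cong) (use True in auto)
    then show ?thesis using True t y by (simp add: sol_def)
  next
    case False
    have "lint 0 t (\<lambda>s. w s (?q s)) = lint 0 c (\<lambda>s. w s (?q s)) + lint c t (\<lambda>s. w s (?q s))"
      using False t c by (intro lint_combine w_integrable continuous_on_subset[OF cont]) auto
    also have "lint 0 c (\<lambda>s. w s (?q s)) = lint 0 c (\<lambda>s. w s (y s))"
      by (rule Bochner_Integration.integral_cong) auto
    also have "lint c t (\<lambda>s. w s (?q s)) = lint c t (\<lambda>s. w s (z s))"
      by (rule Bochner_Integration.integral_cong) (use zc in auto)
    finally have "lint 0 t (\<lambda>s. w s (?q s)) = lint 0 c (\<lambda>s. w s (y s)) + lint c t (\<lambda>s. w s (z s))" .
    moreover have "y c = x + lint 0 c (\<lambda>s. w s (y s))" using y c by (simp add: sol_def)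
    moreover have "z t = y c + lint c t (\<lambda>s. w s (z s))" using z False t by (simp add: sol_def)
    ultimately show ?thesis using False by (simp add: add.assoc)
  qed
  then show ?thesis using cont by (simp add: sol_def)
qed

end

text \<open>\<open>k\<close> bounds the number of short intervals by the mass. \<open>C1\<close>
  does not depend on \<open>k\<close> because every short flow starts afresh at the identity with
  radius 1; only the constant for composing with the flow up to the splitting time grows.\<close>

lemma flow_exists_of_small_mass:
  assumes \<gamma>: "0 < \<gamma>" "\<gamma> \<le> 1" and n: "2 \<le> n"
  shows "\<exists>C1\<ge>1. \<forall>k. \<exists>C\<ge>0. \<forall>(w::real \<Rightarrow> 'a::euclidean_space \<Rightarrow> 'a) m h T.
    caratheodory_field \<gamma> n w m h \<longrightarrow> T \<in> {0..1} \<longrightarrow> C1 * lint 0 T m \<le> real k / 2 \<longrightarrow>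
    (\<exists>P. (\<forall>x. caratheodory_field.sol w 0 T x (\<lambda>t. P t x)) \<and>
      (\<forall>t\<in>{0..T}. cls \<gamma> n C (\<lambda>\<tau>. C * (caratheodory_field.Ah h \<tau> + cap_power \<gamma> \<tau>)) (\<lambda>x. P t x - x)))"
proof -
  have \<gamma>0: "0 \<le> \<gamma>" using \<gamma> by simp
  obtain C1 where C1: "1 \<le> C1" and comp1: "\<And>(f::'a \<Rightarrow> 'a) \<phi> M H K. cls \<gamma> n M H f \<Longrightarrow> modulus H \<Longrightarrow> cls \<gamma> n 1 K \<phi> \<Longrightarrow> near_id 3 \<phi> \<Longrightarrow>
      cls \<gamma> n (C1 * M) (\<lambda>t. C1 * (H t + M * K t + M * cap_power \<gamma> t)) (\<lambda>x. f (x + \<phi> x))"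
    using cls_compose[OF \<gamma>0 \<gamma>(2), of 3 1 n, where 'a='a and 'b='a] by auto
  have "\<exists>C\<ge>0. \<forall>(w::real \<Rightarrow> 'a \<Rightarrow> 'a) m h T.
    caratheodory_field \<gamma> n w m h \<longrightarrow> T \<in> {0..1} \<longrightarrow> C1 * lint 0 T m \<le> real k / 2 \<longrightarrow>
    (\<exists>P. (\<forall>x. caratheodory_field.sol w 0 T x (\<lambda>t. P t x)) \<and>
      (\<forall>t\<in>{0..T}. cls \<gamma> n C (\<lambda>\<tau>. C * (caratheodory_field.Ah h \<tau> + cap_power \<gamma> \<tau>)) (\<lambda>x. P t x - x)))" for k :: nat
  proof (induction k)
    case 0
    have "\<exists>P. (\<forall>x. caratheodory_field.sol w 0 T x (\<lambda>t. P t x)) \<and>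
      (\<forall>t\<in>{0..T}. cls \<gamma> n (2 * C1) (\<lambda>\<tau>. 2 * C1 * (caratheodory_field.Ah h \<tau> + cap_power \<gamma> \<tau>)) (\<lambda>x. P t x - x))"
      if "caratheodory_field \<gamma> n w m h" and T: "T \<in> {0..1}" and le: "C1 * lint 0 T m \<le> real 0 / 2"
      for w :: "real \<Rightarrow> 'a \<Rightarrow> 'a" and m h T
    proof -
      interpret caratheodory_field \<gamma> n w m h by fact
      have sm: "C1 * lint 0 T m \<le> 1 / 2" using le by simp
      obtain P where P: "\<forall>x. sol 0 T x (\<lambda>t. P t x)"
        "\<forall>t\<in>{0..T}. cls \<gamma> n 1 (\<lambda>\<tau>. 2 * C1 * Ah \<tau> + cap_power \<gamma> \<tau>) (\<lambda>x. P t x - x)"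
      proof -
        have T': "0 \<le> T" "T \<le> 1" using T by auto
        show ?thesis using short_flow[OF comp1 C1 order.refl T' sm] that by blast
      qed
      have "cls \<gamma> n (2 * C1) (\<lambda>\<tau>. 2 * C1 * (Ah \<tau> + cap_power \<gamma> \<tau>)) (\<lambda>x. P t x - x)" if "t \<in> {0..T}" for t
      proof (rule cls_mono[OF P(2)[rule_format, OF that]])
        show "2 * C1 * Ah \<tau> + cap_power \<gamma> \<tau> \<le> 2 * C1 * (Ah \<tau> + cap_power \<gamma> \<tau>)" for \<tau>
          using mult_right_mono[of 1 "2 * C1" "cap_power \<gamma> \<tau>"] C1 by (simp add: distrib_left)
      qed (use C1 in simp)
      then show ?thesis using P(1) by blast
    qed
    then show ?case using C1 by (intro exI[of _ "2 * C1"] conjI allI impI) simp_all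
  next
    case (Suc k)
    then obtain C where C: "0 \<le> C" and IH: "\<And>(w::real \<Rightarrow> 'a \<Rightarrow> 'a) m h T.
      caratheodory_field \<gamma> n w m h \<Longrightarrow> T \<in> {0..1} \<Longrightarrow> C1 * lint 0 T m \<le> real k / 2 \<Longrightarrow>
      (\<exists>P. (\<forall>x. caratheodory_field.sol w 0 T x (\<lambda>t. P t x)) \<and>
      (\<forall>t\<in>{0..T}. cls \<gamma> n C (\<lambda>\<tau>. C * (caratheodory_field.Ah h \<tau> + cap_power \<gamma> \<tau>)) (\<lambda>x. P t x - x)))" by blast
    obtain C2 where C2: "1 \<le> C2" and comp2: "\<And>(f::'a \<Rightarrow> 'a) \<phi> M H K. cls \<gamma> n M H f \<Longrightarrow> modulus H \<Longrightarrow> cls \<gamma> n C K \<phi> \<Longrightarrow> near_id (1 + 2 * C) \<phi> \<Longrightarrow>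
      cls \<gamma> n (C2 * M) (\<lambda>t. C2 * (H t + M * K t + M * cap_power \<gamma> t)) (\<lambda>x. f (x + \<phi> x))"
      using cls_compose[OF \<gamma>0 \<gamma>(2), of "1 + 2 * C" C n, where 'a='a and 'b='a] C by auto
    \<comment> \<open>Inside the bracket, \<open>Ah\<close> needs \<open>2 * C1\<close> from the
      short flow and \<open>C\<close> from the flow before it; \<open>cap_power\<close> needs
      \<open>C + 2\<close>, from the same two moduli and the composition estimate.\<close>
    define D where "D = C + C2 * (2 * C1 + C + 2)"
    have D: "C \<le> D" "C + C2 \<le> D" "0 \<le> D"
    proof -
      have "C2 * 1 \<le> C2 * (2 * C1 + C + 2)" using C C1 C2 by (intro mult_left_mono) auto
      then show "C \<le> D" "C + C2 \<le> D" "0 \<le> D" using C C2 by (auto simp: D_def)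
    qed
    have "\<exists>P. (\<forall>x. caratheodory_field.sol w 0 T x (\<lambda>t. P t x)) \<and>
      (\<forall>t\<in>{0..T}. cls \<gamma> n D (\<lambda>\<tau>. D * (caratheodory_field.Ah h \<tau> + cap_power \<gamma> \<tau>)) (\<lambda>x. P t x - x))"
      if cf: "caratheodory_field \<gamma> n w m h" and T: "T \<in> {0..1}" and le: "C1 * lint 0 T m \<le> real (Suc k) / 2"
      for w :: "real \<Rightarrow> 'a \<Rightarrow> 'a" and m h T
    proof -
      interpret caratheodory_field \<gamma> n w m h by fact
      have AJ: "0 \<le> Ah \<tau> + cap_power \<gamma> \<tau>" if "0 \<le> \<tau>" for \<tau> using modulus_nonneg[OF modulus_Ah that] by simp
      \<comment> \<open>The splitting time: it carries \<open>C1\<close>-weighted mass exactly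
        \<open>k / 2\<close> if that much is available, and is \<open>T\<close> otherwise.\<close>
      obtain c where c: "0 \<le> c" "c \<le> T" "C1 * lint 0 c m \<le> real k / 2" "C1 * lint c T m \<le> 1 / 2"
      proof (cases "C1 * lint 0 T m \<le> real k / 2")
        case True
        then show ?thesis using that[of T] T by simp
      next
        case False
        obtain c where c: "0 \<le> c" "c \<le> T" "lint 0 c m = real k / 2 / C1"
          by (rule lint_level[OF im, of T "real k / 2 / C1"]) (use False T C1 in \<open>auto simp: field_simps\<close>)
        have "lint 0 T m = lint 0 c m + lint c T m" using c T by (intro lint_combine im_sub) auto
        then have "C1 * lint 0 T m = real k / 2 + C1 * lint c T m" using c(3) C1 by (simp add: distrib_left)
        then show ?thesis using that[of c] c le C1 by (simp add: field_simps)
      qed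
      obtain P where P: "\<forall>x. sol 0 c x (\<lambda>t. P t x)"
        "\<forall>t\<in>{0..c}. cls \<gamma> n C (\<lambda>\<tau>. C * (Ah \<tau> + cap_power \<gamma> \<tau>)) (\<lambda>x. P t x - x)"
      proof -
        have c': "c \<in> {0..1}" using c T by auto
        show ?thesis using IH[OF cf c' c(3)] that by blast
      qed
      obtain Q where Q: "\<forall>x. sol c T x (\<lambda>t. Q t x)"
        "\<forall>t\<in>{c..T}. cls \<gamma> n 1 (\<lambda>\<tau>. 2 * C1 * Ah \<tau> + cap_power \<gamma> \<tau>) (\<lambda>x. Q t x - x)"
      proof -
        have T': "T \<le> 1" using T by auto
        show ?thesis using short_flow[OF comp1 C1 c(1,2) T' c(4)] that by blast
      qed
      let ?R = "\<lambda>t x. if t \<le> c then P t x else Q t (P c x)"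
      have "sol 0 T x (\<lambda>t. ?R t x)" for x
        using P(1) Q(1) c T by (intro sol_append) auto
      moreover have "cls \<gamma> n D (\<lambda>\<tau>. D * (Ah \<tau> + cap_power \<gamma> \<tau>)) (\<lambda>x. ?R t x - x)" if t: "t \<in> {0..T}" for t
      proof (cases "t \<le> c")
        case True
        then have "cls \<gamma> n C (\<lambda>\<tau>. C * (Ah \<tau> + cap_power \<gamma> \<tau>)) (\<lambda>x. P t x - x)" using P(2) t by simp
        then have "cls \<gamma> n D (\<lambda>\<tau>. D * (Ah \<tau> + cap_power \<gamma> \<tau>)) (\<lambda>x. P t x - x)"
          by (rule cls_mono) (use D AJ in \<open>auto intro!: mult_right_mono\<close>)
        then show ?thesis using True by simp
      next
        case False
        let ?K = "\<lambda>\<tau>. 2 * C1 * Ah \<tau> + cap_power \<gamma> \<tau>"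
        have K: "modulus ?K" using C1 \<gamma>0 \<gamma>(2) by (intro modulus_add modulus_cmult modulus_Ah modulus_cap_power) auto
        have p: "cls \<gamma> n C (\<lambda>\<tau>. C * (Ah \<tau> + cap_power \<gamma> \<tau>)) (\<lambda>x. P c x - x)" using P(2) c by simp
        have q: "cls \<gamma> n 1 ?K (\<lambda>x. Q t x - x)" using Q(2) False t by simp
        \<comment> \<open>The displacement of \<open>Q t\<close> after \<open>P c\<close> is that of
          \<open>P c\<close> plus that of \<open>Q t\<close> evaluated at \<open>P c x\<close>,
          written as \<open>x + (P c x - x)\<close>.\<close>
        from cls_add[OF p comp2[OF q K p cls_near_id[OF p n]]]
        have "cls \<gamma> n (C + C2 * 1) (\<lambda>\<tau>. C * (Ah \<tau> + cap_power \<gamma> \<tau>) + C2 * (?K \<tau> + 1 * (C * (Ah \<tau> + cap_power \<gamma> \<tau>)) + 1 * cap_power \<gamma> \<tau>))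
          (\<lambda>x. P c x - x + (Q t (x + (P c x - x)) - (x + (P c x - x))))" .
        then have "cls \<gamma> n D (\<lambda>\<tau>. D * (Ah \<tau> + cap_power \<gamma> \<tau>)) (\<lambda>x. P c x - x + (Q t (x + (P c x - x)) - (x + (P c x - x))))"
        proof (rule cls_mono)
          show "C + C2 * 1 \<le> D" using D by simp
          fix \<tau> :: real assume \<tau>: "0 \<le> \<tau>"
          have "?K \<tau> + 1 * (C * (Ah \<tau> + cap_power \<gamma> \<tau>)) + 1 * cap_power \<gamma> \<tau> \<le> (2 * C1 + C + 2) * (Ah \<tau> + cap_power \<gamma> \<tau>)"
            using C1 modulus_nonneg[OF modulus_Ah \<tau>] by (simp add: algebra_simps)
          from mult_left_mono[OF this, of C2] C2
          show "C * (Ah \<tau> + cap_power \<gamma> \<tau>) + C2 * (?K \<tau> + 1 * (C * (Ah \<tau> + cap_power \<gamma> \<tau>)) + 1 * cap_power \<gamma> \<tau>) \<le> D * (Ah \<tau> + cap_power \<gamma> \<tau>)"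
            by (simp add: D_def algebra_simps)
        qed
        then show ?thesis using False by simp
      qed
      ultimately show ?thesis by (intro exI[of _ ?R] conjI allI ballI)
    qed
    then show ?case using D(3) by (intro exI[of _ D] conjI allI impI)
  qed
  then show ?thesis using C1 by blast
qed

section \<open>Continuity of the flow in the \<open>C\<^sup>n\<close>-norm\<close>

lemma lint_lebesgue:
  fixes f :: "real \<Rightarrow> 'b::euclidean_space"
  shows "lint a b f = (\<integral>s. indicator {a..b} s *\<^sub>R f s \<partial>lebesgue)"
  by (rule integral_restrict_space) simp

text \<open>The intervals in the definition of absolute continuity are disjoint only in their
  interiors, so the endpoints, a null set, are dropped.\<close>

lemma lint_open:
  fixes g :: "real \<Rightarrow> real"
  assumes g: "integrable (lebesgue_on {0..1}) g" and cd: "0 \<le> c" "d \<le> 1"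
  shows "lint c d g = (\<integral>s. indicat_real {c<..<d} s * g s \<partial>lebesgue)"
    and "integrable lebesgue (\<lambda>s. indicat_real {c<..<d} s * g s)"
proof -
  have "integrable lebesgue (\<lambda>s. indicat_real {0..1} s *\<^sub>R g s)"
    using g by (subst (asm) integrable_restrict_space) auto
  from integrable_mult_indicator[OF _ this, of "{c<..<d}"]
  have "integrable lebesgue (\<lambda>s. indicat_real {c<..<d} s *\<^sub>R (indicat_real {0..1} s *\<^sub>R g s))" by simp
  also have "(\<lambda>s. indicat_real {c<..<d} s *\<^sub>R (indicat_real {0..1} s *\<^sub>R g s)) = (\<lambda>s. indicat_real {c<..<d} s * g s)"
    using cd by (auto simp: indicator_def)
  finally show i: "integrable lebesgue (\<lambda>s. indicat_real {c<..<d} s * g s)" .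
  have "integrable lebesgue (\<lambda>s. indicat_real {c..d} s *\<^sub>R g s)"
    using integrable_sub[OF g cd] by (subst (asm) integrable_restrict_space) auto
  then have m: "(\<lambda>s. indicat_real {c..d} s *\<^sub>R g s) \<in> borel_measurable lebesgue" by (rule borel_measurable_integrable)
  have "AE s in lebesgue. s \<notin> {c}" "AE s in lebesgue. s \<notin> {d}" by (rule AE_not_in, simp)+
  then have "AE s in lebesgue. indicat_real {c..d} s *\<^sub>R g s = indicat_real {c<..<d} s * g s"
    by eventually_elim (auto simp: indicator_def)
  from integral_cong_AE[OF m borel_measurable_integrable[OF i] this]
  show "lint c d g = (\<integral>s. indicat_real {c<..<d} s * g s \<partial>lebesgue)" unfolding lint_lebesgue .
qed

lemma sum_lint_le:
  fixes g :: "real \<Rightarrow> real"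
  assumes g: "integrable (lebesgue_on {0..1}) g" "\<And>s. s \<in> {0..1} \<Longrightarrow> 0 \<le> g s"
    and D: "finite D" "\<forall>(c,d)\<in>D. 0 \<le> c \<and> c \<le> d \<and> d \<le> 1"
      "pairwise (\<lambda>(c,d) (c',d'). {c<..<d} \<inter> {c'<..<d'} = {}) D"
  shows "(\<Sum>(c,d)\<in>D. lint c d g) \<le> lint 0 1 g"
proof -
  let ?i = "\<lambda>e s. indicat_real {fst e<..<snd e} s * g s"
  have i: "lint (fst e) (snd e) g = (\<integral>s. ?i e s \<partial>lebesgue)" "integrable lebesgue (?i e)" if "e \<in> D" for e
    using lint_open[OF g(1), of "fst e" "snd e"] D(2) that by auto
  have i1: "integrable lebesgue (\<lambda>s. indicat_real {0..1} s *\<^sub>R g s)"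
    using g(1) by (subst (asm) integrable_restrict_space) auto
  have "(\<Sum>(c,d)\<in>D. lint c d g) = (\<Sum>e\<in>D. \<integral>s. ?i e s \<partial>lebesgue)"
    using i by (intro sum.cong) (auto simp: case_prod_unfold)
  also have "\<dots> = (\<integral>s. (\<Sum>e\<in>D. ?i e s) \<partial>lebesgue)"
    using i by (intro Bochner_Integration.integral_sum[symmetric]) auto
  also have "\<dots> \<le> (\<integral>s. indicat_real {0..1} s *\<^sub>R g s \<partial>lebesgue)"
  proof (rule integral_mono[OF Bochner_Integration.integrable_sum[OF i(2)] i1])
    fix s :: real
    show "(\<Sum>e\<in>D. ?i e s) \<le> indicat_real {0..1} s *\<^sub>R g s"
    proof (cases "\<exists>e\<in>D. s \<in> {fst e<..<snd e}")
      case True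
      then obtain e where e: "e \<in> D" "s \<in> {fst e<..<snd e}" by blast
      have "s \<notin> {fst e'<..<snd e'}" if "e' \<in> D - {e}" for e'
        using pairwiseD[OF D(3), of e e'] e that by (auto simp: case_prod_unfold)
      then have "?i e' s = (if e' = e then g s else 0)" if "e' \<in> D" for e'
        using e that by (auto simp: indicator_def)
      then have "(\<Sum>e'\<in>D. ?i e' s) = (\<Sum>e'\<in>D. if e' = e then g s else 0)" by (intro sum.cong) auto
      then have "(\<Sum>e'\<in>D. ?i e' s) = g s" using e(1) D(1) by (simp only: sum.delta' sum.delta if_True)
      moreover have "s \<in> {0..1}" using e D(2) by fastforce
      ultimately show ?thesis using e by simp
    next
      case False
      then have "(\<Sum>e\<in>D. ?i e s) = 0" by (intro sum.neutral) (auto simp: indicator_def)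
      then show ?thesis using g(2) by (auto simp: indicator_def)
    qed
  qed
  finally show ?thesis unfolding lint_lebesgue .
qed

text \<open>Truncation: \<open>m\<close> exceeds its cut-off at a suitable level \<open>j\<close> by
  a function of integral below \<open>e / 2\<close>, and the cut-off part contributes at most
  \<open>j\<close> times the total length.\<close>

lemma abs_continuous_lint:
  fixes m :: "real \<Rightarrow> real"
  assumes m: "integrable (lebesgue_on {0..1}) m" "\<And>s. s \<in> {0..1} \<Longrightarrow> 0 \<le> m s"
    and y: "\<And>c d. 0 \<le> c \<Longrightarrow> c \<le> d \<Longrightarrow> d \<le> 1 \<Longrightarrow> norm (y d - y c) \<le> lint c d m"
  shows "abs_continuous_on_interval 0 1 y"
  unfolding abs_continuous_on_interval_def
proof (intro allI impI)
  fix e :: real assume e: "0 < e"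
  have mb[measurable]: "m \<in> borel_measurable (lebesgue_on {0..1})" using m(1) by (rule borel_measurable_integrable)
  have im: "integrable (lebesgue_on {0..1}) (\<lambda>s. min (m s) (real j))" for j
    by (rule Bochner_Integration.integrable_bound[OF m(1)]) (use m(2) in \<open>auto intro!: AE_I2\<close>)
  have "(\<lambda>j. lint 0 1 (\<lambda>s. min (m s) (real j))) \<longlonglongrightarrow> lint 0 1 m"
  proof (rule integral_dominated_convergence[OF mb _ m(1)])
    show "AE s in lebesgue_on {0..1}. (\<lambda>j. min (m s) (real j)) \<longlonglongrightarrow> m s"
    proof (rule AE_I2)
      fix s
      have "\<forall>\<^sub>F j in sequentially. min (m s) (real j) = m s"
        using eventually_ge_at_top[of "nat \<lceil>m s\<rceil>"] by eventually_elim (simp add: min_def nat_le_iff ceiling_le_iff)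
      then show "(\<lambda>j. min (m s) (real j)) \<longlonglongrightarrow> m s" by (rule tendsto_eventually)
    qed
    show "AE s in lebesgue_on {0..1}. norm (min (m s) (real j)) \<le> m s" for j
      by (rule AE_I2) (use m(2) in auto)
  qed simp
  from LIMSEQ_D[OF this, of "e / 2"] e obtain j where j: "norm (lint 0 1 (\<lambda>s. min (m s) (real j)) - lint 0 1 m) < e / 2" by auto
  define g where "g s = m s - min (m s) (real j)" for s
  have ig: "integrable (lebesgue_on {0..1}) g" unfolding g_def by (intro Bochner_Integration.integrable_diff m im)
  have g0: "0 \<le> g s" for s by (simp add: g_def)
  have "lint 0 1 g = lint 0 1 m - lint 0 1 (\<lambda>s. min (m s) (real j))"
    unfolding g_def by (rule Bochner_Integration.integral_diff[OF m(1) im])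
  then have gs: "lint 0 1 g < e / 2" using j unfolding real_norm_def by linarith
  show "\<exists>\<delta>>0. \<forall>D. finite D \<longrightarrow> (\<forall>(c,d)\<in>D. 0 \<le> c \<and> c \<le> d \<and> d \<le> 1) \<longrightarrow>
      pairwise (\<lambda>(c,d) (c',d'). {c<..<d} \<inter> {c'<..<d'} = {}) D \<longrightarrow>
      (\<Sum>(c,d)\<in>D. d - c) < \<delta> \<longrightarrow> (\<Sum>(c,d)\<in>D. norm (y d - y c)) < e"
  \<comment> \<open>With this total length the cut-off part stays below \<open>e / 2\<close>; the
    summand 1 admits \<open>j = 0\<close>.\<close>
  proof (intro exI[of _ "e / (2 * (real j + 1))"] conjI allI impI)
    show "0 < e / (2 * (real j + 1))" using e by simp
    fix D :: "(real \<times> real) set"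
    assume D: "finite D" "\<forall>(c,d)\<in>D. 0 \<le> c \<and> c \<le> d \<and> d \<le> 1"
      "pairwise (\<lambda>(c,d) (c',d'). {c<..<d} \<inter> {c'<..<d'} = {}) D"
      and s: "(\<Sum>(c,d)\<in>D. d - c) < e / (2 * (real j + 1))"
    have "norm (y d - y c) \<le> lint c d g + real j * (d - c)" if "(c, d) \<in> D" for c d
    proof -
      have cd: "0 \<le> c" "c \<le> d" "d \<le> 1" using D(2) that by auto
      have "norm (y d - y c) \<le> lint c d m" by (rule y[OF cd])
      also have "\<dots> \<le> lint c d (\<lambda>s. g s + real j)"
        using cd by (intro lint_mono integrable_sub[OF m(1)] Bochner_Integration.integrable_add integrable_sub[OF ig]) (auto simp: g_def)
      also have "\<dots> = lint c d g + real j * (d - c)"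
        using cd integrable_sub[OF ig, of c d] by (simp add: measure_restrict_space)
      finally show ?thesis .
    qed
    then have "(\<Sum>(c,d)\<in>D. norm (y d - y c)) \<le> (\<Sum>(c,d)\<in>D. lint c d g + real j * (d - c))"
      by (intro sum_mono) auto
    also have "\<dots> = (\<Sum>(c,d)\<in>D. lint c d g) + real j * (\<Sum>(c,d)\<in>D. d - c)"
      by (simp add: case_prod_unfold sum.distrib sum_distrib_left)
    also have "\<dots> \<le> lint 0 1 g + real j * (e / (2 * (real j + 1)))"
      using s by (intro add_mono mult_left_mono sum_lint_le[OF ig g0 D]) auto
    also have "real j * (e / (2 * (real j + 1))) \<le> e / 2" using e by (simp add: field_simps)
    finally show "(\<Sum>(c,d)\<in>D. norm (y d - y c)) < e" using gs by simp
  qed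
qed

lemma abs_continuous_imp_continuous:
  assumes "abs_continuous_on_interval a b y"
  shows "continuous_on {a..b} y"
  unfolding continuous_on_iff
proof (intro ballI allI impI)
  fix s e :: real assume s: "s \<in> {a..b}" and e: "0 < e"
  then obtain r where r: "0 < r" and D: "\<And>D. finite D \<Longrightarrow> \<forall>(c,d)\<in>D. a \<le> c \<and> c \<le> d \<and> d \<le> b \<Longrightarrow>
      pairwise (\<lambda>(c,d) (c',d'). {c<..<d} \<inter> {c'<..<d'} = {}) D \<Longrightarrow>
      (\<Sum>(c,d)\<in>D. d - c) < r \<Longrightarrow> (\<Sum>(c,d)\<in>D. norm (y d - y c)) < e"
    using assms unfolding abs_continuous_on_interval_def by meson
  have "dist (y t) (y s) < e" if t: "t \<in> {a..b}" "dist t s < r" for t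
  proof (cases "s \<le> t")
    case True
    then show ?thesis using D[of "{(s, t)}"] s t by (simp add: dist_norm)
  next
    case False
    then show ?thesis using D[of "{(t, s)}"] s t by (simp add: dist_norm norm_minus_commute)
  qed
  then show "\<exists>d>0. \<forall>t\<in>{a..b}. dist t s < d \<longrightarrow> dist (y t) (y s) < e" using r by blast
qed

text \<open>Extracts the least constant, so that the size of a difference of flows becomes a real
  function of time to which \<open>gronwall\<close> applies.\<close>

lemma bd_Cb_norm:
  fixes g :: "'a::euclidean_space \<Rightarrow> 'b::real_normed_vector"
  assumes "bd n M g"
  shows "bd n (enn2real (Cb_norm n g)) g" "enn2real (Cb_norm n g) \<le> M"
proof -
  note M = cls_nonneg[OF assms]
  have le: "Cb_norm n g \<le> ennreal M" using cls_iter_dderiv_bound[OF assms] by (subst Cb_norm_le_iff[OF M]) blast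
  from enn2real_mono[OF this] M show "enn2real (Cb_norm n g) \<le> M" by simp
  let ?c = "enn2real (Cb_norm n g)"
  have "Cb_norm n g < top" using le by (rule le_less_trans) simp
  then have "Cb_norm n g \<le> ennreal ?c" by simp
  then have b: "norm (iter_dderiv hs g x) \<le> ?c" if "unit_list hs" "length hs \<le> n" for hs x
    using that by (subst (asm) Cb_norm_le_iff) auto
  show "bd n ?c g"
    by (rule cls_ddI[OF b cls_iter_dderiv_differentiable[OF assms]]) (assumption+, rule bd_0I, rule b, simp_all)
qed

section \<open>Flows as solutions of the integral equation\<close>

context caratheodory_field
begin

text \<open>For solutions absolute continuity is automatic, since increments are dominated by
  integrals of \<open>m\<close>; in the other direction only continuity is extracted from
  it.\<close>

lemma is_flow_iff_sol:
  "is_flow w \<Phi> \<longleftrightarrow> \<Phi> \<in> extensional {0..1} \<and> (\<forall>x. sol 0 1 x (\<lambda>t. \<Phi> t x))"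
proof -
  have e: "(LINT s:{0..t}|lebesgue. w s (\<Phi> s x)) = lint 0 t (\<lambda>s. w s (\<Phi> s x))" for t x
    unfolding lint_lebesgue set_lebesgue_integral_def ..
  show ?thesis
  proof
    assume f: "is_flow w \<Phi>"
    have "sol 0 1 x (\<lambda>t. \<Phi> t x)" for x
      unfolding sol_def
      using f abs_continuous_imp_continuous[of 0 1 "\<lambda>t. \<Phi> t x"] by (auto simp: is_flow_def e)
    then show "\<Phi> \<in> extensional {0..1} \<and> (\<forall>x. sol 0 1 x (\<lambda>t. \<Phi> t x))" using f by (simp add: is_flow_def)
  next
    assume s: "\<Phi> \<in> extensional {0..1} \<and> (\<forall>x. sol 0 1 x (\<lambda>t. \<Phi> t x))"
    have c: "continuous_on {0..1} (\<lambda>t. \<Phi> t x)" for x using s by (simp add: sol_def)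
    have "abs_continuous_on_interval 0 1 (\<lambda>t. \<Phi> t x)" for x
    proof (rule abs_continuous_lint[OF im m_nonneg])
      fix a b :: real assume ab: "0 \<le> a" "a \<le> b" "b \<le> 1"
      have "norm (lint a b (\<lambda>s. w s (\<Phi> s x))) \<le> lint a b m"
        using ab w_bound by (intro lint_norm_le w_integrable im_sub continuous_on_subset[OF c]) auto
      then show "norm (\<Phi> b x - \<Phi> a x) \<le> lint a b m"
        using sol_increment[OF _ ab, of x "\<lambda>t. \<Phi> t x"] s by simp
    qed
    moreover have "set_integrable lebesgue {0..1} (\<lambda>s. w s (\<Phi> s x))" for x
      using w_integrable[OF order.refl zero_le_one order.refl c] unfolding set_integrable_def
      by (subst (asm) integrable_restrict_space) auto
    ultimately show "is_flow w \<Phi>" using s by (auto simp: is_flow_def e sol_def)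
  qed
qed

lemma is_flow_unique: "is_flow w \<Phi> \<Longrightarrow> is_flow w \<Psi> \<Longrightarrow> \<Phi> = \<Psi>"
proof (rule extensionalityI)
  fix t :: real assume f: "is_flow w \<Phi>" "is_flow w \<Psi>" and t: "t \<in> {0..1}"
  show "\<Phi> t = \<Psi> t"
    by (rule ext, rule sol_unique[OF _ _ t]) (use f in \<open>auto simp: is_flow_iff_sol\<close>)
qed (auto simp: is_flow_def)

lemma flow_eqI:
  assumes P: "\<And>x. sol 0 1 x (\<lambda>t. P t x)"
  shows "\<exists>!\<Phi>. is_flow w \<Phi>" "flow w = restrict P {0..1}"
proof -
  have "sol 0 1 x (\<lambda>t. restrict P {0..1} t x)" for x
    unfolding sol_def
  proof (intro conjI ballI)
    show "continuous_on {0..1} (\<lambda>t. restrict P {0..1} t x)"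
      by (rule continuous_on_eq[of _ "\<lambda>t. P t x"]) (use P[of x] in \<open>auto simp: sol_def\<close>)
    fix t :: real assume t: "t \<in> {0..1}"
    have "lint 0 t (\<lambda>s. w s (restrict P {0..1} s x)) = lint 0 t (\<lambda>s. w s (P s x))"
      by (rule Bochner_Integration.integral_cong) (use t in auto)
    then show "restrict P {0..1} t x = x + lint 0 t (\<lambda>s. w s (restrict P {0..1} s x))"
      using P[of x] t by (simp add: sol_def)
  qed
  then have f: "is_flow w (restrict P {0..1})" unfolding is_flow_iff_sol by simp
  then show "\<exists>!\<Phi>. is_flow w \<Phi>" using is_flow_unique by blast
  show "flow w = restrict P {0..1}" unfolding flow_def using f is_flow_unique by (intro the_equality) auto
qed

end

section \<open>Bounds and dependence on the field, uniform on bounded sets\<close>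

context besov_setting
begin

lemma X_caratheodory_field:
  assumes u: "u \<in> X" shows "caratheodory_field \<gamma> n u (\<lambda>t. holder_const \<gamma> * bnorm (u t)) (\<lambda>t. eta_real n (u t))"
proof
  show "cls \<gamma> n (holder_const \<gamma> * bnorm (u t)) (eta_real n (u t)) (u t)" "modulus (eta_real n (u t))" if "t \<in> {0..1}" for t
    using V_bounds[OF X_V[OF u that]] by auto
  show "integrable I01 (\<lambda>t. holder_const \<gamma> * bnorm (u t))" using X_bnorm_integrable[OF u] by simp
qed (use \<gamma> \<gamma>1 n X_eta_real_integrable[OF u] X_eval_measurable[OF u] in auto)

lemma Ah_A: "u \<in> X \<Longrightarrow> caratheodory_field.Ah (\<lambda>t. eta_real n (u t)) = mean_modulus u"
  by (intro ext) (simp only: caratheodory_field.Ah_def[OF X_caratheodory_field] mean_modulus_def)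

definition mass :: "(real \<Rightarrow> 'a::euclidean_space \<Rightarrow> 'a) \<Rightarrow> real" where
  "mass u = (\<integral>t. bnorm (u t) \<partial>I01)"

lemma mass_nonneg [simp]: "0 \<le> mass u" by (simp add: mass_def)

lemma mass_diff:
  assumes u: "u \<in> X" and v: "v \<in> X"
  shows "mass (v - u) \<le> mass v + mass u"
proof -
  have "mass (v - u) \<le> lint 0 1 (\<lambda>s. bnorm (v s) + bnorm (u s))"
    unfolding mass_def
  proof (rule lint_mono)
    show "bnorm ((v - u) s) \<le> bnorm (v s) + bnorm (u s)" if s: "s \<in> {0..1}" for s
      using V_diff(2)[OF X_V[OF v s] X_V[OF u s]] by simp
  qed (intro Bochner_Integration.integrable_add X_bnorm_integrable u v X_diff)+
  also have "\<dots> = mass v + mass u" unfolding mass_def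
    by (rule Bochner_Integration.integral_add) (intro X_bnorm_integrable u v)+
  finally show ?thesis .
qed

abbreviation fsol :: "(real \<Rightarrow> 'a::euclidean_space \<Rightarrow> 'a) \<Rightarrow> 'a \<Rightarrow> (real \<Rightarrow> 'a) \<Rightarrow> bool" where
  "fsol u \<equiv> caratheodory_field.sol u 0 1"

text \<open>The bound \<open>R\<close> on the mass fixes the number \<open>k\<close> of short
  intervals, hence one constant for all such \<open>u\<close>.\<close>

lemma flow_bound:
  "\<exists>C\<ge>0. \<forall>u::real \<Rightarrow> 'a::euclidean_space \<Rightarrow> 'a. u \<in> X \<longrightarrow> mass u \<le> R \<longrightarrow> (\<exists>!\<Phi>. is_flow u \<Phi>) \<and>
    (\<forall>x. fsol u x (\<lambda>t. flow u t x)) \<and> (\<forall>t\<in>{0..1}. cls \<gamma> n C (\<lambda>\<tau>. C * (mean_modulus u \<tau> + cap_power \<gamma> \<tau>)) (Fl u t))"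
proof -
  obtain C1 where C1: "1 \<le> C1" and st: "\<And>k. \<exists>C\<ge>0. \<forall>(w::real \<Rightarrow> 'a \<Rightarrow> 'a) m h T.
    caratheodory_field \<gamma> n w m h \<longrightarrow> T \<in> {0..1} \<longrightarrow> C1 * lint 0 T m \<le> real k / 2 \<longrightarrow>
    (\<exists>P. (\<forall>x. caratheodory_field.sol w 0 T x (\<lambda>t. P t x)) \<and>
      (\<forall>t\<in>{0..T}. cls \<gamma> n C (\<lambda>\<tau>. C * (caratheodory_field.Ah h \<tau> + cap_power \<gamma> \<tau>)) (\<lambda>x. P t x - x)))"
    using flow_exists_of_small_mass[OF \<gamma>(1) \<gamma>1(1) n, where 'a='a] by blast
  obtain k :: nat where k: "2 * (C1 * (holder_const \<gamma> * R)) \<le> real k" using real_arch_simple by blast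
  obtain C where C: "0 \<le> C" and *: "\<And>(w::real \<Rightarrow> 'a \<Rightarrow> 'a) m h T.
    caratheodory_field \<gamma> n w m h \<Longrightarrow> T \<in> {0..1} \<Longrightarrow> C1 * lint 0 T m \<le> real k / 2 \<Longrightarrow>
    (\<exists>P. (\<forall>x. caratheodory_field.sol w 0 T x (\<lambda>t. P t x)) \<and>
      (\<forall>t\<in>{0..T}. cls \<gamma> n C (\<lambda>\<tau>. C * (caratheodory_field.Ah h \<tau> + cap_power \<gamma> \<tau>)) (\<lambda>x. P t x - x)))"
    using st[of k] by blast
  have "(\<exists>!\<Phi>. is_flow u \<Phi>) \<and> (\<forall>x. fsol u x (\<lambda>t. flow u t x)) \<and>
    (\<forall>t\<in>{0..1}. cls \<gamma> n C (\<lambda>\<tau>. C * (mean_modulus u \<tau> + cap_power \<gamma> \<tau>)) (Fl u t))" if u: "u \<in> X" and R: "mass u \<le> R" for u :: "real \<Rightarrow> 'a \<Rightarrow> 'a"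
  proof -
    interpret caratheodory_field \<gamma> n u "\<lambda>t. holder_const \<gamma> * bnorm (u t)" "\<lambda>t. eta_real n (u t)" by (rule X_caratheodory_field[OF u])
    have "C1 * lint 0 1 (\<lambda>t. holder_const \<gamma> * bnorm (u t)) = C1 * (holder_const \<gamma> * mass u)" by (simp add: mass_def)
    also have "\<dots> \<le> C1 * (holder_const \<gamma> * R)" using C1 R holder_const_ge[OF \<gamma>1(2)] by (intro mult_left_mono) auto
    also have "\<dots> \<le> real k / 2" using k by simp
    finally have le: "C1 * lint 0 1 (\<lambda>t. holder_const \<gamma> * bnorm (u t)) \<le> real k / 2" .
    have "(1::real) \<in> {0..1}" by simp
    from *[OF X_caratheodory_field[OF u] this le] obtain P where P: "\<And>x. sol 0 1 x (\<lambda>t. P t x)"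
      "\<And>t. t \<in> {0..1} \<Longrightarrow> cls \<gamma> n C (\<lambda>\<tau>. C * (Ah \<tau> + cap_power \<gamma> \<tau>)) (\<lambda>x. P t x - x)" by blast
    note F = flow_eqI[OF P(1)]
    have fl: "is_flow u (flow u)" unfolding flow_def by (rule theI'[OF F(1)])
    have "Fl u t = (\<lambda>x. P t x - x)" if "t \<in> {0..1}" for t using that by (auto simp: Fl_def F(2))
    then show ?thesis using F(1) fl P(2) Ah_A[OF u] by (auto simp: is_flow_iff_sol)
  qed
  then show ?thesis using C by blast
qed

lemma sol_flow_properties:
  assumes u: "u \<in> X" and s: "fsol u x y"
  shows "continuous_on {0..1} y" "y 0 = x" "\<And>a b. 0 \<le> a \<Longrightarrow> a \<le> b \<Longrightarrow> b \<le> 1 \<Longrightarrow> y b = y a + lint a b (\<lambda>s. u s (y s))"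
    "\<And>a b. 0 \<le> a \<Longrightarrow> a \<le> b \<Longrightarrow> b \<le> 1 \<Longrightarrow> integrable (lebesgue_on {a..b}) (\<lambda>s. u s (y s))"
proof -
  interpret caratheodory_field \<gamma> n u "\<lambda>t. holder_const \<gamma> * bnorm (u t)" "\<lambda>t. eta_real n (u t)" by (rule X_caratheodory_field[OF u])
  show c: "continuous_on {0..1} y" "y 0 = x" using s by (auto simp: sol_def)
  show "y b = y a + lint a b (\<lambda>s. u s (y s))" if "0 \<le> a" "a \<le> b" "b \<le> 1" for a b
    by (rule sol_increment[OF s that])
  show "integrable (lebesgue_on {a..b}) (\<lambda>s. u s (y s))" if "0 \<le> a" "a \<le> b" "b \<le> 1" for a b
    using that by (intro w_integrable continuous_on_subset[OF c(1)]) auto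
qed

lemma mass_le:
  assumes u: "u \<in> X" and ab: "0 \<le> a" "a \<le> b" "b \<le> 1"
  shows "lint a b (\<lambda>s. bnorm (u s)) \<le> mass u" "0 \<le> lint a b (\<lambda>s. bnorm (u s))"
    "integrable (lebesgue_on {a..b}) (\<lambda>s. bnorm (u s))"
  using lint_sub_le[OF X_bnorm_integrable[OF u] ab] integrable_sub[OF X_bnorm_integrable[OF u] ab(1,3)]
  by (auto simp: mass_def)

lemma V_lipschitz:
  assumes "f \<in> V" shows "norm (f x - f y) \<le> bnorm f * norm (x - y)"
proof -
  obtain k where "n = Suc k" using n by (cases n) auto
  then show ?thesis using cls_lipschitz V_bounds(1)[OF assms] by blast
qed

lemma Fl_eq: "x + Fl u t x = flow u t x" by (simp add: Fl_def)

text \<open>Gronwall is applied twice. In the uniform norm the fields are Lipschitz and the distance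
  is linear in the mass of \<open>v - u\<close>; in \<open>C\<^sup>n\<close> that distance, raised
  to the power \<gamma>, is part of the inhomogeneity.\<close>

lemma flow_diff:
  assumes R: "0 \<le> R"
  shows "\<exists>C\<ge>0. \<forall>u v::real \<Rightarrow> 'a::euclidean_space \<Rightarrow> 'a. u \<in> X \<longrightarrow> v \<in> X \<longrightarrow> mass u \<le> R \<longrightarrow> mass v \<le> R \<longrightarrow>
    (\<forall>t\<in>{0..1}. bd n (C * mass (v - u) powr \<gamma>) (\<lambda>x. Fl v t x - Fl u t x))"
proof -
  obtain C0 where C0: "0 \<le> C0" and fb: "\<And>u::real \<Rightarrow> 'a \<Rightarrow> 'a. u \<in> X \<Longrightarrow> mass u \<le> R \<Longrightarrow>
    (\<forall>x. fsol u x (\<lambda>t. flow u t x)) \<and> (\<forall>t\<in>{0..1}. cls \<gamma> n C0 (\<lambda>\<tau>. C0 * (mean_modulus u \<tau> + cap_power \<gamma> \<tau>)) (Fl u t))"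
    using flow_bound[of R, where 'a='a] by blast
  have L: "1 \<le> 1 + 2 * C0" using C0 by simp
  obtain c1 where c1: "1 \<le> c1" and comp: "\<And>(f::'a \<Rightarrow> 'a) \<phi> M H K. cls \<gamma> n M H f \<Longrightarrow> modulus H \<Longrightarrow> cls \<gamma> n C0 K \<phi> \<Longrightarrow>
      near_id (1 + 2 * C0) \<phi> \<Longrightarrow> cls \<gamma> n (c1 * M) (\<lambda>t. c1 * (H t + M * K t + M * cap_power \<gamma> t)) (\<lambda>x. f (x + \<phi> x))"
    using cls_compose[OF \<gamma>1(3,1) L C0, of n, where 'b='a] by blast
  obtain c2 where c2: "1 \<le> c2" and cdiff: "\<And>(f::'a \<Rightarrow> 'a) \<phi> \<psi> M H e d. cls \<gamma> n M H f \<Longrightarrow> bd n C0 \<phi> \<Longrightarrow> bd n C0 \<psi> \<Longrightarrow>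
      near_id (1 + 2 * C0) \<psi> \<Longrightarrow> (\<forall>x. norm (\<phi> x - \<psi> x) \<le> e) \<Longrightarrow> bd n d (\<lambda>x. \<phi> x - \<psi> x) \<Longrightarrow>
      bd n (c2 * (M * (e powr \<gamma> + d))) (\<lambda>x. f (x + \<phi> x) - f (x + \<psi> x))"
    using bd_compose_diff[OF \<gamma>1(3,1) L C0, of n, where 'b='a] by blast
  obtain c3 where c3: "1 \<le> c3" and bcomp: "\<And>(f::'a \<Rightarrow> 'a) \<phi> M. bd n M f \<Longrightarrow> bd n C0 \<phi> \<Longrightarrow>
      near_id (1 + 2 * C0) \<phi> \<Longrightarrow> bd n (c3 * M) (\<lambda>x. f (x + \<phi> x))"
    using bd_compose[OF L C0, of n, where 'b='a] by blast
  have holder_const: "1 \<le> holder_const \<gamma>" by (rule holder_const_ge[OF \<gamma>1(2)])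
  obtain k1 :: nat where k1: "2 * R \<le> real k1" using real_arch_simple by blast
  obtain k2 :: nat where k2: "2 * (c2 * (holder_const \<gamma> * R)) \<le> real k2" using real_arch_simple by blast
  let ?G = "gronwall_const k1"
  \<comment> \<open>The first summand comes from the uniform distance
    \<open>?G * mass (v - u)\<close> raised to the power \<gamma>. The second comes from a term
    linear in \<open>mass (v - u)\<close>, turned into that power by
    \<open>mass (v - u) \<le> 2 * R\<close>.\<close>
  define C where "C = gronwall_const k2 * (c2 * (holder_const \<gamma> * R * ?G powr \<gamma>) + c3 * (2 * R) powr (1 - \<gamma>))"
  have C: "0 \<le> C" unfolding C_def using gronwall_const_ge_1[of k2] c2 c3 holder_const R by simp
  have "bd n (C * mass (v - u) powr \<gamma>) (\<lambda>x. Fl v T x - Fl u T x)"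
    if u: "u \<in> X" and v: "v \<in> X" and uR: "mass u \<le> R" and vR: "mass v \<le> R" and T: "T \<in> {0..1}"
    for u v :: "real \<Rightarrow> 'a \<Rightarrow> 'a" and T
  proof -
    have wX: "v - u \<in> X" by (rule X_diff[OF v u])
    define e where "e = mass (v - u)"
    let ?P = "flow u" and ?Q = "flow v"
    have su: "fsol u x (\<lambda>t. ?P t x)" and sv: "fsol v x (\<lambda>t. ?Q t x)" for x using fb u v uR vR by auto
    have cu: "cls \<gamma> n C0 (\<lambda>\<tau>. C0 * (mean_modulus u \<tau> + cap_power \<gamma> \<tau>)) (Fl u t)" and cv: "cls \<gamma> n C0 (\<lambda>\<tau>. C0 * (mean_modulus v \<tau> + cap_power \<gamma> \<tau>)) (Fl v t)"
      if "t \<in> {0..1}" for t using fb u v uR vR that by auto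
    note pu = sol_flow_properties[OF u su] and pv = sol_flow_properties[OF v sv]
    have e0: "0 \<le> e" by (simp add: e_def)
    have wl: "lint a b (\<lambda>s. bnorm ((v - u) s)) \<le> e" "integrable (lebesgue_on {a..b}) (\<lambda>s. bnorm ((v - u) s))"
      if "0 \<le> a" "a \<le> b" "b \<le> 1" for a b using mass_le[OF wX that] by (simp_all only: e_def)
    have e2R: "e \<le> 2 * R" using mass_diff[OF u v] uR vR by (simp add: e_def)
    have C0dist: "norm (?Q t x - ?P t x) \<le> ?G * e" if t: "t \<in> {0..1}" for t x
    proof -
      let ?f = "\<lambda>t. norm (?Q t x - ?P t x)"
      have "continuous_on {0..1} ?f" by (intro continuous_intros pu(1) pv(1))
      then obtain B where "\<forall>t\<in>{0..1}. ?f t \<le> B"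
        using compact_continuous_image[OF _ compact_Icc, THEN compact_imp_bounded] by (fastforce simp: bounded_iff)
      then have B: "?f t \<le> B" if "t \<in> {0..1}" for t using that by blast
      have "?f t \<le> gronwall_const k1 * (?f 0 + e)"
      proof (rule gronwall[OF X_bnorm_integrable[OF v] _ B e0 _ _ t])
        have "lint 0 t (\<lambda>s. bnorm (v s)) \<le> R" using mass_le(1)[OF v, of 0 t] t vR by auto
        then show "lint 0 t (\<lambda>s. bnorm (v s)) \<le> real k1 / 2" using k1 by simp
        fix a b S :: real assume ab: "0 \<le> a" "a \<le> b" "b \<le> 1" and S: "\<And>s. s \<in> {a..b} \<Longrightarrow> ?f s \<le> S"
        note i = pv(4)[OF ab, of x] pu(4)[OF ab, of x]
        have e1: "?Q b x - ?P b x = (?Q a x - ?P a x) + lint a b (\<lambda>s. v s (?Q s x) - u s (?P s x))"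
          using pv(3)[OF ab, of x] pu(3)[OF ab, of x] by (simp add: i)
        have "norm (lint a b (\<lambda>s. v s (?Q s x) - u s (?P s x))) \<le> lint a b (\<lambda>s. bnorm (v s) * S + bnorm ((v - u) s))"
        proof (rule lint_norm_le[OF Bochner_Integration.integrable_diff[OF i]])
          show "integrable (lebesgue_on {a..b}) (\<lambda>s. bnorm (v s) * S + bnorm ((v - u) s))"
            by (intro Bochner_Integration.integrable_add integrable_mult_left mass_le(3)[OF v ab] wl(2)[OF ab])
          fix s assume s: "s \<in> {a..b}"
          then have s01: "s \<in> {0..1}" using ab by auto
          have "v s (?Q s x) - u s (?P s x) = (v s (?Q s x) - v s (?P s x)) + (v s (?P s x) - u s (?P s x))" by simp
          also have "norm \<dots> \<le> bnorm (v s) * ?f s + bnorm (v s - u s)"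
            by (intro norm_triangle_le add_mono V_lipschitz V_eval X_V[OF v s01] X_V[OF u s01])
          also have "\<dots> \<le> bnorm (v s) * S + bnorm ((v - u) s)" using S[OF s] by (simp add: mult_left_mono)
          finally show "norm (v s (?Q s x) - u s (?P s x)) \<le> bnorm (v s) * S + bnorm ((v - u) s)" .
        qed
        moreover have "lint a b (\<lambda>s. bnorm (v s) * S + bnorm ((v - u) s)) = lint a b (\<lambda>s. bnorm (v s)) * S + lint a b (\<lambda>s. bnorm ((v - u) s))"
          using Bochner_Integration.integral_add[OF integrable_mult_left[OF mass_le(3)[OF v ab], of S] wl(2)[OF ab]] by simp
        moreover have "norm ((?Q a x - ?P a x) + lint a b (\<lambda>s. v s (?Q s x) - u s (?P s x))) \<le> ?f a + norm (lint a b (\<lambda>s. v s (?Q s x) - u s (?P s x)))"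
          by (rule norm_triangle_ineq)
        ultimately show "?f b \<le> ?f a + e + lint a b (\<lambda>s. bnorm (v s)) * S"
          unfolding e1 using wl(1)[OF ab] by linarith
      qed auto
      then show ?thesis using pu(2)[of x] pv(2)[of x] by simp
    qed
    let ?D = "\<lambda>t x. Fl v t x - Fl u t x"
    let ?f = "\<lambda>t. enn2real (Cb_norm n (?D t))"
    have bD: "bd n (2 * C0) (?D t)" if "t \<in> {0..1}" for t
      using cls_bd[OF cls_diff[OF cv[OF that] cu[OF that]]] by (simp only: mult_2)
    have bf: "bd n (?f t) (?D t)" "?f t \<le> 2 * C0" if "t \<in> {0..1}" for t using bd_Cb_norm[OF bD[OF that]] by auto
    let ?E = "?G * e"
    let ?c = "c2 * (holder_const \<gamma> * R * ?E powr \<gamma>) + c3 * e"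
    have hkv: "integrable (lebesgue_on {a..b}) (\<lambda>s. holder_const \<gamma> * bnorm (v s))" if "0 \<le> a" "a \<le> b" "b \<le> 1" for a b
      using mass_le(3)[OF v that] by simp
    have "?f T \<le> gronwall_const k2 * (?f 0 + ?c)"
    proof (rule gronwall[where m="\<lambda>s. c2 * (holder_const \<gamma> * bnorm (v s))", OF _ _ bf(2) _ _ _ T])
      show "integrable I01 (\<lambda>s. c2 * (holder_const \<gamma> * bnorm (v s)))" using X_bnorm_integrable[OF v] by simp
      show "0 \<le> ?c" using c2 c3 holder_const R e0 by simp
      show "0 \<le> c2 * (holder_const \<gamma> * bnorm (v s))" for s using c2 holder_const by simp
      have "lint 0 T (\<lambda>s. bnorm (v s)) \<le> R" using mass_le(1)[OF v, of 0 T] T vR by auto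
      then have "c2 * (holder_const \<gamma> * lint 0 T (\<lambda>s. bnorm (v s))) \<le> c2 * (holder_const \<gamma> * R)"
        using c2 holder_const by (intro mult_left_mono) auto
      then show "lint 0 T (\<lambda>s. c2 * (holder_const \<gamma> * bnorm (v s))) \<le> real k2 / 2" using k2 by simp
      fix a b S :: real assume ab: "0 \<le> a" "a \<le> b" "b \<le> 1" and S: "\<And>s. s \<in> {a..b} \<Longrightarrow> ?f s \<le> S"
      let ?g = "\<lambda>s x. v s (?Q s x) - u s (?P s x)"
      let ?N = "lebesgue_on {a..b}"
      \<comment> \<open>The integrand is split into the difference of \<open>v\<close> along the two
        flows, bounded by \<open>cdiff\<close>, and \<open>v - u\<close> along the flow of
        \<open>u\<close>, bounded by \<open>bcomp\<close>.\<close>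
      define bs where "bs s = c2 * (holder_const \<gamma> * bnorm (v s) * (?E powr \<gamma> + S)) + c3 * bnorm ((v - u) s)" for s
      have ibs: "integrable ?N bs" unfolding bs_def
        by (intro Bochner_Integration.integrable_add integrable_mult_right integrable_mult_left hkv[OF ab] wl(2)[OF ab])
      \<comment> \<open>Membership with a positive exponent, for differentiating under the integral;
        the quantitative bound is \<open>bdg\<close>.\<close>
      have creg: "cls \<gamma> n (c1 * (holder_const \<gamma> * bnorm (v s)) + c1 * (holder_const \<gamma> * bnorm (u s)))
          (\<lambda>t. c1 * (eta_real n (v s) t + holder_const \<gamma> * bnorm (v s) * (C0 * (mean_modulus v t + cap_power \<gamma> t)) + holder_const \<gamma> * bnorm (v s) * cap_power \<gamma> t) +
               c1 * (eta_real n (u s) t + holder_const \<gamma> * bnorm (u s) * (C0 * (mean_modulus u t + cap_power \<gamma> t)) + holder_const \<gamma> * bnorm (u s) * cap_power \<gamma> t)) (?g s)"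
        if "s \<in> space ?N" for s
      proof -
        have s: "s \<in> {0..1}" using that ab by auto
        note vs = V_bounds[OF X_V[OF v s]] and us = V_bounds[OF X_V[OF u s]]
        from cls_diff[OF comp[OF vs(4,3) cv[OF s] cls_near_id[OF cv[OF s] n]] comp[OF us(4,3) cu[OF s] cls_near_id[OF cu[OF s] n]]]
        show ?thesis unfolding Fl_eq .
      qed
      have bdg: "bd n (bs s) (?g s)" if "s \<in> space ?N" for s
      proof -
        have s: "s \<in> {0..1}" and sab: "s \<in> {a..b}" using that ab by auto
        note vs = V_bounds[OF X_V[OF v s]] and us = V_bounds[OF X_V[OF u s]]
        have "\<forall>x. norm (Fl v s x - Fl u s x) \<le> ?E" using C0dist[OF s] by (simp add: Fl_def)
        moreover have "bd n S (?D s)" by (rule cls_mono[OF bf(1)[OF s]]) (use S[OF sab] in auto)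
        ultimately have d: "bd n (c2 * (holder_const \<gamma> * bnorm (v s) * (?E powr \<gamma> + S))) (\<lambda>x. v s (?Q s x) - v s (?P s x))"
          using cdiff[OF vs(4) cls_bd[OF cv[OF s]] cls_bd[OF cu[OF s]] cls_near_id[OF cu[OF s] n]] unfolding Fl_eq by blast
        have "bd n (c3 * bnorm ((v - u) s)) (\<lambda>x. (v - u) s (?P s x))"
          using bcomp[OF V_bounds(1)[OF X_V[OF wX s]] cls_bd[OF cu[OF s]] cls_near_id[OF cu[OF s] n]] unfolding Fl_eq .
        from cls_bd[OF cls_add[OF d this]] show ?thesis by (simp add: bs_def)
      qed
      have "cls 0 n (lint a b bs) (\<lambda>t. lint a b (\<lambda>s. 4 * bs s)) (\<lambda>x. lint a b (\<lambda>s. ?g s x))"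
      proof (rule cls_integral[OF \<gamma>(1) \<gamma>1(1) _ ibs _ creg bdg])
        show "integrable ?N (\<lambda>s. c1 * (holder_const \<gamma> * bnorm (v s)) + c1 * (holder_const \<gamma> * bnorm (u s)))"
          by (intro Bochner_Integration.integrable_add integrable_mult_right mass_le(3)[OF v ab] mass_le(3)[OF u ab])
        show "integrable ?N (\<lambda>s. 4 * bs s)" using ibs by simp
        show "(\<lambda>s. ?g s x) \<in> borel_measurable ?N" for x
          by (intro borel_measurable_diff borel_measurable_integrable pv(4)[OF ab] pu(4)[OF ab])
      qed
      from cls_bd[OF cls_add[OF bf(1) this]] have "bd n (?f a + lint a b bs) (\<lambda>x. ?D a x + lint a b (\<lambda>s. ?g s x))"
        using ab by simp
      also have "(\<lambda>x. ?D a x + lint a b (\<lambda>s. ?g s x)) = ?D b"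
      proof
        fix x
        have "lint a b (\<lambda>s. ?g s x) = lint a b (\<lambda>s. v s (?Q s x)) - lint a b (\<lambda>s. u s (?P s x))"
          by (rule Bochner_Integration.integral_diff[OF pv(4)[OF ab] pu(4)[OF ab]])
        then show "?D a x + lint a b (\<lambda>s. ?g s x) = ?D b x"
          using pv(3)[OF ab, of x] pu(3)[OF ab, of x] by (simp add: Fl_def)
      qed
      finally have "?f b \<le> ?f a + lint a b bs" by (rule bd_Cb_norm(2))
      also have "lint a b bs = c2 * (holder_const \<gamma> * lint a b (\<lambda>s. bnorm (v s)) * (?E powr \<gamma> + S)) + c3 * lint a b (\<lambda>s. bnorm ((v - u) s))"
      proof -
        have "integrable ?N (\<lambda>s. c2 * (holder_const \<gamma> * bnorm (v s) * (?E powr \<gamma> + S)))" "integrable ?N (\<lambda>s. c3 * bnorm ((v - u) s))"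
          by (intro integrable_mult_right integrable_mult_left hkv[OF ab] wl(2)[OF ab])+
        from Bochner_Integration.integral_add[OF this] show ?thesis unfolding bs_def by simp
      qed
      also have "\<dots> = c2 * (holder_const \<gamma> * lint a b (\<lambda>s. bnorm (v s)) * ?E powr \<gamma>) + c3 * lint a b (\<lambda>s. bnorm ((v - u) s))
          + c2 * (holder_const \<gamma> * lint a b (\<lambda>s. bnorm (v s))) * S" by (simp add: algebra_simps)
      also have "\<dots> \<le> ?c + c2 * (holder_const \<gamma> * lint a b (\<lambda>s. bnorm (v s))) * S"
        using c2 c3 holder_const wl(1)[OF ab] mass_le(1,2)[OF v ab] vR
        by (intro add_mono order.refl mult_left_mono mult_right_mono) auto
      also have "c2 * (holder_const \<gamma> * lint a b (\<lambda>s. bnorm (v s))) = lint a b (\<lambda>s. c2 * (holder_const \<gamma> * bnorm (v s)))" by simp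
      finally show "?f b \<le> ?f a + ?c + lint a b (\<lambda>s. c2 * (holder_const \<gamma> * bnorm (v s))) * S" by simp
    qed auto
    moreover have f00: "?f 0 \<le> 0"
    proof (rule bd_Cb_norm(2))
      have "?D 0 = (\<lambda>_. 0)" using pu(2) pv(2) by (simp add: Fl_def)
      then show "bd n 0 (?D 0)" using cls_bd[OF cls_const[of 0 0]] by simp
    qed
    moreover have "gronwall_const k2 * (?f 0 + ?c) \<le> gronwall_const k2 * ?c"
      by (rule mult_left_mono) (use f00 gronwall_const_ge_1[of k2] in linarith)+
    ultimately have "?f T \<le> gronwall_const k2 * ?c" by linarith
    also have "\<dots> \<le> C * e powr \<gamma>"
    proof -
      have "e \<le> (2 * R) powr (1 - \<gamma>) * e powr \<gamma>"
      proof (cases "e = 0")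
        case False
        then have "e = e powr (1 - \<gamma>) * e powr \<gamma>" using e0 by (simp flip: powr_add)
        also have "\<dots> \<le> (2 * R) powr (1 - \<gamma>) * e powr \<gamma>"
          using e0 e2R \<gamma>1 by (intro mult_right_mono powr_mono2) auto
        finally show ?thesis .
      qed simp
      then have "c3 * e \<le> c3 * (2 * R) powr (1 - \<gamma>) * e powr \<gamma>" using c3 by simp
      moreover have "?E powr \<gamma> = ?G powr \<gamma> * e powr \<gamma>" using e0 gronwall_const_ge_1[of k1] by (simp add: powr_mult)
      ultimately have "?c \<le> (c2 * (holder_const \<gamma> * R * ?G powr \<gamma>) + c3 * (2 * R) powr (1 - \<gamma>)) * e powr \<gamma>"
        by (simp add: algebra_simps)
      from mult_left_mono[OF this, of "gronwall_const k2"] gronwall_const_ge_1[of k2] show ?thesis by (simp add: C_def mult.assoc)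
    qed
    finally have le: "?f T \<le> C * e powr \<gamma>" .
    show ?thesis unfolding e_def[symmetric]
      by (rule cls_mono[OF bf(1)[OF T]]) (use le in auto)
  qed
  then show ?thesis using C by blast
qed

end

section \<open>Continuity of the flow in the Besov norm\<close>

text \<open>The increment is the integral of the field along its flow, and composing with the flow
  multiplies the \<open>C\<^sup>n\<close> bound by a fixed constant.\<close>

lemma (in besov_setting) flow_time:
  "\<exists>C\<ge>0. \<forall>u::real \<Rightarrow> 'a::euclidean_space \<Rightarrow> 'a. u \<in> X \<longrightarrow> mass u \<le> R \<longrightarrow>
    (\<forall>a b. 0 \<le> a \<longrightarrow> a \<le> b \<longrightarrow> b \<le> 1 \<longrightarrow> bd n (C * lint a b (\<lambda>s. bnorm (u s))) (\<lambda>x. Fl u b x - Fl u a x))"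
proof -
  obtain C0 where C0: "0 \<le> C0" and fb: "\<And>u::real \<Rightarrow> 'a \<Rightarrow> 'a. u \<in> X \<Longrightarrow> mass u \<le> R \<Longrightarrow>
    (\<forall>x. fsol u x (\<lambda>t. flow u t x)) \<and> (\<forall>t\<in>{0..1}. cls \<gamma> n C0 (\<lambda>\<tau>. C0 * (mean_modulus u \<tau> + cap_power \<gamma> \<tau>)) (Fl u t))"
    using flow_bound[of R, where 'a='a] by blast
  have L: "1 \<le> 1 + 2 * C0" using C0 by simp
  obtain c1 where c1: "1 \<le> c1" and comp: "\<And>(f::'a \<Rightarrow> 'a) \<phi> M H K. cls \<gamma> n M H f \<Longrightarrow> modulus H \<Longrightarrow> cls \<gamma> n C0 K \<phi> \<Longrightarrow>
      near_id (1 + 2 * C0) \<phi> \<Longrightarrow> cls \<gamma> n (c1 * M) (\<lambda>t. c1 * (H t + M * K t + M * cap_power \<gamma> t)) (\<lambda>x. f (x + \<phi> x))"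
    using cls_compose[OF \<gamma>1(3,1) L C0, of n, where 'b='a] by blast
  obtain c3 where c3: "1 \<le> c3" and bcomp: "\<And>(f::'a \<Rightarrow> 'a) \<phi> M. bd n M f \<Longrightarrow> bd n C0 \<phi> \<Longrightarrow>
      near_id (1 + 2 * C0) \<phi> \<Longrightarrow> bd n (c3 * M) (\<lambda>x. f (x + \<phi> x))"
    using bd_compose[OF L C0, of n, where 'b='a] by blast
  have "bd n (c3 * lint a b (\<lambda>s. bnorm (u s))) (\<lambda>x. Fl u b x - Fl u a x)"
    if u: "u \<in> X" and uR: "mass u \<le> R" and ab: "0 \<le> a" "a \<le> b" "b \<le> 1" for u :: "real \<Rightarrow> 'a \<Rightarrow> 'a" and a b
  proof -
    have su: "fsol u x (\<lambda>t. flow u t x)" for x using fb u uR by auto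
    have cu: "cls \<gamma> n C0 (\<lambda>\<tau>. C0 * (mean_modulus u \<tau> + cap_power \<gamma> \<tau>)) (Fl u t)" if "t \<in> {0..1}" for t using fb u uR that by auto
    note pu = sol_flow_properties[OF u su]
    let ?N = "lebesgue_on {a..b}"
    have i: "integrable ?N (\<lambda>s. bnorm (u s))" by (rule mass_le(3)[OF u ab])
    have "cls 0 n (lint a b (\<lambda>s. c3 * bnorm (u s))) (\<lambda>t. lint a b (\<lambda>s. 4 * (c3 * bnorm (u s)))) (\<lambda>x. lint a b (\<lambda>s. u s (flow u s x)))"
    proof (rule cls_integral[OF \<gamma>(1) \<gamma>1(1), where m="\<lambda>s. c1 * (holder_const \<gamma> * bnorm (u s))" and
          h="\<lambda>s t. c1 * (eta_real n (u s) t + holder_const \<gamma> * bnorm (u s) * (C0 * (mean_modulus u t + cap_power \<gamma> t)) + holder_const \<gamma> * bnorm (u s) * cap_power \<gamma> t)"])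
      show "(\<lambda>s. u s (flow u s x)) \<in> borel_measurable ?N" for x
        by (rule borel_measurable_integrable[OF pu(4)[OF ab]])
      fix s assume "s \<in> space ?N"
      then have s: "s \<in> {0..1}" using ab by auto
      note us = V_bounds[OF X_V[OF u s]]
      show "cls \<gamma> n (c1 * (holder_const \<gamma> * bnorm (u s)))
          (\<lambda>t. c1 * (eta_real n (u s) t + holder_const \<gamma> * bnorm (u s) * (C0 * (mean_modulus u t + cap_power \<gamma> t)) + holder_const \<gamma> * bnorm (u s) * cap_power \<gamma> t)) (\<lambda>x. u s (flow u s x))"
        using comp[OF us(4,3) cu[OF s] cls_near_id[OF cu[OF s] n]] unfolding Fl_eq .
      show "bd n (c3 * bnorm (u s)) (\<lambda>x. u s (flow u s x))"
        using bcomp[OF us(1) cls_bd[OF cu[OF s]] cls_near_id[OF cu[OF s] n]] unfolding Fl_eq .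
    qed (use i in auto)
    then have "bd n (lint a b (\<lambda>s. c3 * bnorm (u s))) (\<lambda>x. lint a b (\<lambda>s. u s (flow u s x)))" by (rule cls_bd)
    moreover have "(\<lambda>x. lint a b (\<lambda>s. u s (flow u s x))) = (\<lambda>x. Fl u b x - Fl u a x)"
      using pu(3)[OF ab] by (auto simp: Fl_def)
    ultimately show ?thesis by simp
  qed
  then show ?thesis using c3 by (intro exI[of _ c3]) auto
qed

text \<open>Interpolation is applied to the modulus of the top derivative of \<open>g\<close>, which
  is at most \<open>4 * d\<close>. Positivity of \<open>d\<close> matters because the splitting
  point is a power of \<open>d\<close>.\<close>

lemma besov_interpolation:
  assumes \<alpha>: "0 < \<alpha>" "\<alpha> < \<beta>" and p: "1 \<le> p" and a: "0 \<le> a" and \<gamma>: "0 < \<gamma>" "\<gamma> \<le> 1"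
  shows "\<exists>C\<ge>0. \<forall>(g::'a::euclidean_space \<Rightarrow> 'b::real_normed_vector) M H d. cls \<gamma> n M H g \<longrightarrow> modulus H \<longrightarrow> besov_bound \<beta> p a H \<longrightarrow>
    bd n d g \<longrightarrow> 0 < d \<longrightarrow> g \<in> besov n \<alpha> p \<and> besov_norm n \<alpha> p g \<le> ennreal (d + C * d powr ((\<beta> - \<alpha>) / \<beta>))"
proof -
  obtain C where C: "0 \<le> C" and *: "\<And>H d. modulus H \<Longrightarrow> besov_bound \<beta> p a H \<Longrightarrow> 0 < d \<Longrightarrow> (\<forall>t>0. H t \<le> 4 * d) \<Longrightarrow>
    besov_bound \<alpha> p (C * d powr ((\<beta> - \<alpha>) / \<beta>)) H"
    using besov_bound_interpolation[OF \<alpha> p a] by blast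
  have "g \<in> besov n \<alpha> p \<and> besov_norm n \<alpha> p g \<le> ennreal (d + C * d powr ((\<beta> - \<alpha>) / \<beta>))"
    if g: "cls \<gamma> n M H g" and H: "modulus H" "besov_bound \<beta> p a H" and d: "bd n d g" "0 < d"
    for g :: "'a \<Rightarrow> 'b" and M H d
  proof -
    let ?B = "d + C * d powr ((\<beta> - \<alpha>) / \<beta>)"
    have B: "d \<le> ?B" "C * d powr ((\<beta> - \<alpha>) / \<beta>) \<le> ?B" using C d by auto
    have b: "norm (iter_dderiv hs g x) \<le> d" if "unit_list hs" "length hs = n" for hs x
      using cls_iter_dderiv_bound[OF d(1) that(1)] that by simp
    have m: "modulus (eta_real n g)" by (rule modulus_eta_real[OF b])
    have "besov_bound \<beta> p a (eta_real n g)" by (rule besov_bound_mono[OF H(2) p a order.refl]) (use eta_real_le[OF g H(1)] in auto)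
    moreover have "eta_real n g t \<le> 4 * d" for t
      by (rule eta_real_least[OF norm_second_diff_le[OF b]]) (use d in auto)
    ultimately have "besov_bound \<alpha> p (C * d powr ((\<beta> - \<alpha>) / \<beta>)) (eta_real n g)" using m d by (intro *) auto
    then have z: "besov_bound \<alpha> p ?B (eta_real n g)" by (rule besov_bound_mono[OF _ p _ B(2)]) (use C in auto)
    have "bd n ?B g" by (rule cls_mono[OF d(1) B(1)]) (use B in auto)
    from besov_normI[OF \<gamma> p g this z] show ?thesis by blast
  qed
  then show ?thesis using C by blast
qed

context besov_setting
begin

lemma mass_flow_besov_bound:
  assumes aJ: "besov_bound \<beta> p aJ (cap_power \<gamma>)" "0 < aJ" and C0: "0 \<le> C0" and u: "u \<in> X" "mass u \<le> R"
  shows "besov_bound \<beta> p (C0 * (R + aJ)) (\<lambda>\<tau>. C0 * (mean_modulus u \<tau> + cap_power \<gamma> \<tau>))" "modulus (\<lambda>\<tau>. C0 * (mean_modulus u \<tau> + cap_power \<gamma> \<tau>))"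
proof -
  have mJ: "modulus (cap_power \<gamma>)" by (rule modulus_cap_power[OF \<gamma>1(3,1)])
  note mA = modulus_A[OF u(1)]
  have R: "0 \<le> R" using u(2) mass_nonneg[of u] by linarith
  have "besov_bound \<beta> p R (mean_modulus u)"
    by (rule besov_bound_mono[OF besov_bound_A[OF u(1)] p _ u(2)[unfolded mass_def]]) (use modulus_nonneg[OF mA] in auto)
  then have "besov_bound \<beta> p (R + aJ) (\<lambda>\<tau>. mean_modulus u \<tau> + cap_power \<gamma> \<tau>)"
    using mA mJ aJ R p by (intro besov_bound_add_nonneg) auto
  moreover have m: "modulus (\<lambda>\<tau>. mean_modulus u \<tau> + cap_power \<gamma> \<tau>)" by (rule modulus_add[OF mA mJ])
  ultimately show "besov_bound \<beta> p (C0 * (R + aJ)) (\<lambda>\<tau>. C0 * (mean_modulus u \<tau> + cap_power \<gamma> \<tau>))"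
    using C0 R aJ by (intro besov_bound_scale) auto
  show "modulus (\<lambda>\<tau>. C0 * (mean_modulus u \<tau> + cap_power \<gamma> \<tau>))" by (rule modulus_cmult[OF C0 m])
qed

text \<open>Two fields and two times are allowed so that one estimate serves both continuity in time
  (\<open>v = u\<close>) and dependence on the field (\<open>s = t\<close>).\<close>

lemma flow_besov:
  assumes \<alpha>: "0 < \<alpha>" "\<alpha> < \<beta>" and R: "0 \<le> R"
  shows "\<exists>C\<ge>0. \<forall>u v::real \<Rightarrow> 'a::euclidean_space \<Rightarrow> 'a. u \<in> X \<longrightarrow> v \<in> X \<longrightarrow> mass u \<le> R \<longrightarrow> mass v \<le> R \<longrightarrow>
    (\<forall>t\<in>{0..1}. Fl u t \<in> besov n \<alpha> p) \<and>
    (\<forall>t\<in>{0..1}. \<forall>s\<in>{0..1}. \<forall>d>0. bd n d (\<lambda>x. Fl v t x - Fl u s x) \<longrightarrow>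
      besov_norm n \<alpha> p (Fl v t - Fl u s) \<le> ennreal (d + C * d powr ((\<beta> - \<alpha>) / \<beta>)))"
proof -
  obtain C0 where C0: "0 \<le> C0" and fb: "\<And>u::real \<Rightarrow> 'a \<Rightarrow> 'a. u \<in> X \<Longrightarrow> mass u \<le> R \<Longrightarrow>
    (\<forall>t\<in>{0..1}. cls \<gamma> n C0 (\<lambda>\<tau>. C0 * (mean_modulus u \<tau> + cap_power \<gamma> \<tau>)) (Fl u t))"
    using flow_bound[of R, where 'a='a] by blast
  have "0 < \<beta>" using \<gamma> by simp
  then obtain aJ where aJ: "0 < aJ" "besov_bound \<beta> p aJ (cap_power \<gamma>)" using besov_bound_cap_power[OF \<beta>(2) _ p] by blast
  \<comment> \<open>The bound of order \<beta> for a single flow; differences of two flows obey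
    twice this bound.\<close>
  let ?a = "C0 * (R + aJ)"
  have a: "0 \<le> ?a" using C0 R aJ by simp
  then have a2: "0 \<le> ?a + ?a" by simp
  obtain C where C: "0 \<le> C" and *: "\<And>(g::'a \<Rightarrow> 'a) M H d. cls \<gamma> n M H g \<Longrightarrow> modulus H \<Longrightarrow> besov_bound \<beta> p (?a + ?a) H \<Longrightarrow>
    bd n d g \<Longrightarrow> 0 < d \<Longrightarrow> g \<in> besov n \<alpha> p \<and> besov_norm n \<alpha> p g \<le> ennreal (d + C * d powr ((\<beta> - \<alpha>) / \<beta>))"
    using besov_interpolation[OF \<alpha> p a2 \<gamma>(1) \<gamma>1(1), of n, where 'a='a and 'b='a] by blast
  have "Fl u t \<in> besov n \<alpha> p" if u: "u \<in> X" "mass u \<le> R" and t: "t \<in> {0..1}" for u :: "real \<Rightarrow> 'a \<Rightarrow> 'a" and t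
  proof -
    note z = mass_flow_besov_bound[OF aJ(2,1) C0 u]
    have c: "cls \<gamma> n C0 (\<lambda>\<tau>. C0 * (mean_modulus u \<tau> + cap_power \<gamma> \<tau>)) (Fl u t)" using fb u t by blast
    have z2: "besov_bound \<beta> p (?a + ?a) (\<lambda>\<tau>. C0 * (mean_modulus u \<tau> + cap_power \<gamma> \<tau>))"
      by (rule besov_bound_mono[OF z(1) p a]) (use a modulus_nonneg[OF z(2)] in auto)
    have "bd n (C0 + 1) (Fl u t)" by (rule cls_mono[OF cls_bd[OF c]]) auto
    from *[OF c z(2) z2 this] C0 show ?thesis by simp
  qed
  moreover have "besov_norm n \<alpha> p (Fl v t - Fl u s) \<le> ennreal (d + C * d powr ((\<beta> - \<alpha>) / \<beta>))"
    if u: "u \<in> X" "mass u \<le> R" and v: "v \<in> X" "mass v \<le> R" and t: "t \<in> {0..1}" "s \<in> {0..1}"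
      and d: "0 < d" "bd n d (\<lambda>x. Fl v t x - Fl u s x)" for u v :: "real \<Rightarrow> 'a \<Rightarrow> 'a" and t s d
  proof -
    note zu = mass_flow_besov_bound[OF aJ(2,1) C0 u] and zv = mass_flow_besov_bound[OF aJ(2,1) C0 v]
    have cu: "cls \<gamma> n C0 (\<lambda>\<tau>. C0 * (mean_modulus u \<tau> + cap_power \<gamma> \<tau>)) (Fl u s)" and cv: "cls \<gamma> n C0 (\<lambda>\<tau>. C0 * (mean_modulus v \<tau> + cap_power \<gamma> \<tau>)) (Fl v t)"
      using fb u v t by blast+
    from *[OF cls_diff[OF cv cu] modulus_add[OF zv(2) zu(2)] besov_bound_add_nonneg[OF zv a zu a p] d(2,1)]
    show ?thesis by (simp add: fun_diff_def)
  qed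
  ultimately show ?thesis using C by blast
qed

lemma flow_continuous_curve:
  fixes u :: "real \<Rightarrow> 'a::euclidean_space \<Rightarrow> 'a"
  assumes \<alpha>: "0 < \<alpha>" "\<alpha> < \<beta>" and u: "u \<in> X"
  shows "Fl u \<in> C_curves (besov n \<alpha> p) (besov_norm n \<alpha> p)"
proof -
  let ?R = "mass u" and ?th = "(\<beta> - \<alpha>) / \<beta>"
  have th: "0 < ?th" using \<alpha> by simp
  obtain C where C: "0 \<le> C" and F1: "\<And>(v::real \<Rightarrow> 'a \<Rightarrow> 'a) t. v \<in> X \<Longrightarrow> mass v \<le> ?R \<Longrightarrow> t \<in> {0..1} \<Longrightarrow> Fl v t \<in> besov n \<alpha> p"
    and F2: "\<And>(w::real \<Rightarrow> 'a \<Rightarrow> 'a) v t s d. w \<in> X \<Longrightarrow> v \<in> X \<Longrightarrow> mass w \<le> ?R \<Longrightarrow> mass v \<le> ?R \<Longrightarrow>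
      t \<in> {0..1} \<Longrightarrow> s \<in> {0..1} \<Longrightarrow> 0 < d \<Longrightarrow> bd n d (\<lambda>x. Fl v t x - Fl w s x) \<Longrightarrow>
      besov_norm n \<alpha> p (Fl v t - Fl w s) \<le> ennreal (d + C * d powr ?th)"
    using flow_besov[OF \<alpha> mass_nonneg[of u], where 'a='a] by blast
  note F = F1[OF u order.refl] F2[OF u u order.refl order.refl]
  obtain c where c: "0 \<le> c" and T: "\<And>a b. 0 \<le> a \<Longrightarrow> a \<le> b \<Longrightarrow> b \<le> 1 \<Longrightarrow> bd n (c * lint a b (\<lambda>s. bnorm (u s))) (\<lambda>x. Fl u b x - Fl u a x)"
    using flow_time[of ?R, where 'a='a] u by blast
  define k where "k t = lint 0 t (\<lambda>s. bnorm (u s))" for t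
  have kc: "continuous_on {0..1} k" unfolding k_def
    by (rule indefinite_integral_continuous_real[OF X_bnorm_integrable[OF u]])
  have ki: "lint a b (\<lambda>s. bnorm (u s)) = k b - k a" if "0 \<le> a" "a \<le> b" "b \<le> 1" for a b
    using lint_combine[of 0 b "\<lambda>s. bnorm (u s)" a] that integrable_sub[OF X_bnorm_integrable[OF u], of 0 b] by (simp add: k_def)
  have bdd: "bd n (c * \<bar>k s - k t\<bar>) (\<lambda>x. Fl u s x - Fl u t x)" if st: "s \<in> {0..1}" "t \<in> {0..1}" for s t
  proof (cases "t \<le> s")
    case True
    have "0 \<le> k s - k t" using ki[of t s] mass_le(2)[OF u, of t s] True st by simp
    then show ?thesis using T[of t s] ki[of t s] True st by simp
  next
    case False
    have "0 \<le> k t - k s" using ki[of s t] mass_le(2)[OF u, of s t] False st by simp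
    then have "bd n (c * \<bar>k s - k t\<bar>) (\<lambda>x. Fl u t x - Fl u s x)" using T[of s t] ki[of s t] False st by simp
    from cls_scaleR[OF this, of "-1"] show ?thesis by simp
  qed
  have "((\<lambda>s. besov_norm n \<alpha> p (Fl u s - Fl u t)) \<longlongrightarrow> 0) (at t within {0..1})" if t: "t \<in> {0..1}" for t
  proof (rule tendsto_sandwich[OF _ _ tendsto_const])
    \<comment> \<open>The summand \<open>\<bar>s - t\<bar>\<close> makes \<open>?d s\<close>
      positive for \<open>s \<noteq> t\<close>, as interpolation requires, and vanishes in the
      limit.\<close>
    let ?d = "\<lambda>s. c * \<bar>k s - k t\<bar> + \<bar>s - t\<bar>"
    have "(k \<longlongrightarrow> k t) (at t within {0..1})" using kc t by (simp add: continuous_on)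
    then have d0: "(?d \<longlongrightarrow> 0) (at t within {0..1})" by (auto intro!: tendsto_eq_intros)
    then have "((\<lambda>s. ?d s powr ?th) \<longlongrightarrow> 0 powr ?th) (at t within {0..1})"
      using th c by (intro tendsto_powr' tendsto_const) (auto intro!: always_eventually)
    then have "((\<lambda>s. ?d s + C * ?d s powr ?th) \<longlongrightarrow> 0 + C * (0 powr ?th)) (at t within {0..1})"
      by (intro tendsto_add d0 tendsto_mult tendsto_const)
    from tendsto_ennrealI[OF this] show "((\<lambda>s. ennreal (?d s + C * ?d s powr ?th)) \<longlongrightarrow> 0) (at t within {0..1})" by simp
    have "besov_norm n \<alpha> p (Fl u s - Fl u t) \<le> ennreal (?d s + C * ?d s powr ?th)" if s: "s \<in> {0..1}" "s \<noteq> t" for s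
    proof (rule F(2)[OF s(1) t])
      show "0 < ?d s" using s(2) c by (intro add_nonneg_pos) auto
      show "bd n (?d s) (\<lambda>x. Fl u s x - Fl u t x)" by (rule cls_mono[OF bdd[OF s(1) t]]) auto
    qed
    then show "\<forall>\<^sub>F s in at t within {0..1}. besov_norm n \<alpha> p (Fl u s - Fl u t) \<le> ennreal (?d s + C * ?d s powr ?th)"
      by (auto simp: eventually_at_filter)
  qed simp
  then show ?thesis using F(1) by (simp add: C_curves_def)
qed

lemma mass_tri:
  assumes u: "u \<in> X" and v: "v \<in> X"
  shows "mass v \<le> mass u + mass (v - u)"
proof -
  have "mass v \<le> lint 0 1 (\<lambda>t. bnorm (u t) + bnorm ((v - u) t))"
    unfolding mass_def
  proof (rule lint_mono)
    show "bnorm (v t) \<le> bnorm (u t) + bnorm ((v - u) t)" if "t \<in> {0..1}" for t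
      using bnorm_tri[OF X_V[OF v that] X_V[OF u that]] by simp
  qed (intro Bochner_Integration.integrable_add X_bnorm_integrable u v X_diff)+
  also have "\<dots> = mass u + mass (v - u)" unfolding mass_def
    by (rule Bochner_Integration.integral_add) (intro X_bnorm_integrable u v X_diff)+
  finally show ?thesis .
qed

lemma L1_mass: "u \<in> X \<Longrightarrow> L1_norm N u = ennreal (mass u)"
  unfolding mass_def by (rule X_L1_norm)

text \<open>A \<open>C\<^sup>n\<close> distance of order \<open>mass (v - u) powr \<gamma>\<close>
  is interpolated against the uniform bound of order \<beta>; smaller exponents \<open>r\<close>
  follow because the masses are bounded.\<close>

lemma flow_holder:
  assumes \<alpha>: "0 < \<alpha>" "\<alpha> < \<beta>" and R: "0 \<le> R" and r: "0 < r" "r \<le> \<gamma> * ((\<beta> - \<alpha>) / \<beta>)"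
  shows "\<exists>C\<ge>0. \<forall>u v::real \<Rightarrow> 'a::euclidean_space \<Rightarrow> 'a. u \<in> X \<longrightarrow> v \<in> X \<longrightarrow> mass u \<le> R \<longrightarrow> mass v \<le> R \<longrightarrow>
    C_norm (besov_norm n \<alpha> p) (Fl v - Fl u) \<le> ennreal (C * mass (v - u) powr r)"
proof -
  let ?th = "(\<beta> - \<alpha>) / \<beta>"
  have th: "0 < ?th" "?th \<le> 1" using \<alpha> by auto
  obtain C where C: "0 \<le> C" and F: "\<And>(u::real \<Rightarrow> 'a \<Rightarrow> 'a) v t s d. u \<in> X \<Longrightarrow> v \<in> X \<Longrightarrow> mass u \<le> R \<Longrightarrow> mass v \<le> R \<Longrightarrow>
      t \<in> {0..1} \<Longrightarrow> s \<in> {0..1} \<Longrightarrow> 0 < d \<Longrightarrow> bd n d (\<lambda>x. Fl v t x - Fl u s x) \<Longrightarrow>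
      besov_norm n \<alpha> p (Fl v t - Fl u s) \<le> ennreal (d + C * d powr ?th)"
    using flow_besov[OF \<alpha> R, where 'a='a] by blast
  obtain c where c: "0 \<le> c" and D: "\<And>(u::real \<Rightarrow> 'a \<Rightarrow> 'a) v t. u \<in> X \<Longrightarrow> v \<in> X \<Longrightarrow> mass u \<le> R \<Longrightarrow> mass v \<le> R \<Longrightarrow>
      t \<in> {0..1} \<Longrightarrow> bd n (c * mass (v - u) powr \<gamma>) (\<lambda>x. Fl v t x - Fl u t x)"
    using flow_diff[OF R, where 'a='a] by blast
  define E where "E = 2 * R + 1"
  have E: "1 \<le> E" using R by (simp add: E_def)
  \<comment> \<open>The powers \<gamma> and \<open>\<gamma> * ?th\<close> of a number
    \<open>d \<le> E\<close> are both lowered to \<open>r\<close>, at the price of a power of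
    \<open>E\<close>.\<close>
  define K where "K = (c + 1) * E powr (\<gamma> - r) + C * (c + 1) powr ?th * E powr (\<gamma> * ?th - r)"
  have K: "0 \<le> K" using c C by (simp add: K_def)
  have "\<gamma> * ?th \<le> \<gamma> * 1" using th \<gamma>1 by (intro mult_left_mono) auto
  then have rg: "r \<le> \<gamma>" using r by simp
  have "besov_norm n \<alpha> p (Fl v t - Fl u t) \<le> ennreal (K * mass (v - u) powr r)"
    if u: "u \<in> X" and v: "v \<in> X" and uR: "mass u \<le> R" and vR: "mass v \<le> R" and t: "t \<in> {0..1}" for u v :: "real \<Rightarrow> 'a \<Rightarrow> 'a" and t
  proof -
    let ?e = "mass (v - u)"
    let ?L = "besov_norm n \<alpha> p (Fl v t - Fl u t)"
    have e2: "?e \<le> 2 * R" using mass_diff[OF u v] uR vR by simp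
    have key: "?L \<le> ennreal (K * d powr r)" if d: "0 < d" "?e \<le> d" "d \<le> E" for d
    proof -
      let ?d = "(c + 1) * d powr \<gamma>"
      have pw: "d powr x \<le> E powr (x - r) * d powr r" if "r \<le> x" for x
      proof -
        have "d powr x = d powr (x - r) * d powr r" using d by (simp flip: powr_add)
        also have "\<dots> \<le> E powr (x - r) * d powr r" using d that by (intro mult_right_mono powr_mono2) auto
        finally show ?thesis .
      qed
      have b: "bd n ?d (\<lambda>x. Fl v t x - Fl u t x)"
      proof (rule cls_mono[OF D[OF u v uR vR t]])
        show "c * ?e powr \<gamma> \<le> ?d" using c d \<gamma>1 by (intro mult_mono powr_mono2) auto
        then show "4 * (c * ?e powr \<gamma>) \<le> 4 * ?d" by simp
      qed
      have L: "?L \<le> ennreal (?d + C * ?d powr ?th)" by (rule F[OF u v uR vR t t _ b]) (use c d in simp)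
      have "?d + C * ?d powr ?th = (c + 1) * d powr \<gamma> + C * (c + 1) powr ?th * d powr (\<gamma> * ?th)"
        using c by (simp add: powr_mult powr_powr)
      also have "\<dots> \<le> (c + 1) * (E powr (\<gamma> - r) * d powr r) + C * (c + 1) powr ?th * (E powr (\<gamma> * ?th - r) * d powr r)"
        using c C r rg by (intro add_mono mult_left_mono pw) auto
      also have "\<dots> = K * d powr r" by (simp add: K_def algebra_simps)
      finally show ?thesis by (intro order_trans[OF L] ennreal_leI)
    qed
    show ?thesis
    proof (cases "?e = 0")
      case False
      then show ?thesis using key[of ?e] e2 mass_nonneg[of "v - u"] by (simp add: E_def del: mass_nonneg)
    next
      case True
      \<comment> \<open>Interpolation needs a positive \<open>d\<close>, so mass 0 is reached as the
        limit of \<open>d = 1 / Suc i\<close>; these numbers lie below \<open>E\<close> because of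
        its summand 1.\<close>
      have "(\<lambda>i. (1 / real (Suc i)) powr r) \<longlonglongrightarrow> 0 powr r"
        by (rule tendsto_powr') (use r LIMSEQ_inverse_real_of_nat in \<open>auto simp: inverse_eq_divide\<close>)
      then have "(\<lambda>i. K * (1 / real (Suc i)) powr r) \<longlonglongrightarrow> K * 0 powr r" by (intro tendsto_mult tendsto_const)
      from tendsto_ennrealI[OF this] have "?L \<le> ennreal (K * 0 powr r)"
      proof (rule LIMSEQ_le_const)
        have "?L \<le> ennreal (K * (1 / real (Suc i)) powr r)" for i
        proof (rule key)
          have "1 / real (Suc i) \<le> 1" by simp
          then show "1 / real (Suc i) \<le> E" using E by linarith
        qed (use True in auto)
        then show "\<exists>N. \<forall>i\<ge>N. ?L \<le> ennreal (K * (1 / real (Suc i)) powr r)" by blast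
      qed
      then show ?thesis using True by simp
    qed
  qed
  then have "C_norm (besov_norm n \<alpha> p) (Fl v - Fl u) \<le> ennreal (K * mass (v - u) powr r)"
    if "u \<in> X" "v \<in> X" "mass u \<le> R" "mass v \<le> R" for u v :: "real \<Rightarrow> 'a \<Rightarrow> 'a"
    unfolding C_norm_def using that by (intro SUP_least) simp
  then show ?thesis using K by blast
qed

lemma flow_holder_on_bounded:
  assumes \<alpha>: "0 < \<alpha>" "\<alpha> < \<beta>" and r: "0 < r" "r \<le> \<gamma> * ((\<beta> - \<alpha>) / \<beta>)"
  shows "holder_on_bounded r (X :: (real \<Rightarrow> 'a::euclidean_space \<Rightarrow> 'a) set) (L1_norm N) (C_norm (besov_norm n \<alpha> p)) Fl"
  unfolding holder_on_bounded_def
proof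
  fix R :: real
  \<comment> \<open>\<open>ennreal\<close> maps a negative \<open>R\<close> to 0, so bounded sets
    are described by \<open>max R 0\<close>.\<close>
  have R: "0 \<le> max R 0" by simp
  obtain C where C: "0 \<le> C" and F: "\<And>u v::real \<Rightarrow> 'a \<Rightarrow> 'a. u \<in> X \<Longrightarrow> v \<in> X \<Longrightarrow> mass u \<le> max R 0 \<Longrightarrow> mass v \<le> max R 0 \<Longrightarrow>
    C_norm (besov_norm n \<alpha> p) (Fl v - Fl u) \<le> ennreal (C * mass (v - u) powr r)"
    using flow_holder[OF \<alpha> R r, where 'a='a] by blast
  have main: "C_norm (besov_norm n \<alpha> p) (Fl v - Fl u) \<le> ennreal C * ennpowr (L1_norm N (v - u)) r"
    if u: "u \<in> X" and v: "v \<in> X" and le: "L1_norm N u \<le> ennreal R" "L1_norm N v \<le> ennreal R" for u v :: "real \<Rightarrow> 'a \<Rightarrow> 'a"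
  proof -
    have m: "mass w \<le> max R 0" if "w \<in> X" "L1_norm N w \<le> ennreal R" for w :: "real \<Rightarrow> 'a \<Rightarrow> 'a"
    proof -
      have "ennreal (mass w) \<le> ennreal R" using that L1_mass[of w] by simp
      also have "\<dots> \<le> ennreal (max R 0)" by (rule ennreal_leI) simp
      finally show ?thesis by (subst (asm) ennreal_le_iff) auto
    qed
    have "ennreal (C * mass (v - u) powr r) = ennreal C * ennpowr (L1_norm N (v - u)) r"
      using C by (simp add: L1_mass[OF X_diff[OF v u]] ennpowr_ennreal ennreal_mult)
    then show ?thesis using F[OF u v m[OF u le(1)] m[OF v le(2)]] by metis
  qed
  show "\<exists>C. 0 \<le> C \<and> (\<forall>u\<in>X :: (real \<Rightarrow> 'a \<Rightarrow> 'a) set. \<forall>v\<in>X. L1_norm N u \<le> ennreal R \<longrightarrow> L1_norm N v \<le> ennreal R \<longrightarrow>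
      C_norm (besov_norm n \<alpha> p) (Fl v - Fl u) \<le> ennreal C * ennpowr (L1_norm N (v - u)) r)"
    by (intro exI[of _ C] conjI ballI impI C main)
qed

lemma flow_norm_continuous:
  assumes \<alpha>: "0 < \<alpha>" "\<alpha> < \<beta>"
  shows "norm_continuous_on (X :: (real \<Rightarrow> 'a::euclidean_space \<Rightarrow> 'a) set) (L1_norm N) (C_norm (besov_norm n \<alpha> p)) Fl"
  unfolding norm_continuous_on_def
proof (intro ballI allI impI)
  fix u :: "real \<Rightarrow> 'a \<Rightarrow> 'a" and \<epsilon> :: ennreal
  assume u: "u \<in> X" and \<epsilon>: "0 < \<epsilon>"
  \<comment> \<open>The Hoelder constant belongs to masses up to \<open>?R\<close>, which includes
    every \<open>v\<close> within distance 1 of \<open>u\<close>.\<close>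
  let ?r = "\<gamma> * ((\<beta> - \<alpha>) / \<beta>)" and ?R = "mass u + 1"
  have r: "0 < ?r" using \<alpha> \<gamma> by simp
  have R: "0 \<le> ?R" using mass_nonneg[of u] by linarith
  obtain C where C: "0 \<le> C" and F: "\<And>u v::real \<Rightarrow> 'a \<Rightarrow> 'a. u \<in> X \<Longrightarrow> v \<in> X \<Longrightarrow> mass u \<le> ?R \<Longrightarrow> mass v \<le> ?R \<Longrightarrow>
    C_norm (besov_norm n \<alpha> p) (Fl v - Fl u) \<le> ennreal (C * mass (v - u) powr ?r)"
    using flow_holder[OF \<alpha> R r order.refl, where 'a='a] by blast
  \<comment> \<open>\<epsilon> may be infinite; it is cut off at 1 to obtain a real number.\<close>
  define e where "e = enn2real (min \<epsilon> 1)"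
  have fin: "min \<epsilon> 1 < top" by (rule le_less_trans[of _ 1]) auto
  then have "ennreal e = min \<epsilon> 1" by (simp add: e_def)
  then have e: "0 < e" "ennreal e \<le> \<epsilon>"
    using \<epsilon> fin by (auto simp: e_def enn2real_positive_iff)
  \<comment> \<open>The second argument solves \<open>(C + 1) * d powr ?r = e\<close>; the minimum
    with 1 keeps the mass of \<open>v\<close> below \<open>?R\<close>.\<close>
  define d where "d = min 1 ((e / (C + 1)) powr (1 / ?r))"
  have d: "0 < d" "d \<le> 1" using e C by (auto simp: d_def)
  have "C_norm (besov_norm n \<alpha> p) (Fl v - Fl u) < \<epsilon>" if v: "v \<in> X" and lt: "L1_norm N (v - u) < ennreal d" for v
  proof -
    have m: "mass (v - u) < d" using lt d by (simp add: L1_mass[OF X_diff[OF v u]] ennreal_less_iff)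
    have "mass v \<le> ?R" using mass_tri[OF u v] m d by simp
    then have "C_norm (besov_norm n \<alpha> p) (Fl v - Fl u) \<le> ennreal (C * mass (v - u) powr ?r)"
      by (intro F u v) simp
    also have "ennreal (C * mass (v - u) powr ?r) < ennreal e"
    proof -
      have "mass (v - u) powr ?r \<le> ((e / (C + 1)) powr (1 / ?r)) powr ?r"
        using m r by (intro powr_mono2) (auto simp: d_def)
      also have "((e / (C + 1)) powr (1 / q)) powr q = e / (C + 1)" if "0 < q" for q
        using e C that by (simp add: powr_powr)
      note this[OF r]
      finally have "C * mass (v - u) powr ?r \<le> C * (e / (C + 1))" using C by (rule mult_left_mono)
      also have "\<dots> < e" using e C by (simp add: divide_less_eq)
      finally show ?thesis using C by (simp add: ennreal_less_iff)
    qed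
    also note e(2)
    finally show ?thesis .
  qed
  then show "\<exists>\<delta>>0. \<forall>v\<in>X. L1_norm N (v - u) < \<delta> \<longrightarrow> C_norm (besov_norm n \<alpha> p) (Fl v - Fl u) < \<epsilon>"
    using d by (intro exI[of _ "ennreal d"]) auto
qed

end

theorem theorem2:
  fixes \<alpha> \<beta> :: real and n :: nat and p :: ennreal
    and X :: "(real \<Rightarrow> (real ^ 'd) \<Rightarrow> (real ^ 'd)) set"
  assumes "0 < \<alpha>" and "\<alpha> < \<beta>" and "\<beta> \<le> 1" and "2 \<le> n" and "1 \<le> p"
  defines "X \<equiv> L1_curves (besov n \<beta> p) (besov_norm n \<beta> p)"
  shows "(\<forall>u\<in>X. \<exists>!\<Phi>. is_flow u \<Phi>) \<and>
         Fl ` X \<subseteq> C_curves (besov n \<alpha> p) (besov_norm n \<alpha> p) \<and>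
         norm_continuous_on X (L1_norm (besov_norm n \<beta> p)) (C_norm (besov_norm n \<alpha> p)) Fl \<and>
         (\<forall>\<gamma>. 0 < \<gamma> \<and> \<gamma> < \<beta> - \<alpha> \<longrightarrow>
            holder_on_bounded \<gamma> X (L1_norm (besov_norm n \<beta> p)) (C_norm (besov_norm n \<alpha> p)) Fl)"
proof -
  have b0: "0 < \<beta>" using assms by simp
  \<comment> \<open>Existence and continuity ask for no particular rate, so some exponent strictly
    between \<beta> / 2 and \<beta> is fixed.\<close>
  interpret b: besov_setting n \<beta> "3 / 4 * \<beta>" p
    by unfold_locales (use assms b0 in auto)
  have "\<exists>!\<Phi>. is_flow u \<Phi>" if "u \<in> X" for u
    using b.flow_bound[of "b.mass u", where 'a="real ^ 'd"] that unfolding X_def by blast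
  moreover have "Fl ` X \<subseteq> C_curves (besov n \<alpha> p) (besov_norm n \<alpha> p)"
    using b.flow_continuous_curve[OF assms(1,2)] unfolding X_def by blast
  moreover have "norm_continuous_on X (L1_norm (besov_norm n \<beta> p)) (C_norm (besov_norm n \<alpha> p)) Fl"
    unfolding X_def by (rule b.flow_norm_continuous[OF assms(1,2)])
  moreover have "holder_on_bounded \<gamma> X (L1_norm (besov_norm n \<beta> p)) (C_norm (besov_norm n \<alpha> p)) Fl"
    if \<gamma>: "0 < \<gamma>" "\<gamma> < \<beta> - \<alpha>" for \<gamma>
  proof -
    \<comment> \<open>Interpolation multiplies the exponent by
      \<open>(\<beta> - \<alpha>) / \<beta>\<close>, so
      \<open>\<gamma> * \<beta> / (\<beta> - \<alpha>)\<close> is what yields \<gamma>; it is below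
      \<beta> exactly since \<gamma> < \<beta> - \<alpha>, and the maximum keeps the choice above
      \<beta> / 2.\<close>
    let ?g = "max (3 / 4 * \<beta>) (\<gamma> * \<beta> / (\<beta> - \<alpha>))"
    have "\<gamma> * \<beta> / (\<beta> - \<alpha>) < \<beta>" using \<gamma> assms b0 by (simp add: divide_less_eq mult.commute)
    then have g: "0 < ?g" "?g < \<beta>" "\<beta> < 2 * ?g" using b0 by (auto simp: less_max_iff_disj)
    interpret c: besov_setting n \<beta> ?g p
      by unfold_locales (use assms g in auto)
    have "\<gamma> = (\<gamma> * \<beta> / (\<beta> - \<alpha>)) * ((\<beta> - \<alpha>) / \<beta>)" using assms b0 by simp
    also have "\<dots> \<le> ?g * ((\<beta> - \<alpha>) / \<beta>)" using assms b0 by (intro mult_right_mono) auto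
    finally show ?thesis unfolding X_def by (rule c.flow_holder_on_bounded[OF assms(1,2) \<gamma>(1)])
  qed
  ultimately show ?thesis by blast
qed

end
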